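(* The map on $U_M\backslash N'$ induced by $\mathcal N$, that is, the map $$R\longrightarrow M,\qquad (c_0,\dots,c_5)\longmapsto \mathcal N\Big(\prod_{i=0}^5x_{\gamma_i}(c_i)\Big),$$ is étale onto its image of degree $2$.
   Context: $F$ is a $p$-adic field. $G$ is the split simply connected group of type $E_6$ over $F$ with a fixed $F$-splitting $(B=AU,A,\{x_\alpha\})$, extended to a Chevalley system of root subgroups $x_\beta$ for all roots $\beta$. Simple roots $\alpha_1,\dots,\alpha_6$ are in Bourbaki's labelling (chain $\alpha_1,\alpha_3,\alpha_4,\alpha_5,\alpha_6$, with $\alpha_2$ attached to $\alpha_4$), and $(abcdef)$ denotes $a\alpha_1+\cdots+f\alpha_6$. $P=MN$ is the standard maximal parabolic subgroup obtained by deleting $\alpha_2$, $\overline N$ the opposite of $N$, $U_M=U\cap M$. Set $\gamma_0=(122321)$, $\gamma_1=(112321)$, $\gamma_2=(112221)$, $\gamma_3=(111211)$, $\gamma_4=(011210)$, $\gamma_5=(010000)$. $\dot w_0=\dot w_G\dot w_M^{-1}$, where $\dot w_G,\dot w_M$ are the products along reduced decompositions of the longest Weyl elements of $G,M$ of $\dot s_i=x_{\alpha_i}(1)x_{-\alpha_i}(-1)x_{\alpha_i}(1)$. The map $\mathcal N$ sends $n$ to the $M$-component $m$ in the decomposition $\dot w_0^{-1}n=mn'\overline n$, $m\in M,n'\in N,\overline n\in\overline N$. $R\subset\mathbb A^6$ is the open subset $$R=\{(c_0,\dots,c_5):c_i\ne0,\ c_0-c_1c_5\ne0,\ c_0(c_0-c_1c_5)-c_2c_3c_4c_5\ne0,\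 2c_0^2(c_3c_4+c_2c_5)-2c_2c_3^2c_4^2c_5+c_0c_1c_5^2(c_4-c_2)\ne0\},$$ and $N'\subset N$ is the corresponding saturated open subset, i.e. the set of $U_M$-conjugates of the points $\prod_{i=0}^5x_{\gamma_i}(c_i)$, $c\in R$; thus $R$ is identified with the geometric quotient $U_M\backslash N'$ ($U_M$ acting freely by conjugation).
   Formalization: The Chevalley system is assumed to have the two signs (for γ1+γ5=γ0 and −γ0+γ2+γ3+γ4+γ5=γ0) for which the map 𝒩 is defined on all of R; for the other sign choices 𝒩 is undefined at some points of R. *)

theory Defs
  imports
    "HOL-Algebra.Algebraic_Closure_Type"
    "HOL-Algebra.Generated_Groups"
    "HOL-Library.Poly_Mapping"
    "Jordan_Normal_Form.Determinant"
begin

no_notation fps_nth (infixl \<open>$\<close> 75)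

section \<open>The base field\<close>

text \<open>
  A \<open>p\<close>-adic field, as a field of characteristic 0 that is complete with respect to a nontrivial
  discrete non-archimedean absolute value with finite residue field.
\<close>

definition p_adic_field :: "('f::field_char_0 \<Rightarrow> real) \<Rightarrow> bool" where
  "p_adic_field absv \<longleftrightarrow>
     (\<forall>a. 0 \<le> absv a \<and> (absv a = 0 \<longleftrightarrow> a = 0)) \<and>
     (\<forall>a b. absv (a * b) = absv a * absv b) \<and>
     (\<forall>a b. absv (a + b) \<le> max (absv a) (absv b)) \<and>
     (\<exists>p. 0 < absv p \<and> absv p < 1 \<and> (\<forall>a. a \<noteq> 0 \<longrightarrow> (\<exists>k::int. absv a = absv p powi k))) \<and>
     (\<forall>s :: nat \<Rightarrow> 'f.
        (\<forall>e>0. \<exists>n0. \<forall>m\<ge>n0. \<forall>n\<ge>n0. absv (s m - s n) < e) \<longrightarrow>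
        (\<exists>l. \<forall>e>0. \<exists>n0. \<forall>n\<ge>n0. absv (s n - l) < e)) \<and>
     finite ((\<lambda>a. {b. absv (b - a) < 1}) ` {a. absv a \<le> 1})"


section \<open>Varieties over \<open>F\<close> and etale morphisms\<close>

text \<open>
  A reduced \<open>F\<close>-variety inside an affine space over \<open>F\<close> is represented by its set of points over
  the algebraic closure of \<open>F\<close>. In characteristic 0 reduced means geometrically reduced, so its
  structure sheaf over \<open>F\<close> is faithfully represented by functions on these points that are
  locally quotients of polynomials with coefficients in \<open>F\<close>. All polynomials, open sets and closed
  sets below are over \<open>F\<close>.
\<close>

record ('p, 'k) aff_space =
  points :: "'p set"
  coordinates :: "('p \<Rightarrow> 'k) set"

inductive_set polyfuns :: "('p, 'f::field alg_closure) aff_space \<Rightarrow> ('p \<Rightarrow> 'f alg_closure) set"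
  for S where
  const: "(\<lambda>_. to_ac a) \<in> polyfuns S"
| coord: "y \<in> coordinates S \<Longrightarrow> y \<in> polyfuns S"
| add: "g \<in> polyfuns S \<Longrightarrow> h \<in> polyfuns S \<Longrightarrow> (\<lambda>p. g p + h p) \<in> polyfuns S"
| mult: "g \<in> polyfuns S \<Longrightarrow> h \<in> polyfuns S \<Longrightarrow> (\<lambda>p. g p * h p) \<in> polyfuns S"

definition zar_closed :: "('p, 'f::field alg_closure) aff_space \<Rightarrow> 'p set \<Rightarrow> bool" where
  "zar_closed S Z \<longleftrightarrow> (\<exists>G. G \<subseteq> polyfuns S \<and> Z = {p \<in> points S. \<forall>g\<in>G. g p = 0})"

definition zar_openin :: "('p, 'f::field alg_closure) aff_space \<Rightarrow> 'p set \<Rightarrow> 'p set \<Rightarrow> bool" where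
  "zar_openin S W U \<longleftrightarrow> (\<exists>Z. zar_closed S Z \<and> U = W - Z)"

definition locally_closed :: "('p, 'f::field alg_closure) aff_space \<Rightarrow> 'p set \<Rightarrow> bool" where
  "locally_closed S W \<longleftrightarrow> (\<exists>Z. zar_closed S Z \<and> zar_openin S Z W)"

text \<open>
  Principal open subsets of closed subvarieties. They are affine varieties, and they form a basis
  of the topology of every locally closed subvariety.
\<close>

definition principal_affine :: "('p, 'f::field alg_closure) aff_space \<Rightarrow> 'p set \<Rightarrow> bool" where
  "principal_affine S U \<longleftrightarrow>
     (\<exists>Z h. zar_closed S Z \<and> h \<in> polyfuns S \<and> U = {p \<in> Z. h p \<noteq> 0})"

text \<open>The ring of regular functions on \<open>W\<close>, extended by 0 outside \<open>W\<close>.\<close>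

definition regular_funs ::
  "('p, 'f::field alg_closure) aff_space \<Rightarrow> 'p set \<Rightarrow> ('p \<Rightarrow> 'f alg_closure) set" where
  "regular_funs S W =
     {\<phi>. (\<forall>p. p \<notin> W \<longrightarrow> \<phi> p = 0) \<and>
         (\<forall>p\<in>W. \<exists>g\<in>polyfuns S. \<exists>h\<in>polyfuns S. h p \<noteq> 0 \<and>
            (\<forall>q\<in>W. h q \<noteq> 0 \<longrightarrow> \<phi> q = g q / h q))}"

definition morphism ::
  "('p, 'f::field alg_closure) aff_space \<Rightarrow> 'p set \<Rightarrow> ('q, 'f alg_closure) aff_space \<Rightarrow> 'q set \<Rightarrow>
   ('p \<Rightarrow> 'q) \<Rightarrow> bool" where
  "morphism S W T Y f \<longleftrightarrow> f ` W \<subseteq> Y \<and>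
     (\<forall>y\<in>coordinates T. (\<lambda>p. if p \<in> W then y (f p) else 0) \<in> regular_funs S W)"

type_synonym 'k mpoly = "(nat \<Rightarrow>\<^sub>0 nat) \<Rightarrow>\<^sub>0 'k"

definition mpoly_eval :: "'k::comm_ring_1 mpoly \<Rightarrow> (nat \<Rightarrow> 'k) \<Rightarrow> 'k" where
  "mpoly_eval p t = (\<Sum>m\<in>Poly_Mapping.keys p.
     Poly_Mapping.lookup p m * (\<Prod>i\<in>Poly_Mapping.keys m. t i ^ Poly_Mapping.lookup m i))"

definition mpoly_deriv :: "nat \<Rightarrow> 'k::comm_ring_1 mpoly \<Rightarrow> 'k mpoly" where
  "mpoly_deriv j p = (\<Sum>m\<in>Poly_Mapping.keys p.
     Poly_Mapping.single (m - Poly_Mapping.single j 1)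
       (of_nat (Poly_Mapping.lookup m j) * Poly_Mapping.lookup p m))"

text \<open>
  The polynomial ring \<open>O(V)[T\<^sub>0, \<dots>, T\<^sub>n\<^sub>-\<^sub>1]\<close>: a polynomial is given by the family of its values at the
  points of \<open>V\<close>, with bounded support and regular coefficients.
\<close>

definition regular_polys ::
  "('q, 'f::field alg_closure) aff_space \<Rightarrow> 'q set \<Rightarrow> nat \<Rightarrow> ('q \<Rightarrow> 'f alg_closure mpoly) set" where
  "regular_polys T V n =
     {P. (\<exists>D. finite D \<and> (\<forall>m\<in>D. Poly_Mapping.keys m \<subseteq> {..<n}) \<and>
           (\<forall>v. Poly_Mapping.keys (P v) \<subseteq> D)) \<and>
         (\<forall>m. (\<lambda>v. Poly_Mapping.lookup (P v) m) \<in> regular_funs T V)}"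

text \<open>
  \<open>O(U)\<close> is, via \<open>f\<close>, isomorphic to \<open>O(V)[T\<^sub>0, \<dots>, T\<^sub>n\<^sub>-\<^sub>1]/(P\<^sub>0, \<dots>, P\<^sub>n\<^sub>-\<^sub>1)\<close>, with \<open>T\<^sub>i\<close> corresponding to
  \<open>b\<^sub>i\<close>, and the Jacobian determinant of the \<open>P\<^sub>i\<close> is a unit of \<open>O(U)\<close>.
\<close>

definition etale_chart ::
  "('p, 'f::field alg_closure) aff_space \<Rightarrow> 'p set \<Rightarrow> ('q, 'f alg_closure) aff_space \<Rightarrow> 'q set \<Rightarrow>
   ('p \<Rightarrow> 'q) \<Rightarrow> bool" where
  "etale_chart S U T V f \<longleftrightarrow>
     (\<exists>n (b :: nat \<Rightarrow> 'p \<Rightarrow> 'f alg_closure) P.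
        (\<forall>i<n. b i \<in> regular_funs S U) \<and> (\<forall>i<n. P i \<in> regular_polys T V n) \<and>
        (\<forall>\<phi>\<in>regular_funs S U. \<exists>Q\<in>regular_polys T V n.
           \<forall>u\<in>U. \<phi> u = mpoly_eval (Q (f u)) (\<lambda>i. b i u)) \<and>
        (\<forall>Q\<in>regular_polys T V n.
           (\<forall>u\<in>U. mpoly_eval (Q (f u)) (\<lambda>i. b i u) = 0) \<longleftrightarrow>
           (\<exists>A. (\<forall>i<n. A i \<in> regular_polys T V n) \<and> Q = (\<lambda>v. \<Sum>i<n. A i v * P i v))) \<and>
        (\<forall>u\<in>U. det (mat n n (\<lambda>(i, j).
           mpoly_eval (mpoly_deriv j (P i (f u))) (\<lambda>i. b i u))) \<noteq> 0))"

definition etale ::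
  "('p, 'f::field alg_closure) aff_space \<Rightarrow> 'p set \<Rightarrow> ('q, 'f alg_closure) aff_space \<Rightarrow> 'q set \<Rightarrow>
   ('p \<Rightarrow> 'q) \<Rightarrow> bool" where
  "etale S W T Y f \<longleftrightarrow> morphism S W T Y f \<and>
     (\<forall>p\<in>W. \<exists>U V. p \<in> U \<and> zar_openin S W U \<and> principal_affine S U \<and>
        zar_openin T Y V \<and> principal_affine T V \<and> f ` U \<subseteq> V \<and> etale_chart S U T V f)"

text \<open>The image carries its structure of reduced locally closed subvariety.\<close>

definition etale_onto_image ::
  "('p, 'f::field alg_closure) aff_space \<Rightarrow> 'p set \<Rightarrow> ('q, 'f alg_closure) aff_space \<Rightarrow>
   ('p \<Rightarrow> 'q) \<Rightarrow> bool" where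
  "etale_onto_image S W T f \<longleftrightarrow> locally_closed T (f ` W) \<and> etale S W T (f ` W) f"

text \<open>The number of points of each geometric fibre over the image.\<close>

definition has_degree_onto_image :: "'p set \<Rightarrow> ('p \<Rightarrow> 'q) \<Rightarrow> nat \<Rightarrow> bool" where
  "has_degree_onto_image W f d \<longleftrightarrow> (\<forall>y \<in> f ` W. card {p \<in> W. f p = y} = d)"


section \<open>The root system \<open>E\<^sub>6\<close>\<close>

definition cartan :: "nat \<Rightarrow> nat \<Rightarrow> int" where
  "cartan i j =
     (if i = j then 2
      else if {i, j} \<in> {{1, 3}, {3, 4}, {4, 5}, {5, 6}, {2, 4}} then - 1 else 0)"

text \<open>
  The list \<open>[a, b, c, d, e, f]\<close> stands for \<open>(abcdef)\<close>; the coefficient of the \<open>i\<close>-th simple root is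
  at position \<open>i - 1\<close>.
\<close>

definition simple_root :: "nat \<Rightarrow> int list" where
  "simple_root i = map (\<lambda>j. if j = i then 1 else 0) [1..<7]"

text \<open>For roots this is the pairing of \<open>\<beta>\<close> with the coroot of \<open>\<alpha>\<close>, as \<open>E\<^sub>6\<close> is simply laced.\<close>

definition root_pairing :: "int list \<Rightarrow> int list \<Rightarrow> int" where
  "root_pairing \<beta> \<alpha> = (\<Sum>i\<in>{1..6}. \<Sum>j\<in>{1..6}. \<beta> ! (i - 1) * cartan i j * \<alpha> ! (j - 1))"

definition root_refl :: "int list \<Rightarrow> int list \<Rightarrow> int list" where
  "root_refl \<alpha> \<beta> = map2 (\<lambda>b a. b - root_pairing \<beta> \<alpha> * a) \<beta> \<alpha>"

inductive_set roots :: "int list set" where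
  simple: "i \<in> {1..6} \<Longrightarrow> simple_root i \<in> roots"
| refl: "\<beta> \<in> roots \<Longrightarrow> i \<in> {1..6} \<Longrightarrow> root_refl (simple_root i) \<beta> \<in> roots"

definition neg_root :: "int list \<Rightarrow> int list" where
  "neg_root = map uminus"

definition pos_roots :: "nat set \<Rightarrow> int list set" where
  "pos_roots J = {\<beta> \<in> roots. (\<forall>b \<in> set \<beta>. 0 \<le> b) \<and> (\<forall>i\<in>{1..6} - J. \<beta> ! (i - 1) = 0)}"

definition weyl_word :: "nat list \<Rightarrow> int list \<Rightarrow> int list" where
  "weyl_word ws = foldr (\<lambda>i. root_refl (simple_root i)) ws"

definition reduced_word :: "nat list \<Rightarrow> bool" where
  "reduced_word ws \<longleftrightarrow> set ws \<subseteq> {1..6} \<and>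
     (\<forall>vs. set vs \<subseteq> {1..6} \<and> (\<forall>\<beta>\<in>roots. weyl_word vs \<beta> = weyl_word ws \<beta>) \<longrightarrow>
        length ws \<le> length vs)"

text \<open>
  Reduced decompositions of the longest element of the parabolic subgroup of the Weyl group
  generated by the simple reflections in \<open>J\<close>.
\<close>

definition longest_reduced_word :: "nat set \<Rightarrow> nat list \<Rightarrow> bool" where
  "longest_reduced_word J ws \<longleftrightarrow> reduced_word ws \<and> set ws \<subseteq> J \<and>
     (\<forall>\<beta>\<in>pos_roots J. neg_root (weyl_word ws \<beta>) \<in> pos_roots J)"


section \<open>The split simply connected group of type \<open>E\<^sub>6\<close>\<close>

text \<open>
  The group is realized on the 27-dimensional minuscule representation with highest weight the
  first fundamental weight. Its weights generate the full weight lattice, so the Chevalley group of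
  this representation is the simply connected one. The weights are listed by their pairings with
  the six simple coroots.
\<close>

definition weights :: "int list list" where
  "weights =
    [[ 1, 0, 0, 0, 0, 0], [-1, 0, 1, 0, 0, 0], [ 0, 0,-1, 1, 0, 0], [ 0, 1, 0,-1, 1, 0],
     [ 0,-1, 0, 0, 1, 0], [ 0, 1, 0, 0,-1, 1], [ 0,-1, 0, 1,-1, 1], [ 0, 1, 0, 0, 0,-1],
     [ 0, 0, 1,-1, 0, 1], [ 0,-1, 0, 1, 0,-1], [ 1, 0,-1, 0, 0, 1], [ 0, 0, 1,-1, 1,-1],
     [-1, 0, 0, 0, 0, 1], [ 1, 0,-1, 0, 1,-1], [ 0, 0, 1, 0,-1, 0], [-1, 0, 0, 0, 1,-1],
     [ 1, 0,-1, 1,-1, 0], [-1, 0, 0, 1,-1, 0], [ 1, 1, 0,-1, 0, 0], [-1, 1, 1,-1, 0, 0],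
     [ 1,-1, 0, 0, 0, 0], [-1,-1, 1, 0, 0, 0], [ 0, 1,-1, 0, 0, 0], [ 0,-1,-1, 1, 0, 0],
     [ 0, 0, 0,-1, 1, 0], [ 0, 0, 0, 0,-1, 1], [ 0, 0, 0, 0, 0,-1]]"

text \<open>
  \<open>raising_mat i\<close> sends the weight vector of weight \<open>\<mu>\<close> to the one of weight \<open>\<mu> + \<alpha>\<^sub>i\<close> if this is a
  weight, and to 0 otherwise; its transpose lowers weights. Since the representation is minuscule,
  these matrices satisfy the Serre relations, and they square to 0, so that the exponential of
  \<open>t \<cdot> raising_mat i\<close> is \<open>1 + t \<cdot> raising_mat i\<close>.
\<close>

definition raising_mat :: "nat \<Rightarrow> 'k::field mat" where
  "raising_mat i = mat 27 27 (\<lambda>(r, s).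
     if weights ! r = map2 (+) (weights ! s) (map (cartan i) [1..<7]) then 1 else 0)"

definition x_simple :: "nat \<Rightarrow> 'k::field \<Rightarrow> 'k mat" where
  "x_simple i t = 1\<^sub>m 27 + t \<cdot>\<^sub>m raising_mat i"

definition x_neg_simple :: "nat \<Rightarrow> 'k::field \<Rightarrow> 'k mat" where
  "x_neg_simple i t = 1\<^sub>m 27 + t \<cdot>\<^sub>m (raising_mat i)\<^sup>T"

definition GL27 :: "'k::field mat monoid" where
  "GL27 = units_of (ring_mat TYPE('k) 27 ())"

definition E6 :: "'k::field mat monoid" where
  "E6 = GL27\<lparr>carrier :=
     generate GL27 (\<Union>i\<in>{1..6}. range (x_simple i) \<union> range (x_neg_simple i))\<rparr>"

text \<open>The value of the \<open>i\<close>-th simple coroot at \<open>t\<close>.\<close>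

definition coroot_mat :: "nat \<Rightarrow> 'k::field \<Rightarrow> 'k mat" where
  "coroot_mat i t = mat 27 27 (\<lambda>(r, s). if r = s then t powi (weights ! r ! (i - 1)) else 0)"

definition weyl_rep :: "(int list \<Rightarrow> 'k::field \<Rightarrow> 'k mat) \<Rightarrow> int list \<Rightarrow> 'k mat" where
  "weyl_rep x \<alpha> = x \<alpha> 1 * x (neg_root \<alpha>) (- 1) * x \<alpha> 1"

definition conj_E6 :: "'k::field mat \<Rightarrow> 'k mat \<Rightarrow> 'k mat" where
  "conj_E6 g h = g * h * inv\<^bsub>E6\<^esub> g"

text \<open>
  Chevalley systems extending the splitting given by the maps \<open>x_simple i\<close>. As every root is
  conjugate to a simple one, the relations determine each \<open>x \<beta>\<close> up to \<open>t \<mapsto> -t\<close>; in particular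
  every \<open>x \<beta>\<close> is automatically an isomorphism of the additive group, over \<open>F\<close>, with the root
  subgroup of \<open>\<beta>\<close>.
\<close>

definition chevalley_system :: "(int list \<Rightarrow> 'k::field \<Rightarrow> 'k mat) \<Rightarrow> bool" where
  "chevalley_system x \<longleftrightarrow>
     (\<forall>i\<in>{1..6}. x (simple_root i) = x_simple i \<and> x (neg_root (simple_root i)) = x_neg_simple i) \<and>
     (\<forall>\<alpha>\<in>roots. \<forall>\<beta>\<in>roots. \<exists>\<epsilon>\<in>{1, - 1}. \<forall>t.
        conj_E6 (weyl_rep x \<alpha>) (x \<beta> t) = x (root_refl \<alpha> \<beta>) (\<epsilon> * t))"


section \<open>The parabolic subgroup and the map \<open>\<N>\<close>\<close>

definition levi :: "(int list \<Rightarrow> 'k::field \<Rightarrow> 'k mat) \<Rightarrow> 'k mat set" where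
  "levi x = generate E6
     ({coroot_mat i t |i t. i \<in> {1..6} \<and> t \<noteq> 0} \<union> {x \<beta> t |\<beta> t. \<beta> \<in> roots \<and> \<beta> ! 1 = 0})"

definition unip_rad :: "(int list \<Rightarrow> 'k::field \<Rightarrow> 'k mat) \<Rightarrow> 'k mat set" where
  "unip_rad x = generate E6 {x \<beta> t |\<beta> t. \<beta> \<in> roots \<and> \<beta> ! 1 > 0}"

definition opp_unip_rad :: "(int list \<Rightarrow> 'k::field \<Rightarrow> 'k mat) \<Rightarrow> 'k mat set" where
  "opp_unip_rad x = generate E6 {x \<beta> t |\<beta> t. \<beta> \<in> roots \<and> \<beta> ! 1 < 0}"

definition weyl_lift :: "(int list \<Rightarrow> 'k::field \<Rightarrow> 'k mat) \<Rightarrow> nat list \<Rightarrow> 'k mat" where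
  "weyl_lift x ws = foldr (\<lambda>i A. weyl_rep x (simple_root i) * A) ws (1\<^sub>m 27)"

definition w0_lift :: "(int list \<Rightarrow> 'k::field \<Rightarrow> 'k mat) \<Rightarrow> nat list \<Rightarrow> nat list \<Rightarrow> 'k mat" where
  "w0_lift x wG wM = weyl_lift x wG * inv\<^bsub>E6\<^esub> (weyl_lift x wM)"

definition is_M_component ::
  "(int list \<Rightarrow> 'k::field \<Rightarrow> 'k mat) \<Rightarrow> 'k mat \<Rightarrow> 'k mat \<Rightarrow> 'k mat \<Rightarrow> bool" where
  "is_M_component x w0 n m \<longleftrightarrow> m \<in> levi x \<and>
     (\<exists>n'\<in>unip_rad x. \<exists>nb\<in>opp_unip_rad x. inv\<^bsub>E6\<^esub> w0 * n = m * n' * nb)"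

text \<open>A partial map: it is meaningful only where the decomposition exists.\<close>

definition N_map :: "(int list \<Rightarrow> 'k::field \<Rightarrow> 'k mat) \<Rightarrow> 'k mat \<Rightarrow> 'k mat \<Rightarrow> 'k mat" where
  "N_map x w0 n = (THE m. is_M_component x w0 n m)"

definition gamma :: "nat \<Rightarrow> int list" where
  "gamma i = [[1,2,2,3,2,1], [1,1,2,3,2,1], [1,1,2,2,2,1], [1,1,1,2,1,1], [0,1,1,2,1,0],
              [0,1,0,0,0,0]] ! i"

definition gamma_prod :: "(int list \<Rightarrow> 'k::field \<Rightarrow> 'k mat) \<Rightarrow> 'k vec \<Rightarrow> 'k mat" where
  "gamma_prod x c = foldr (\<lambda>i A. x (gamma i) (c $ i) * A) [0..<6] (1\<^sub>m 27)"

definition R_set :: "'k::field vec set" where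
  "R_set = {c \<in> carrier_vec 6.
     (\<forall>i<6. c $ i \<noteq> 0) \<and>
     c $ 0 - c $ 1 * c $ 5 \<noteq> 0 \<and>
     c $ 0 * (c $ 0 - c $ 1 * c $ 5) - c $ 2 * c $ 3 * c $ 4 * c $ 5 \<noteq> 0 \<and>
     2 * (c $ 0)^2 * (c $ 3 * c $ 4 + c $ 2 * c $ 5)
       - 2 * c $ 2 * (c $ 3)^2 * (c $ 4)^2 * c $ 5
       + c $ 0 * c $ 1 * (c $ 5)^2 * (c $ 4 - c $ 2) \<noteq> 0}"

text \<open>
  A Chevalley system is determined by the splitting only up to signs, whereas the equations of \<open>R\<close>
  involve the signs of the \<open>x \<gamma>\<^sub>i\<close>. We allow all choices for which the domain of \<open>\<N>\<close>, on the
  products of the \<open>x \<gamma>\<^sub>i (c\<^sub>i)\<close>, is the locus where the polynomial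
  \<open>c\<^sub>0 (c\<^sub>0 - c\<^sub>1 c\<^sub>5) - c\<^sub>2 c\<^sub>3 c\<^sub>4 c\<^sub>5\<close> of the definition of \<open>R\<close> does not vanish. The first sign (that of
  \<open>\<gamma>\<^sub>1 + \<gamma>\<^sub>5 = \<gamma>\<^sub>0\<close>) gives the sign of \<open>c\<^sub>1 c\<^sub>5\<close>, the second one (that of
  \<open>- \<gamma>\<^sub>0 + \<gamma>\<^sub>2 + \<gamma>\<^sub>3 + \<gamma>\<^sub>4 + \<gamma>\<^sub>5 = \<gamma>\<^sub>0\<close>) the sign of \<open>c\<^sub>2 c\<^sub>3 c\<^sub>4 c\<^sub>5\<close>; for the other values of these two
  signs, \<open>\<N>\<close> is not defined on all of \<open>R\<close>.
\<close>

definition adapted_signs :: "(int list \<Rightarrow> 'k::field \<Rightarrow> 'k mat) \<Rightarrow> bool" where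
  "adapted_signs x \<longleftrightarrow>
     (\<forall>t. conj_E6 (weyl_rep x (gamma 5)) (x (gamma 1) t) = x (gamma 0) t) \<and>
     (\<forall>t. conj_E6 (weyl_rep x (gamma 2) * weyl_rep x (gamma 3) *
                   weyl_rep x (gamma 4) * weyl_rep x (gamma 5)) (x (neg_root (gamma 0)) t)
          = x (gamma 0) t)"

definition A6 :: "('f::field alg_closure vec, 'f alg_closure) aff_space" where
  "A6 = \<lparr>points = carrier_vec 6, coordinates = {\<lambda>c. c $ i |i. i < 6}\<rparr>"

text \<open>
  \<open>M\<close> is a closed subvariety of this space (the matrices in \<open>M\<close> have determinant 1), so locally
  closed subsets of \<open>M\<close> are the subsets of \<open>M\<close> that are locally closed here.
\<close>

definition Mat27 :: "('f::field alg_closure mat, 'f alg_closure) aff_space" where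
  "Mat27 = \<lparr>points = carrier_mat 27 27, coordinates = {\<lambda>m. m $$ (i, j) |i j. i < 27 \<and> j < 27}\<rparr>"

end

theory Submission
  imports Defs
begin

text \<open>
  The map can be computed. Let \<open>w\<close> be a representative of the reflection at the highest root \<open>\<gamma>\<^sub>0\<close>. The
  longest elements of the Weyl groups of \<open>G\<close> and \<open>M\<close> differ by this reflection, and their
  representatives give \<open>w\<^sub>0\<^sup>-\<^sup>1 = \<mu> w\<^sup>-\<^sup>1\<close> with a fixed \<open>\<mu> \<in> M\<close> that has integer entries
  (\<open>longest_quotient\<close>). So \<open>\<N>(n) = \<mu> m\<close>, where \<open>m\<close> is the \<open>M\<close>-component of \<open>w\<^sup>-\<^sup>1 n\<close>. In the rank one
  group of \<open>\<gamma>\<^sub>0\<close>, \<open>w\<^sup>-\<^sup>1 x(\<gamma>\<^sub>0, c\<^sub>0)\<close> becomes an upper unipotent element, a torus element and some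
  \<open>x(-\<gamma>\<^sub>0, u)\<close>, and the last factor is moved to the right past the other \<open>x(\<gamma>\<^sub>i, c\<^sub>i)\<close> by commutator
  relations (\<open>big_cell\<close>, \<open>M_component_exists\<close>). One division occurs on the way, by the polynomial
  \<open>c\<^sub>0 (c\<^sub>0 - c\<^sub>1 c\<^sub>5) - c\<^sub>2 c\<^sub>3 c\<^sub>4 c\<^sub>5\<close>, here called \<open>quartic\<close>. The result is an explicit product
  \<open>levi_part c\<close> in \<open>M\<close>; uniqueness of the component is block triangularity (\<open>upper_diag_lower\<close>).

  The parameters in \<open>levi_part\<close> are products of powers of \<open>c\<^sub>0\<close> and \<open>quartic\<close> and an even number of the other
  \<open>c\<^sub>i\<close>, so they do not change when \<open>c\<^sub>1, \<dots>, c\<^sub>5\<close> all change sign (\<open>flip\<close>). Conversely, on the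
  weight spaces of lowest degree with respect to \<open>\<alpha>\<^sub>2\<close> the factors in \<open>N\<close> and in its
  opposite have no effect, so that entries of \<open>\<mu>\<^sup>-\<^sup>1 \<N>(n)\<close> are entries of \<open>w\<^sup>-\<^sup>1 n\<close>. Among these
  are, up to sign, \<open>c\<^sub>0\<close>, \<open>c\<^sub>0 - c\<^sub>1 c\<^sub>5\<close>, \<open>c\<^sub>2 c\<^sub>5\<close>, \<open>c\<^sub>3 c\<^sub>5\<close>, \<open>c\<^sub>4 c\<^sub>5\<close> and \<open>c\<^sub>2 c\<^sub>3\<close>
  (\<open>levi_part_entries\<close>). They determine \<open>c\<^sub>5\<^sup>2\<close>, and then \<open>c\<close> up to \<open>flip\<close>.

  Hence every fibre has two points, and an even regular function on \<open>R\<close> is a regular function of the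
  image point. Splitting a function into its even and its odd part, one gets the coordinate ring of
  \<open>R\<close> from that of the image by adjoining \<open>c\<^sub>5\<close>, a square root of a function without zeros; this is
  etale in characteristic 0 (\<open>etale_chart_double_cover\<close>, \<open>invariant_coordinates\<close>).

  The group is handled through a table of root vectors on the 27-dimensional representation. The
  finitely many identities between them that are needed (\<open>code_simp\<close>) are evaluated on sparse
  integer matrices.
\<close>

section \<open>Regular functions on locally closed sets\<close>

lemma polyfuns_minus: "g \<in> polyfuns S \<Longrightarrow> (\<lambda>p. - g p) \<in> polyfuns S"
  using polyfuns.mult[OF polyfuns.const[of "-1"]] by fastforce

lemma polyfuns_diff: "g \<in> polyfuns S \<Longrightarrow> h \<in> polyfuns S \<Longrightarrow> (\<lambda>p. g p - h p) \<in> polyfuns S"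
  using polyfuns.add[OF _ polyfuns_minus, of g S h] by simp

lemma polyfuns_power: "g \<in> polyfuns S \<Longrightarrow> (\<lambda>p. g p ^ k) \<in> polyfuns S"
proof (induction k)
  case 0 then show ?case using polyfuns.const[of 1 S] by simp
next
  case (Suc k) then show ?case using polyfuns.mult by fastforce
qed

lemma polyfuns_sum: "(\<And>i. i \<in> I \<Longrightarrow> g i \<in> polyfuns S) \<Longrightarrow> (\<lambda>p. \<Sum>i\<in>I. g i p) \<in> polyfuns S"
proof (induction I rule: infinite_finite_induct)
  case (insert i I) then show ?case using polyfuns.add[of "g i" S "\<lambda>p. \<Sum>i\<in>I. g i p"] by simp
qed (use polyfuns.const[of 0 S] in simp_all)

lemmas polyfuns_intros =
  polyfuns_minus polyfuns_diff polyfuns_power polyfuns_sum polyfuns.add polyfuns.mult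

lemma regular_funsI:
  assumes "\<And>p. p \<notin> W \<Longrightarrow> \<phi> p = 0"
    and "\<And>p. p \<in> W \<Longrightarrow> \<exists>g\<in>polyfuns S. \<exists>h\<in>polyfuns S. h p \<noteq> 0 \<and> (\<forall>q\<in>W. h q * \<phi> q = g q)"
  shows "\<phi> \<in> regular_funs S W"
  unfolding regular_funs_def
proof (safe, goal_cases)
  case (2 p)
  from assms(2)[OF 2] obtain g h where "g \<in> polyfuns S" "h \<in> polyfuns S" "h p \<noteq> 0" "\<forall>q\<in>W. h q * \<phi> q = g q"
    by blast
  then show ?case by (intro bexI[of _ g] bexI[of _ h]) (auto simp: field_simps)
qed (use assms(1) in auto)

text \<open>
  Multiplying numerator and denominator of a local fraction by the denominator makes the relation
  \<open>h \<phi> = g\<close> hold on all of \<open>W\<close>, also where \<open>h\<close> vanishes; such relations can be added and multiplied.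
\<close>
lemma regular_funsD:
  assumes "\<phi> \<in> regular_funs S W" "p \<in> W"
  obtains g h where "g \<in> polyfuns S" "h \<in> polyfuns S" "h p \<noteq> 0" "\<And>q. q \<in> W \<Longrightarrow> h q * \<phi> q = g q"
proof -
  from assms obtain g h where gh: "g \<in> polyfuns S" "h \<in> polyfuns S" "h p \<noteq> 0"
      "\<forall>q\<in>W. h q \<noteq> 0 \<longrightarrow> \<phi> q = g q / h q"
    unfolding regular_funs_def by blast
  show ?thesis
  proof (rule that[of "\<lambda>q. g q * h q" "\<lambda>q. h q * h q"])
    show "h q * h q * \<phi> q = g q * h q" if "q \<in> W" for q
      using gh(4) that by (cases "h q = 0") auto
  qed (use gh in \<open>auto intro: polyfuns_intros\<close>)
qed

lemma regular_funs_outside: "\<phi> \<in> regular_funs S W \<Longrightarrow> p \<notin> W \<Longrightarrow> \<phi> p = 0"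
  by (simp add: regular_funs_def)

lemma regular_funs_restrict:
  assumes "g \<in> polyfuns S" shows "(\<lambda>p. if p \<in> W then g p else 0) \<in> regular_funs S W"
proof (rule regular_funsI)
  show "\<exists>g'\<in>polyfuns S. \<exists>h\<in>polyfuns S. h p \<noteq> 0 \<and> (\<forall>q\<in>W. h q * (if q \<in> W then g q else 0) = g' q)" for p
    using assms polyfuns.const[of 1 S] by (intro bexI[of _ g] bexI[of _ "\<lambda>_. 1"]) auto
qed simp

lemma regular_funs_const: "(\<lambda>p. if p \<in> W then to_ac a else 0) \<in> regular_funs S W"
  using regular_funs_restrict[OF polyfuns.const] by fast

lemma regular_funs_add:
  assumes "\<phi> \<in> regular_funs S W" "\<psi> \<in> regular_funs S W"
  shows "(\<lambda>p. \<phi> p + \<psi> p) \<in> regular_funs S W"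
proof (rule regular_funsI)
  fix p assume p: "p \<in> W"
  from regular_funsD[OF assms(1) p] obtain g h where 1: "g \<in> polyfuns S" "h \<in> polyfuns S" "h p \<noteq> 0"
      "\<And>q. q \<in> W \<Longrightarrow> h q * \<phi> q = g q" by blast
  from regular_funsD[OF assms(2) p] obtain g' h' where 2: "g' \<in> polyfuns S" "h' \<in> polyfuns S" "h' p \<noteq> 0"
      "\<And>q. q \<in> W \<Longrightarrow> h' q * \<psi> q = g' q" by blast
  have "(h q * h' q) * (\<phi> q + \<psi> q) = g q * h' q + h q * g' q" if "q \<in> W" for q
    unfolding 1(4)[OF that, symmetric] 2(4)[OF that, symmetric] by (simp add: algebra_simps)
  then show "\<exists>g\<in>polyfuns S. \<exists>h\<in>polyfuns S. h p \<noteq> 0 \<and> (\<forall>q\<in>W. h q * (\<phi> q + \<psi> q) = g q)"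
    using 1 2 by (intro bexI[of _ "\<lambda>q. g q * h' q + h q * g' q"] bexI[of _ "\<lambda>q. h q * h' q"])
      (auto intro: polyfuns_intros)
qed (use assms in \<open>simp add: regular_funs_outside\<close>)

lemma regular_funs_mult:
  assumes "\<phi> \<in> regular_funs S W" "\<psi> \<in> regular_funs S W"
  shows "(\<lambda>p. \<phi> p * \<psi> p) \<in> regular_funs S W"
proof (rule regular_funsI)
  fix p assume p: "p \<in> W"
  from regular_funsD[OF assms(1) p] obtain g h where 1: "g \<in> polyfuns S" "h \<in> polyfuns S" "h p \<noteq> 0"
      "\<And>q. q \<in> W \<Longrightarrow> h q * \<phi> q = g q" by blast
  from regular_funsD[OF assms(2) p] obtain g' h' where 2: "g' \<in> polyfuns S" "h' \<in> polyfuns S" "h' p \<noteq> 0"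
      "\<And>q. q \<in> W \<Longrightarrow> h' q * \<psi> q = g' q" by blast
  have "(h q * h' q) * (\<phi> q * \<psi> q) = g q * g' q" if "q \<in> W" for q
    unfolding 1(4)[OF that, symmetric] 2(4)[OF that, symmetric] by (simp add: algebra_simps)
  then show "\<exists>g\<in>polyfuns S. \<exists>h\<in>polyfuns S. h p \<noteq> 0 \<and> (\<forall>q\<in>W. h q * (\<phi> q * \<psi> q) = g q)"
    using 1 2 by (intro bexI[of _ "\<lambda>q. g q * g' q"] bexI[of _ "\<lambda>q. h q * h' q"])
      (auto intro: polyfuns_intros)
qed (use assms in \<open>simp add: regular_funs_outside\<close>)

lemma regular_funs_cmult: "\<phi> \<in> regular_funs S W \<Longrightarrow> (\<lambda>p. to_ac a * \<phi> p) \<in> regular_funs S W"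
  using regular_funs_mult[OF regular_funs_const[of W a]]
  by (rule back_subst[where P="\<lambda>f. f \<in> regular_funs S W"]) (auto simp: regular_funs_outside)

lemma regular_funs_minus: "\<phi> \<in> regular_funs S W \<Longrightarrow> (\<lambda>p. - \<phi> p) \<in> regular_funs S W"
  using regular_funs_cmult[of \<phi> S W "-1"] by simp

lemma regular_funs_zero: "(\<lambda>p. 0) \<in> regular_funs S W"
  using regular_funs_restrict[OF polyfuns.const[of 0 S], of W] by (simp cong: if_cong)

lemma regular_funs_sum: "(\<And>i. i \<in> I \<Longrightarrow> g i \<in> regular_funs S W) \<Longrightarrow> (\<lambda>p. \<Sum>i\<in>I. g i p) \<in> regular_funs S W"
proof (induction I rule: infinite_finite_induct)
  case (insert i I) then show ?case using regular_funs_add[of "g i" S W "\<lambda>p. \<Sum>i\<in>I. g i p"] by simp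
qed (simp_all add: regular_funs_zero)

lemma regular_funs_mult_power:
  assumes "\<phi> \<in> regular_funs S W" "\<psi> \<in> regular_funs S W"
  shows "(\<lambda>p. \<phi> p * \<psi> p ^ k) \<in> regular_funs S W"
proof (induction k)
  case 0 then show ?case using assms by simp
next
  case (Suc k) then show ?case using regular_funs_mult[OF Suc assms(2)] by (simp add: algebra_simps)
qed

lemma regular_funs_inverse:
  assumes "\<phi> \<in> regular_funs S W" "\<And>p. p \<in> W \<Longrightarrow> \<phi> p \<noteq> 0"
  shows "(\<lambda>p. inverse (\<phi> p)) \<in> regular_funs S W"
proof (rule regular_funsI)
  fix p assume p: "p \<in> W"
  from regular_funsD[OF assms(1) p] obtain g h where 1: "g \<in> polyfuns S" "h \<in> polyfuns S" "h p \<noteq> 0"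
      "\<And>q. q \<in> W \<Longrightarrow> h q * \<phi> q = g q" by blast
  have "g p \<noteq> 0" using 1(3) 1(4)[OF p] p assms(2) by force
  moreover have "g q * inverse (\<phi> q) = h q" if "q \<in> W" for q
    using 1(4)[OF that] assms(2)[OF that] by (simp add: field_simps)
  ultimately show "\<exists>g\<in>polyfuns S. \<exists>h\<in>polyfuns S. h p \<noteq> 0 \<and> (\<forall>q\<in>W. h q * inverse (\<phi> q) = g q)"
    using 1 by blast
qed (use assms in \<open>simp add: regular_funs_outside\<close>)

text \<open>
  If neither of two denominators, each nonzero at one of the points, is nonzero at both points,
  then their sum is.
\<close>
lemma regular_funs_two_points:
  assumes "\<phi> \<in> regular_funs S W" "p \<in> W" "p' \<in> W"
  obtains g h where "g \<in> polyfuns S" "h \<in> polyfuns S" "h p \<noteq> 0" "h p' \<noteq> 0" "\<And>q. q \<in> W \<Longrightarrow> h q * \<phi> q = g q"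
proof -
  obtain g h where 1: "g \<in> polyfuns S" "h \<in> polyfuns S" "h p \<noteq> 0"
      "\<And>q. q \<in> W \<Longrightarrow> h q * \<phi> q = g q" using regular_funsD[OF assms(1,2)] by blast
  obtain g' h' where 2: "g' \<in> polyfuns S" "h' \<in> polyfuns S" "h' p' \<noteq> 0"
      "\<And>q. q \<in> W \<Longrightarrow> h' q * \<phi> q = g' q" using regular_funsD[OF assms(1,3)] by blast
  consider "h p' \<noteq> 0" | "h' p \<noteq> 0" | "h p' = 0" "h' p = 0" by blast
  then show ?thesis
  proof cases
    case 1 with \<open>g \<in> _\<close> \<open>h \<in> _\<close> \<open>h p \<noteq> 0\<close> show ?thesis by (intro that[of g h]) (use "1"(1) \<open>\<And>q. q \<in> W \<Longrightarrow> h q * \<phi> q = g q\<close> in auto)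
  next
    case 3
    show ?thesis
      by (rule that[of "\<lambda>q. g q + g' q" "\<lambda>q. h q + h' q"])
        (use 1 2 3 in \<open>auto intro: polyfuns_intros simp: algebra_simps\<close>)
  qed (use 2 that in auto)
qed

section \<open>Polynomials in one variable\<close>

text \<open>The exponent of the \<open>k\<close>-th power of the variable with index 0.\<close>
definition mon :: "nat \<Rightarrow> nat \<Rightarrow>\<^sub>0 nat" where "mon k = Poly_Mapping.single 0 k"

lemma lookup_mon [simp]: "Poly_Mapping.lookup (mon k) 0 = k"
  by (simp add: mon_def)

lemma mon_eq_iff [simp]: "mon k = mon l \<longleftrightarrow> k = l"
  by (metis lookup_mon)

lemma mon_add: "mon k + mon l = mon (k + l)"
  by (simp add: mon_def single_add)

lemma mon_diff: "mon k - mon l = mon (k - l)"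
  by (simp add: mon_def single_diff)

lemma keys_mon: "Poly_Mapping.keys (mon k) \<subseteq> {0}" "k \<noteq> 0 \<Longrightarrow> Poly_Mapping.keys (mon k) = {0}" "Poly_Mapping.keys (mon 0) = {}"
  by (simp_all add: mon_def)

lemma monomial_one_variable:
  assumes "Poly_Mapping.keys m \<subseteq> {..<Suc 0}" shows "m = mon (Poly_Mapping.lookup m 0)"
proof (rule poly_mapping_eqI)
  fix i show "Poly_Mapping.lookup m i = Poly_Mapping.lookup (mon (Poly_Mapping.lookup m 0)) i"
    using assms by (cases "i = 0") (auto simp: mon_def lookup_single in_keys_iff)
qed

lemma mpoly_eval_one_variable:
  assumes "Poly_Mapping.keys p \<subseteq> mon ` {..<n}"
  shows "mpoly_eval p t = (\<Sum>k<n. Poly_Mapping.lookup p (mon k) * t 0 ^ k)"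
proof -
  have "mpoly_eval p t = (\<Sum>m\<in>mon ` {..<n}. Poly_Mapping.lookup p m * (\<Prod>i\<in>Poly_Mapping.keys m. t i ^ Poly_Mapping.lookup m i))"
    unfolding mpoly_eval_def by (rule sum.mono_neutral_left) (use assms in \<open>auto simp: in_keys_iff\<close>)
  also have "\<dots> = (\<Sum>k<n. Poly_Mapping.lookup p (mon k) * t 0 ^ k)"
  proof (subst sum.reindex)
    have "(\<Prod>i\<in>Poly_Mapping.keys (mon k). t i ^ Poly_Mapping.lookup (mon k) i) = t 0 ^ k" for k
      by (cases "k = 0") (simp_all add: keys_mon)
    then show "sum ((\<lambda>m. Poly_Mapping.lookup p m * (\<Prod>i\<in>Poly_Mapping.keys m. t i ^ Poly_Mapping.lookup m i)) \<circ> mon) {..<n} =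
        (\<Sum>k<n. Poly_Mapping.lookup p (mon k) * t 0 ^ k)" by simp
  qed (auto simp: inj_on_def)
  finally show ?thesis .
qed

lemma keys_mon_bounded:
  assumes "Poly_Mapping.keys p \<subseteq> range mon"
  obtains n where "Poly_Mapping.keys p \<subseteq> mon ` {..<n}"
proof -
  obtain D where "finite D" "Poly_Mapping.keys p = mon ` D"
    using finite_subset_image[OF finite_keys, of p mon UNIV] assms by auto
  moreover have "D \<subseteq> {..<Suc (Max (insert 0 D))}"
    using \<open>finite D\<close> by (auto simp: less_Suc_eq_le)
  ultimately show ?thesis by (intro that) blast
qed

lemma mpoly_eval_diff_one_variable:
  assumes "Poly_Mapping.keys p \<subseteq> range mon" "Poly_Mapping.keys p' \<subseteq> range mon"
  shows "mpoly_eval (p - p') t = mpoly_eval p t - mpoly_eval p' t"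
proof -
  obtain n n' where n: "Poly_Mapping.keys p \<subseteq> mon ` {..<n}" "Poly_Mapping.keys p' \<subseteq> mon ` {..<n'}"
    using keys_mon_bounded assms by metis
  let ?n = "max n n'"
  have k: "Poly_Mapping.keys p \<subseteq> mon ` {..<?n}" "Poly_Mapping.keys p' \<subseteq> mon ` {..<?n}"
    using n by force+
  then have "Poly_Mapping.keys (p - p') \<subseteq> mon ` {..<?n}"
    using keys_diff[of p p'] by blast
  with k show ?thesis
    by (simp add: mpoly_eval_one_variable lookup_minus sum_subtractf algebra_simps)
qed

lemma mpoly_eval_sum_one_variable:
  "mpoly_eval (\<Sum>k<(n::nat). Poly_Mapping.single (mon (e k)) (c k)) t = (\<Sum>k<n. c k * t 0 ^ e k)"
proof (induction n)
  case 0 then show ?case by (simp add: mpoly_eval_def)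
next
  case (Suc n)
  have 1: "mpoly_eval (- Poly_Mapping.single (mon (e n)) (c n)) t = - (c n * t 0 ^ e n)"
    by (subst mpoly_eval_one_variable[of _ "Suc (e n)"]) (auto simp: lookup_single sum.delta if_distrib cong: if_cong)
  have "Poly_Mapping.keys (\<Sum>k<n. Poly_Mapping.single (mon (e k)) (c k)) \<subseteq> range mon"
    by (rule order_trans[OF Poly_Mapping.keys_sum]) auto
  then show ?case
    using mpoly_eval_diff_one_variable[of "\<Sum>k<n. Poly_Mapping.single (mon (e k)) (c k)" "- Poly_Mapping.single (mon (e n)) (c n)" t]
    by (simp add: 1 Suc)
qed

lemma sum_even_odd:
  "(\<Sum>k<2*n. c k * (t::'a::comm_ring_1) ^ k) = (\<Sum>j<n. c (2*j) * (t^2)^j) + t * (\<Sum>j<n. c (2*j+1) * (t^2)^j)"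
  by (induction n) (simp_all add: algebra_simps power_mult[symmetric] power_add power2_eq_square power_mult)

section \<open>Etale double covers\<close>

text \<open>
  The functions on \<open>W\<close> form the ring \<open>O(V)[T]/(T\<^sup>2 - q)\<close>, where \<open>T\<close> corresponds to \<open>b\<close> and \<open>q\<close> to
  \<open>b\<^sup>2\<close>: a function \<open>\<phi>\<close> is the sum of its even part and of \<open>b\<close> times its odd part divided by \<open>b\<close>, and
  both coefficients are invariant under \<open>\<sigma>\<close>, so they descend to \<open>V\<close>. A polynomial that vanishes at \<open>b\<close>
  also vanishes at \<open>- b\<close>; so its reduction modulo \<open>T\<^sup>2 - q\<close>, of degree at most 1, is 0. The derivative
  \<open>2 b\<close> of \<open>T\<^sup>2 - q\<close> is a unit.
\<close>
lemma etale_chart_double_cover: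
  fixes f :: "'p \<Rightarrow> 'q" and b :: "'p \<Rightarrow> 'f::field_char_0 alg_closure"
  assumes img: "f ` W = V"
    and inv: "\<And>p. p \<in> W \<Longrightarrow> \<sigma> p \<in> W" "\<And>p. p \<in> W \<Longrightarrow> \<sigma> (\<sigma> p) = p" "\<And>p. p \<in> W \<Longrightarrow> f (\<sigma> p) = f p"
    and b: "b \<in> regular_funs S W" "\<And>p. p \<in> W \<Longrightarrow> b p \<noteq> 0" "\<And>p. p \<in> W \<Longrightarrow> b (\<sigma> p) = - b p"
    and sig: "\<And>\<phi>. \<phi> \<in> regular_funs S W \<Longrightarrow> (\<lambda>p. if p \<in> W then \<phi> (\<sigma> p) else 0) \<in> regular_funs S W"
    and desc: "\<And>\<phi>. \<phi> \<in> regular_funs S W \<Longrightarrow> (\<And>p. p \<in> W \<Longrightarrow> \<phi> (\<sigma> p) = \<phi> p) \<Longrightarrow>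
                 \<exists>\<psi>\<in>regular_funs T V. \<forall>p\<in>W. \<psi> (f p) = \<phi> p"
  shows "etale_chart S W T V f"
proof -
  note [simp] = lookup_add lookup_single lookup_sum
  obtain q where q: "q \<in> regular_funs T V" "\<And>p. p \<in> W \<Longrightarrow> q (f p) = b p ^ 2"
    using desc[OF regular_funs_mult[OF b(1) b(1)]] b(3) by (auto simp: power2_eq_square)
  \<comment> \<open>The coefficients have to vanish outside \<open>V\<close>, so the leading coefficient is the indicator function of \<open>V\<close>.\<close>
  define one where "one = (\<lambda>v. if v \<in> V then (1 :: 'f alg_closure) else 0)"
  have one: "one \<in> regular_funs T V"
    using regular_funs_const[of V 1 T] by (simp add: one_def cong: if_cong)
  define P :: "'q \<Rightarrow> 'f alg_closure mpoly"
    where "P v = Poly_Mapping.single (mon 2) (one v) - Poly_Mapping.single (mon 0) (q v)" for v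
  have single_reg: "(\<lambda>v. Poly_Mapping.lookup (Poly_Mapping.single (mon k) (\<phi> v)) m) \<in> regular_funs T V"
    if "\<phi> \<in> regular_funs T V" for \<phi> k m
    using that by (cases "m = mon k") (auto simp: lookup_single when_def regular_funs_zero)
  have keysV: "Poly_Mapping.keys m \<subseteq> {..<1}" if "m \<in> mon ` D" for m D
    using that keys_mon(1) by fastforce
  have P_reg: "P \<in> regular_polys T V 1"
    unfolding regular_polys_def
  proof (intro CollectI conjI allI exI[of _ "mon ` {0,2}"] ballI)
    show "Poly_Mapping.keys (P v) \<subseteq> mon ` {0,2}" for v
      unfolding P_def by (rule order_trans[OF keys_diff]) auto
    show "(\<lambda>v. Poly_Mapping.lookup (P v) m) \<in> regular_funs T V" for m
      unfolding P_def lookup_minus unfolding diff_conv_add_uminus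
      by (intro regular_funs_add regular_funs_minus single_reg one q)
  qed (simp, erule keysV)
  have evP: "mpoly_eval (P v) t = one v * t 0 ^ 2 - q v" for v t
  proof -
    have "Poly_Mapping.keys (P v) \<subseteq> mon ` {..<3}"
      unfolding P_def by (rule order_trans[OF keys_diff]) auto
    then show ?thesis
      by (subst mpoly_eval_one_variable) (auto simp: P_def lookup_minus lookup_single eval_nat_numeral)
  qed
  show ?thesis
    unfolding etale_chart_def
  proof (intro exI[of _ 1] exI[of _ "\<lambda>_. b"] exI[of _ "\<lambda>_. P"] conjI allI impI ballI)
    fix \<phi> assume \<phi>: "\<phi> \<in> regular_funs S W"
    define \<phi>' where "\<phi>' p = (if p \<in> W then \<phi> (\<sigma> p) else 0)" for p
    have \<phi>': "\<phi>' \<in> regular_funs S W" unfolding \<phi>'_def by (rule sig[OF \<phi>])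
    have e: "(\<lambda>p. to_ac (1/2) * (\<phi> p + \<phi>' p)) \<in> regular_funs S W"
      by (intro regular_funs_cmult regular_funs_add \<phi> \<phi>')
    obtain Q0 where Q0: "Q0 \<in> regular_funs T V" "\<And>p. p \<in> W \<Longrightarrow> Q0 (f p) = to_ac (1/2) * (\<phi> p + \<phi>' p)"
      using desc[OF e] by (auto simp: \<phi>'_def inv add.commute)
    have o: "(\<lambda>p. (to_ac (1/2) * (\<phi> p + - \<phi>' p)) * inverse (b p)) \<in> regular_funs S W"
      by (intro regular_funs_cmult regular_funs_mult regular_funs_inverse regular_funs_add regular_funs_minus \<phi> \<phi>' b)
    obtain Q1 where Q1: "Q1 \<in> regular_funs T V" "\<And>p. p \<in> W \<Longrightarrow> Q1 (f p) = to_ac (1/2) * (\<phi> p + - \<phi>' p) * inverse (b p)"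
      using desc[OF o] by (auto simp: \<phi>'_def inv b algebra_simps)
    define Q where "Q v = Poly_Mapping.single (mon 0) (Q0 v) + Poly_Mapping.single (mon 1) (Q1 v)" for v
    have "Q \<in> regular_polys T V 1"
      unfolding regular_polys_def
    proof (intro CollectI conjI allI exI[of _ "mon ` {0,1}"] ballI)
      show "Poly_Mapping.keys (Q v) \<subseteq> mon ` {0,1}" for v
        unfolding Q_def by (rule order_trans[OF keys_add]) auto
      show "(\<lambda>v. Poly_Mapping.lookup (Q v) m) \<in> regular_funs T V" for m
        unfolding Q_def lookup_add
        by (intro regular_funs_add single_reg Q0 Q1)
    qed (use keysV in auto)
    moreover have "mpoly_eval (Q (f u)) (\<lambda>i. b u) = \<phi> u" if u: "u \<in> W" for u
    proof -
      have "Poly_Mapping.keys (Q v) \<subseteq> mon ` {..<2}" for v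
        unfolding Q_def by (rule order_trans[OF keys_add]) auto
      then have "mpoly_eval (Q (f u)) (\<lambda>i. b u) = Q0 (f u) + Q1 (f u) * b u"
        by (subst mpoly_eval_one_variable) (auto simp: Q_def lookup_single eval_nat_numeral)
      also have "\<dots> = \<phi> u"
        using b(2)[OF u] by (simp add: Q0 Q1 u field_simps)
      finally show ?thesis .
    qed
    ultimately show "\<exists>Q\<in>regular_polys T V 1. \<forall>u\<in>W. \<phi> u = mpoly_eval (Q (f u)) (\<lambda>i. b u)"
      by metis
  next
    fix Q assume Q: "Q \<in> regular_polys T V 1"
    then obtain D where D: "finite D" "\<And>m. m \<in> D \<Longrightarrow> Poly_Mapping.keys m \<subseteq> {..<1}"
        "\<And>v. Poly_Mapping.keys (Q v) \<subseteq> D"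
      and coef: "\<And>m. (\<lambda>v. Poly_Mapping.lookup (Q v) m) \<in> regular_funs T V"
      unfolding regular_polys_def by auto
    define N where "N = Suc (Max (insert 0 ((\<lambda>m. Poly_Mapping.lookup m 0) ` D)))"
    have N: "Poly_Mapping.keys (Q v) \<subseteq> mon ` {..<N}" for v
    proof
      fix m assume "m \<in> Poly_Mapping.keys (Q v)"
      then have m: "m \<in> D" using D(3) by blast
      then have "m = mon (Poly_Mapping.lookup m 0)" by (intro monomial_one_variable) (use D(2) in auto)
      moreover have "Poly_Mapping.lookup m 0 < N"
        unfolding N_def less_Suc_eq_le by (rule Max_ge) (use m D(1) in auto)
      ultimately show "m \<in> mon ` {..<N}" by blast
    qed
    define c where "c v k = Poly_Mapping.lookup (Q v) (mon k)" for v k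
    have c_reg: "(\<lambda>v. c v k) \<in> regular_funs T V" for k unfolding c_def by (rule coef)
    have c0: "c v k = 0" if "k \<ge> N" for v k
      using N[of v] that by (force simp: c_def in_keys_iff)
    have Q_sum: "Q v = (\<Sum>k<2*N. Poly_Mapping.single (mon k) (c v k))" for v
    proof (rule poly_mapping_eqI)
      fix m show "Poly_Mapping.lookup (Q v) m = Poly_Mapping.lookup (\<Sum>k<2*N. Poly_Mapping.single (mon k) (c v k)) m"
      proof (cases "m \<in> range mon")
        case True
        then obtain k where k: "m = mon k" by blast
        have "(\<Sum>i<2*N. c v i when i = k) = (if k < 2 * N then c v k else 0)"
          by (simp add: when_def)
        also have "\<dots> = c v k" using c0[of k v] by auto
        finally show ?thesis by (simp add: k c_def)
      next
        case False
        then have "m \<notin> Poly_Mapping.keys (Q v)" using N[of v] by blast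
        with False show ?thesis by (auto simp: in_keys_iff when_def intro!: sum.neutral sum.neutral[symmetric])
      qed
    qed
    have evQ: "mpoly_eval (Q v) (\<lambda>i. t) = (\<Sum>j<N. c v (2*j) * (t^2)^j) + t * (\<Sum>j<N. c v (2*j+1) * (t^2)^j)" for v t
    proof -
      have "Poly_Mapping.keys (Q v) \<subseteq> mon ` {..<2*N}" using N[of v] by force
      then have "mpoly_eval (Q v) (\<lambda>i. t) = (\<Sum>k<2*N. c v k * t ^ k)"
        by (subst mpoly_eval_one_variable) (auto simp: c_def)
      then show ?thesis by (simp only: sum_even_odd)
    qed
    show "(\<forall>u\<in>W. mpoly_eval (Q (f u)) (\<lambda>i. b u) = 0) \<longleftrightarrow>
       (\<exists>A. (\<forall>i<(1::nat). A i \<in> regular_polys T V 1) \<and> Q = (\<lambda>v. \<Sum>i<1. A i v * P v))"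
    proof
      assume "\<exists>A. (\<forall>i<(1::nat). A i \<in> regular_polys T V 1) \<and> Q = (\<lambda>v. \<Sum>i<1. A i v * P v)"
      then obtain A where A: "A \<in> regular_polys T V 1" "\<And>v. Q v = A v * P v"
        by (auto simp: fun_eq_iff lessThan_Suc One_nat_def)
      from A(1) obtain D where D: "\<And>m. m \<in> D \<Longrightarrow> Poly_Mapping.keys m \<subseteq> {..<1}"
          "\<And>v. Poly_Mapping.keys (A v) \<subseteq> D"
        unfolding regular_polys_def by auto
      show "\<forall>u\<in>W. mpoly_eval (Q (f u)) (\<lambda>i. b u) = 0"
      proof
        fix u assume u: "u \<in> W"
        then have V: "f u \<in> V" using img by blast
        let ?A = "A (f u)"
        have kA: "Poly_Mapping.keys ?A \<subseteq> range mon"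
          using D monomial_one_variable by (metis One_nat_def rangeI subset_iff)
        then obtain n where n: "Poly_Mapping.keys ?A \<subseteq> mon ` {..<n}" using keys_mon_bounded by blast
        define a where "a k = Poly_Mapping.lookup ?A (mon k)" for k
        have A_sum: "?A = (\<Sum>k<n. Poly_Mapping.single (mon k) (a k))"
        proof (rule poly_mapping_eqI)
          fix m show "Poly_Mapping.lookup ?A m = Poly_Mapping.lookup (\<Sum>k<n. Poly_Mapping.single (mon k) (a k)) m"
          proof (cases "m \<in> mon ` {..<n}")
            case True then show ?thesis by (auto simp: when_def a_def)
          next
            case False
            then have "m \<notin> Poly_Mapping.keys ?A" using n by blast
            with False show ?thesis by (auto simp: in_keys_iff when_def intro!: sum.neutral sum.neutral[symmetric])
          qed
        qed
        have "Q (f u) = (\<Sum>k<n. Poly_Mapping.single (mon (k + 2)) (a k)) - (\<Sum>k<n. Poly_Mapping.single (mon k) (q (f u) * a k))"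
          unfolding A(2) using V
          by (subst A_sum) (simp add: P_def one_def sum_distrib_left sum_distrib_right right_diff_distrib mult_single mon_add sum_subtractf mult.commute)
        also have "mpoly_eval \<dots> (\<lambda>i. b u) = (\<Sum>k<n. a k * b u ^ (k + 2)) - (\<Sum>k<n. q (f u) * a k * b u ^ k)"
        proof (subst mpoly_eval_diff_one_variable)
          show "Poly_Mapping.keys (\<Sum>k<n. Poly_Mapping.single (mon (k + 2)) (a k)) \<subseteq> range mon"
               "Poly_Mapping.keys (\<Sum>k<n. Poly_Mapping.single (mon k) (q (f u) * a k)) \<subseteq> range mon"
            by (rule order_trans[OF Poly_Mapping.keys_sum]; auto)+
        qed (simp only: mpoly_eval_sum_one_variable)
        also have "\<dots> = 0"
          by (simp add: q(2)[OF u] sum_distrib_left power2_eq_square algebra_simps)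
        finally show "mpoly_eval (Q (f u)) (\<lambda>i. b u) = 0" .
      qed
    next
      assume van: "\<forall>u\<in>W. mpoly_eval (Q (f u)) (\<lambda>i. b u) = 0"
      have van2: "(\<Sum>j<N. c v (2*j) * q v ^ j) = 0" "(\<Sum>j<N. c v (2*j+1) * q v ^ j) = 0" if v: "v \<in> V" for v
      proof -
        obtain p where p: "p \<in> W" "v = f p" using v img by blast
        let ?E = "\<Sum>j<N. c v (2*j) * q v ^ j" and ?O = "\<Sum>j<N. c v (2*j+1) * q v ^ j"
        have halves: "E = 0 \<and> F = 0" if "E + F = 0" "E + - F = 0" for E F :: "'f alg_closure"
        proof -
          have "E = F" using that(2) by simp
          moreover have "2 * E = 0" using that(1) unfolding \<open>E = F\<close> mult_2 .
          ultimately show ?thesis by simp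
        qed
        have "?E + b p * ?O = 0"
          using bspec[OF van p(1)] unfolding evQ q(2)[OF p(1), symmetric] p(2)[symmetric] .
        moreover have "?E + - b p * ?O = 0"
          using bspec[OF van inv(1)[OF p(1)]]
          unfolding evQ b(3)[OF p(1)] inv(3)[OF p(1)] power2_minus q(2)[OF p(1), symmetric] p(2)[symmetric] .
        ultimately have "?E = 0 \<and> b p * ?O = 0"
          unfolding mult_minus_left by (rule halves)
        then show "?E = 0" "?O = 0" using b(2)[OF p(1)] by auto
      qed
      \<comment> \<open>The coefficients of the quotient on division by \<open>T\<^sup>2 - q\<close>.\<close>
      define a where "a v l = (\<Sum>j<N. c v (l + 2 + 2*j) * q v ^ j)" for v l
      have a_reg: "(\<lambda>v. a v l) \<in> regular_funs T V" for l
        unfolding a_def by (intro regular_funs_sum regular_funs_mult_power c_reg q)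
      have a0: "a v l = 0" if "l \<ge> N" for v l
        unfolding a_def by (rule sum.neutral) (use c0 that in auto)
      have a_rec: "(\<Sum>j<N. c v (l + 2*j) * q v ^ j) = c v l + q v * a v l" for v l
      proof -
        have "c v l + q v * a v l = c v (l + 2*0) * q v ^ 0 + (\<Sum>j<N. c v (l + 2 * Suc j) * q v ^ Suc j)"
          by (simp add: a_def sum_distrib_left algebra_simps)
        also have "\<dots> = (\<Sum>j<Suc N. c v (l + 2*j) * q v ^ j)"
          by (subst sum.lessThan_Suc_shift) simp
        also have "\<dots> = (\<Sum>j<N. c v (l + 2*j) * q v ^ j)"
          using c0[of "l + 2 * N" v] by simp
        finally show ?thesis by simp
      qed
      define A where "A v = (\<Sum>l<2*N. Poly_Mapping.single (mon l) (a v l))" for v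
      have Areg: "A \<in> regular_polys T V 1"
        unfolding regular_polys_def
      proof (intro CollectI conjI allI exI[of _ "mon ` {..<2*N}"] ballI)
        show "Poly_Mapping.keys (A v) \<subseteq> mon ` {..<2*N}" for v
          unfolding A_def by (rule order_trans[OF Poly_Mapping.keys_sum]) auto
        show "(\<lambda>v. Poly_Mapping.lookup (A v) m) \<in> regular_funs T V" for m
          unfolding A_def lookup_sum
          by (intro regular_funs_sum single_reg a_reg)
      qed (use keysV in auto)
      have "Q v = A v * P v" for v
      proof (cases "v \<in> V")
        case False
        have "c v k = 0" for k using c_reg[of k] False by (rule regular_funs_outside)
        then have "Q v = 0" by (simp add: Q_sum)
        moreover have "P v = 0" using False q(1) by (simp add: P_def one_def regular_funs_outside)
        ultimately show ?thesis by simp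
      next
        case True
        have cl: "c v (Suc (Suc l)) = a v l - q v * a v (Suc (Suc l))" for l
          using a_rec[of v "Suc (Suc l)"] by (simp add: a_def)
        have c01: "c v 0 = - (q v * a v 0)" "c v (Suc 0) = - (q v * a v (Suc 0))"
          using a_rec[of v 0] a_rec[of v 1] van2[OF True] by (simp_all add: eq_neg_iff_add_eq_0)
        have "A v * P v = (\<Sum>l<2*N. Poly_Mapping.single (mon (Suc (Suc l))) (a v l))
              - (\<Sum>l<2*N. Poly_Mapping.single (mon l) (q v * a v l))"
          using True
          by (simp add: A_def P_def one_def sum_distrib_left sum_distrib_right right_diff_distrib mult_single mon_add sum_subtractf mult.commute)
        also have "(\<Sum>l<2*N. Poly_Mapping.single (mon l) (q v * a v l)) =
            (\<Sum>l<Suc (Suc (2*N)). Poly_Mapping.single (mon l) (q v * a v l))"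
          by (simp add: a0)
        also have "(\<Sum>l<2*N. Poly_Mapping.single (mon (Suc (Suc l))) (a v l)) - \<dots> =
            (\<Sum>l<2*N. Poly_Mapping.single (mon (Suc (Suc l))) (c v (Suc (Suc l)))) +
            (Poly_Mapping.single (mon 0) (c v 0) + Poly_Mapping.single (mon (Suc 0)) (c v (Suc 0)))"
          unfolding sum.lessThan_Suc_shift cl c01
          by (simp add: single_diff single_uminus sum_subtractf o_def)
        also have "\<dots> = (\<Sum>l<Suc (Suc (2*N)). Poly_Mapping.single (mon l) (c v l))"
          unfolding sum.lessThan_Suc_shift by (simp add: o_def)
        also have "\<dots> = Q v" using c0[of "2*N" v] c0[of "Suc (2*N)" v] by (simp add: Q_sum)
        finally show ?thesis by simp
      qed
      then show "\<exists>A. (\<forall>i<(1::nat). A i \<in> regular_polys T V 1) \<and> Q = (\<lambda>v. \<Sum>i<1. A i v * P v)"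
        by (intro exI[of _ "\<lambda>_. A"]) (use Areg in auto)
    qed
  next
    fix u assume u: "u \<in> W"
    have V: "f u \<in> V" using u img by blast
    have kP: "Poly_Mapping.keys (P (f u)) \<subseteq> {mon 0, mon 2}"
      unfolding P_def by (rule order_trans[OF keys_diff]) auto
    have "mpoly_deriv 0 (P (f u)) = (\<Sum>m\<in>{mon 0, mon 2}.
       Poly_Mapping.single (m - mon 1) (of_nat (Poly_Mapping.lookup m 0) * Poly_Mapping.lookup (P (f u)) m))"
      unfolding mpoly_deriv_def mon_def[of 1, symmetric] by (rule sum.mono_neutral_left) (use kP in \<open>auto simp: in_keys_iff\<close>)
    also have "\<dots> = Poly_Mapping.single (mon 1) 2"
      using V by (simp add: P_def one_def lookup_minus lookup_single mon_diff)
    finally have d: "mpoly_deriv 0 (P (f u)) = Poly_Mapping.single (mon 1) 2" .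
    have "mpoly_eval (Poly_Mapping.single (mon 1) 2) (\<lambda>i. b u) = 2 * b u"
      by (subst mpoly_eval_one_variable[of _ 2]) (auto simp: lookup_single eval_nat_numeral)
    then show "det (mat 1 1 (\<lambda>(i, j). mpoly_eval (mpoly_deriv j (P (f u))) (\<lambda>i. b u))) \<noteq> 0"
      using b(2)[OF u] d by (subst det_single) auto
  qed (use b P_reg in auto)
qed

section \<open>The quotient of \<open>R\<close> by the sign change of the odd coordinates\<close>

definition flip :: "'k::field vec \<Rightarrow> 'k vec" where
  "flip c = vec 6 (\<lambda>i. if i = 0 then c $ 0 else - c $ i)"

lemma flip_nth: "flip c $ 0 = c $ 0" "0 < i \<Longrightarrow> i < 6 \<Longrightarrow> flip c $ i = - c $ i"
  by (simp_all add: flip_def)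

lemma flip_carrier: "flip c \<in> carrier_vec 6"
  by (simp add: flip_def)

lemma flip_flip: "c \<in> carrier_vec 6 \<Longrightarrow> flip (flip c) = c"
  by (rule eq_vecI) (auto simp: flip_def)

definition quartic :: "'k::field vec \<Rightarrow> 'k" where
  "quartic c = c $ 0 * (c $ 0 - c $ 1 * c $ 5) - c $ 2 * c $ 3 * c $ 4 * c $ 5"

text \<open>The last polynomial in the definition of \<open>R\<close>; it is even under the change of sign.\<close>
definition quintic :: "'k::field vec \<Rightarrow> 'k" where
  "quintic c = 2 * (c $ 0)^2 * (c $ 3 * c $ 4 + c $ 2 * c $ 5)
       - 2 * c $ 2 * (c $ 3)^2 * (c $ 4)^2 * c $ 5
       + c $ 0 * c $ 1 * (c $ 5)^2 * (c $ 4 - c $ 2)"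

text \<open>The last factor occurs only in order that \<open>R\<close> be the principal open set of an even function.\<close>
definition R_fun :: "'k::field vec \<Rightarrow> 'k" where
  "R_fun c = c $ 0 * (c $ 0 - c $ 1 * c $ 5) * quartic c *
     quintic c *
     (c $ 1 * c $ 5) * (c $ 2 * c $ 5) * (c $ 3 * c $ 5) * (c $ 4 * c $ 5)"

lemma all_less_6: "(\<forall>i<(6::nat). P i) \<longleftrightarrow> P 0 \<and> P 1 \<and> P 2 \<and> P 3 \<and> P 4 \<and> P 5"
proof -
  have "i < 6 \<longleftrightarrow> i = 0 \<or> i = 1 \<or> i = 2 \<or> i = 3 \<or> i = 4 \<or> i = 5" for i :: nat by auto
  then show ?thesis by auto
qed

lemma R_set_principal: "R_set = {c :: 'a::field vec \<in> carrier_vec 6. R_fun c \<noteq> 0}"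
proof -
  have "R_set = {c :: 'a vec \<in> carrier_vec 6. (\<forall>i<6. c $ i \<noteq> 0) \<and> c $ 0 - c $ 1 * c $ 5 \<noteq> 0 \<and> quartic c \<noteq> 0 \<and> quintic c \<noteq> 0}"
    by (simp only: R_set_def quartic_def quintic_def)
  then show ?thesis unfolding R_fun_def all_less_6 by (simp only: mult_eq_0_iff de_Morgan_disj) blast
qed

lemma R_fun_flip: "R_fun (flip c) = R_fun c"
proof -
  have "quartic (flip c) = quartic c" by (simp add: quartic_def flip_nth)
  moreover have "quintic (flip c) = quintic c" by (simp add: quintic_def flip_nth algebra_simps)
  ultimately show ?thesis by (simp add: R_fun_def flip_nth)
qed

lemma flip_R: "c \<in> R_set \<Longrightarrow> flip c \<in> R_set"
  by (simp add: R_set_principal R_fun_flip flip_carrier)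

lemma R_carrier: "c \<in> R_set \<Longrightarrow> c \<in> carrier_vec 6"
  by (simp add: R_set_def)

lemma R_nonzero: "c \<in> R_set \<Longrightarrow> i < 6 \<Longrightarrow> c $ i \<noteq> 0" "c \<in> R_set \<Longrightarrow> quartic c \<noteq> 0"
  by (simp_all add: R_set_def quartic_def)

lemma polyfuns_A6_coord: "i < 6 \<Longrightarrow> (\<lambda>c. c $ i) \<in> polyfuns A6"
  by (rule polyfuns.coord) (auto simp: A6_def)

lemma polyfuns_Mat27_coord: "i < 27 \<Longrightarrow> j < 27 \<Longrightarrow> (\<lambda>m. m $$ (i, j)) \<in> polyfuns Mat27"
  by (rule polyfuns.coord) (auto simp: Mat27_def)

lemma polyfuns_numeral: "(\<lambda>_. numeral n) \<in> polyfuns S" "(\<lambda>_. 1) \<in> polyfuns S" "(\<lambda>_. 0) \<in> polyfuns S"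
  using polyfuns.const[of "numeral n" S] polyfuns.const[of 1 S] polyfuns.const[of 0 S] by simp_all

lemma quartic_poly: "(quartic :: 'f::field alg_closure vec \<Rightarrow> _) \<in> polyfuns A6"
  unfolding quartic_def[abs_def] by (intro polyfuns_intros polyfuns_A6_coord polyfuns_numeral) simp_all

lemma quintic_poly: "(quintic :: 'f::field alg_closure vec \<Rightarrow> _) \<in> polyfuns A6"
  unfolding quintic_def[abs_def] by (intro polyfuns_intros polyfuns_A6_coord polyfuns_numeral) simp_all

lemma R_fun_poly: "(R_fun :: 'f::field alg_closure vec \<Rightarrow> _) \<in> polyfuns A6"
  unfolding R_fun_def[abs_def]
  by (intro polyfuns_intros polyfuns_A6_coord polyfuns_numeral quartic_poly quintic_poly) simp_all

lemma polyfuns_flip: "g \<in> polyfuns A6 \<Longrightarrow> (\<lambda>c. g (flip c)) \<in> polyfuns A6"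
proof (induction rule: polyfuns.induct)
  case (coord y)
  then obtain i where i: "i < 6" "y = (\<lambda>c. c $ i)" by (auto simp: A6_def)
  then show ?case
    by (cases "i = 0") (auto simp: flip_nth intro!: polyfuns_intros polyfuns_A6_coord)
qed (erule (1) polyfuns.add polyfuns.mult | rule polyfuns.const)+

lemma zar_closed_zero_locus: "g \<in> polyfuns S \<Longrightarrow> zar_closed S {p \<in> points S. g p = 0}"
  unfolding zar_closed_def by (intro exI[of _ "{g}"]) auto

lemma zar_openin_self: "zar_openin S W W"
  unfolding zar_openin_def using zar_closed_zero_locus[OF polyfuns_numeral(2), of S]
  by (intro exI[of _ "{}"]) auto

text \<open>
  All that is used of the map: its entries are fractions with even denominators, it is invariant under
  the change of sign, and the generating invariants of the sign change are polynomials in its values.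
  This makes it a bijection from the quotient of \<open>R\<close> by the sign change onto the image.
\<close>
locale invariant_coordinates =
  fixes f :: "'f::field_char_0 alg_closure vec \<Rightarrow> 'f alg_closure mat"
    and p :: "nat \<Rightarrow> 'f alg_closure mat \<Rightarrow> 'f alg_closure"
    and r :: "'f alg_closure mat \<Rightarrow> 'f alg_closure"
  assumes f_carrier: "c \<in> R_set \<Longrightarrow> f c \<in> carrier_mat 27 27"
    and f_entry: "i < 27 \<Longrightarrow> j < 27 \<Longrightarrow>
        \<exists>e\<in>polyfuns A6. \<exists>k. \<forall>c\<in>R_set. f c $$ (i, j) * (c $ 0 * quartic c) ^ k = e c"
    and f_flip: "c \<in> R_set \<Longrightarrow> f (flip c) = f c"
    and p_poly: "i < 5 \<Longrightarrow> p i \<in> polyfuns Mat27"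
    and r_poly: "r \<in> polyfuns Mat27"
    and p_0: "c \<in> R_set \<Longrightarrow> p 0 (f c) = c $ 0"
    and p_i: "c \<in> R_set \<Longrightarrow> 0 < i \<Longrightarrow> i < 5 \<Longrightarrow> p i (f c) = c $ i * c $ 5"
    and r_f: "c \<in> R_set \<Longrightarrow> r (f c) = c $ 2 * c $ 3"
begin

definition den :: "'f alg_closure mat \<Rightarrow> 'f alg_closure" where
  "den m = p 2 m * p 3 m * r m"

text \<open>
  The values of the invariants \<open>c\<^sub>0\<close>, \<open>c\<^sub>i c\<^sub>5\<close> and \<open>c\<^sub>5\<^sup>2 = (c\<^sub>2 c\<^sub>5) (c\<^sub>3 c\<^sub>5) / (c\<^sub>2 c\<^sub>3)\<close> at \<open>c\<close> are those read
  off from the matrix \<open>m\<close>; then \<open>c\<close> is determined by \<open>m\<close> up to \<open>flip\<close>. The matrix need not be in the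
  image of \<open>f\<close>.
\<close>
definition matches :: "'f alg_closure vec \<Rightarrow> 'f alg_closure mat \<Rightarrow> bool" where
  "matches c m \<longleftrightarrow> c \<in> carrier_vec 6 \<and> den m \<noteq> 0 \<and> c $ 0 = p 0 m \<and>
     (\<forall>i\<in>{1..<5}. c $ i * c $ 5 = p i m) \<and> (c $ 5)^2 * r m = p 2 m * p 3 m"

lemma den_poly: "den \<in> polyfuns Mat27"
  unfolding den_def[abs_def] by (intro polyfuns_intros p_poly r_poly) simp_all

lemma matches_f: "c \<in> R_set \<Longrightarrow> matches c (f c)"
  using R_nonzero(1)[of c] by (simp add: matches_def den_def p_0 p_i r_f R_carrier power2_eq_square)

lemma matches_flip: "matches c m \<Longrightarrow> matches (flip c) m"
  by (auto simp: matches_def flip_carrier flip_nth)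

lemma matches_c5: "matches c m \<Longrightarrow> c $ 5 \<noteq> 0"
  by (auto simp: matches_def den_def)

lemma matches_unique:
  assumes "matches c m" "matches d m" shows "d = c \<or> d = flip c"
proof -
  have r: "r m \<noteq> 0" using assms(1) by (auto simp: matches_def den_def)
  have "(d $ 5)^2 * r m = (c $ 5)^2 * r m" using assms by (simp add: matches_def)
  then have "(d $ 5)^2 = (c $ 5)^2" using r by simp
  then consider "d $ 5 = c $ 5" | "d $ 5 = - c $ 5" by (auto simp: power2_eq_iff)
  then show ?thesis
  proof cases
    case 1
    have "d $ i = c $ i" if "i < 6" for i
    proof -
      have "i = 0 \<or> i \<in> {1..<5} \<or> i = 5" using that by auto
      then consider "i = 0" | "i \<in> {1..<5}" | "i = 5" by blast
      then show ?thesis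
      proof cases
        case 2
        then have "d $ i * d $ 5 = c $ i * c $ 5" using assms by (simp add: matches_def)
        then show ?thesis using 1 matches_c5[OF assms(1)] by simp
      qed (use assms 1 in \<open>auto simp: matches_def\<close>)
    qed
    then have "d = c" using assms by (intro eq_vecI) (auto simp: matches_def)
    then show ?thesis ..
  next
    case 2
    have "d $ i = flip c $ i" if "i < 6" for i
    proof -
      have "i = 0 \<or> i \<in> {1..<5} \<or> i = 5" using that by auto
      then consider "i = 0" | "i \<in> {1..<5}" | "i = 5" by blast
      then show ?thesis
      proof cases
        case 2
        then have "d $ i * d $ 5 = c $ i * c $ 5" using assms by (simp add: matches_def)
        then have "- d $ i * c $ 5 = c $ i * c $ 5" using \<open>d $ 5 = - c $ 5\<close> by simp
        then have "- d $ i = c $ i" using matches_c5[OF assms(1)] mult_cancel_right by blast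
        then have "d $ i = - c $ i" by (metis minus_minus)
        then show ?thesis using 2 by (auto simp: flip_nth)
      qed (use assms 2 in \<open>auto simp: matches_def flip_nth\<close>)
    qed
    then have "d = flip c" using assms flip_carrier[of c] by (intro eq_vecI) (auto simp: matches_def)
    then show ?thesis ..
  qed
qed

text \<open>
  The field is algebraically closed, so the required value of \<open>c\<^sub>5\<^sup>2\<close> has a square root.
\<close>
lemma matches_exists:
  assumes "den m \<noteq> 0" obtains c where "matches c m"
proof -
  obtain t where t: "t ^ 2 = p 2 m * p 3 m / r m"
    using nth_root_exists[of 2 "p 2 m * p 3 m / r m"] by auto
  have nz: "r m \<noteq> 0" "p 2 m \<noteq> 0" "p 3 m \<noteq> 0" using assms by (auto simp: den_def)
  have t0: "t \<noteq> 0"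
  proof
    assume "t = 0" with t nz show False by simp
  qed
  define c where "c = vec 6 (\<lambda>i. if i = 0 then p 0 m else if i = 5 then t else p i m / t)"
  have "matches c m"
    using assms t t0 nz by (auto simp: matches_def c_def)
  then show ?thesis by (rule that)
qed

text \<open>
  Each \<open>c\<^sub>i\<close> with \<open>0 < i < 5\<close> is \<open>c\<^sub>5\<close> times a fraction of invariants, and \<open>c\<^sub>5\<^sup>2\<close> is such a fraction. So every
  polynomial in \<open>c\<close> reduces to one of degree at most 1 in \<open>c\<^sub>5\<close>.
\<close>
lemma descend_poly:
  assumes "e \<in> polyfuns A6"
  shows "\<exists>a0\<in>polyfuns Mat27. \<exists>a1\<in>polyfuns Mat27. \<exists>k. \<forall>c m. matches c m \<longrightarrow>
    e c * den m ^ k = a0 m + c $ 5 * a1 m"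
  using assms
proof (induction rule: polyfuns.induct)
  case (const a)
  show ?case
    by (intro bexI[of _ "\<lambda>_. to_ac a"] bexI[of _ "\<lambda>_. 0"] exI[of _ 0]) (auto intro: polyfuns.const polyfuns_numeral)
next
  case (coord y)
  then obtain i where i: "i < 6" "y = (\<lambda>c. c $ i)" by (auto simp: A6_def)
  have "i = 0 \<or> i \<in> {1..<5} \<or> i = 5" using i by auto
  then consider "i = 0" | "i \<in> {1..<5}" | "i = 5" by blast
  then show ?case
  proof cases
    case 1
    show ?thesis unfolding i 1
      by (intro bexI[of _ "p 0"] bexI[of _ "\<lambda>_. 0"] exI[of _ 0])
        (auto intro: p_poly polyfuns_numeral simp: matches_def)
  next
    case 2
    have "c $ i * den m = c $ 5 * (p i m * r m * r m)" if "matches c m" for c m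
    proof -
      have "c $ i * den m = c $ i * (p 2 m * p 3 m) * r m" by (simp add: den_def)
      also have "p 2 m * p 3 m = (c $ 5)^2 * r m" using that by (simp add: matches_def)
      also have "c $ i * ((c $ 5)^2 * r m) * r m = c $ 5 * ((c $ i * c $ 5) * r m * r m)"
        by (simp add: power2_eq_square)
      also have "c $ i * c $ 5 = p i m" using that 2 by (simp add: matches_def)
      finally show ?thesis .
    qed
    then show ?thesis unfolding i
      by (intro bexI[of _ "\<lambda>_. 0"] bexI[of _ "\<lambda>m. p i m * r m * r m"] exI[of _ 1])
        (use 2 in \<open>auto intro!: p_poly r_poly polyfuns_numeral polyfuns_intros\<close>)
  next
    case 3
    show ?thesis unfolding i 3
      by (intro bexI[of _ "\<lambda>_. 0"] bexI[of _ "\<lambda>_. 1"] exI[of _ 0]) (auto intro: polyfuns_numeral)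
  qed
next
  case (add g h)
  then obtain a0 a1 k b0 b1 l where ab: "a0 \<in> polyfuns Mat27" "a1 \<in> polyfuns Mat27"
      "b0 \<in> polyfuns Mat27" "b1 \<in> polyfuns Mat27"
    and g: "\<And>c m. matches c m \<Longrightarrow> g c * den m ^ k = a0 m + c $ 5 * a1 m"
    and h: "\<And>c m. matches c m \<Longrightarrow> h c * den m ^ l = b0 m + c $ 5 * b1 m" by metis
  have "(g c + h c) * den m ^ (k + l) =
      (a0 m * den m ^ l + b0 m * den m ^ k) + c $ 5 * (a1 m * den m ^ l + b1 m * den m ^ k)"
    if "matches c m" for c m
  proof -
    have "(g c + h c) * den m ^ (k + l) = g c * den m ^ k * den m ^ l + h c * den m ^ l * den m ^ k"
      by (simp add: power_add algebra_simps)
    then show ?thesis unfolding g[OF that] h[OF that] by (simp add: algebra_simps)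
  qed
  then show ?case
    by (intro bexI[of _ "\<lambda>m. a0 m * den m ^ l + b0 m * den m ^ k"]
      bexI[of _ "\<lambda>m. a1 m * den m ^ l + b1 m * den m ^ k"] exI[of _ "k + l"])
     (auto intro!: polyfuns_intros ab den_poly)
next
  case (mult g h)
  then obtain a0 a1 k b0 b1 l where ab: "a0 \<in> polyfuns Mat27" "a1 \<in> polyfuns Mat27"
      "b0 \<in> polyfuns Mat27" "b1 \<in> polyfuns Mat27"
    and g: "\<And>c m. matches c m \<Longrightarrow> g c * den m ^ k = a0 m + c $ 5 * a1 m"
    and h: "\<And>c m. matches c m \<Longrightarrow> h c * den m ^ l = b0 m + c $ 5 * b1 m" by metis
  have "(g c * h c) * den m ^ (k + l + 1) =
      (a0 m * b0 m * den m + (p 2 m * p 3 m)^2 * a1 m * b1 m) + c $ 5 * ((a0 m * b1 m + a1 m * b0 m) * den m)"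
    if "matches c m" for c m
  proof -
    have d: "(c $ 5)^2 * den m = (p 2 m * p 3 m)^2"
      proof -
      have "(c $ 5)^2 * den m = ((c $ 5)^2 * r m) * (p 2 m * p 3 m)" by (simp add: den_def)
      also have "(c $ 5)^2 * r m = p 2 m * p 3 m" using that by (simp add: matches_def)
      finally show ?thesis by (simp only: power2_eq_square)
    qed
    have "(g c * h c) * den m ^ (k + l + 1) = (g c * den m ^ k) * (h c * den m ^ l) * den m"
      by (simp add: power_add algebra_simps)
    also have "\<dots> = (a0 m * b0 m * den m + ((c $ 5)^2 * den m) * a1 m * b1 m) + c $ 5 * ((a0 m * b1 m + a1 m * b0 m) * den m)"
      unfolding g[OF that] h[OF that] by (simp add: algebra_simps power2_eq_square)
    finally show ?thesis unfolding d .
  qed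
  then show ?case
    by (intro bexI[of _ "\<lambda>m. a0 m * b0 m * den m + (p 2 m * p 3 m)^2 * a1 m * b1 m"]
      bexI[of _ "\<lambda>m. (a0 m * b1 m + a1 m * b0 m) * den m"] exI[of _ "k + l + 1"])
     (auto intro!: polyfuns_intros ab den_poly p_poly)
qed

text \<open>
  The part with \<open>c\<^sub>5\<close> cancels, by comparison of the values at \<open>c\<close> and \<open>flip c\<close>.
\<close>
lemma descend_even_poly:
  assumes "e \<in> polyfuns A6"
  shows "\<exists>a\<in>polyfuns Mat27. \<exists>k. \<forall>c m. matches c m \<and> e (flip c) = e c \<longrightarrow> e c * den m ^ k = a m"
proof -
  obtain a0 a1 k where a: "a0 \<in> polyfuns Mat27"
      "\<And>c m. matches c m \<Longrightarrow> e c * den m ^ k = a0 m + c $ 5 * a1 m"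
    using descend_poly[OF assms] by metis
  have "e c * den m ^ k = a0 m" if "matches c m" "e (flip c) = e c" for c m
  proof -
    have "a0 m + c $ 5 * a1 m = a0 m + flip c $ 5 * a1 m"
      using a(2)[OF that(1)] a(2)[OF matches_flip[OF that(1)]] that(2) by simp
    then have "c $ 5 * a1 m + c $ 5 * a1 m = 0"
      by (simp add: flip_nth eq_neg_iff_add_eq_0)
    then have "2 * (c $ 5 * a1 m) = 0" unfolding mult_2 .
    then show ?thesis using a(2)[OF that(1)] by simp
  qed
  then show ?thesis using a(1) by blast
qed

lemma fibre:
  assumes "c \<in> R_set" shows "{d \<in> R_set. f d = f c} = {c, flip c}"
proof -
  have "d = c \<or> d = flip c" if "d \<in> R_set" "f d = f c" for d
    using matches_unique[OF matches_f[OF assms]] matches_f[OF that(1)] that(2) by simp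
  then show ?thesis using assms f_flip[OF assms] flip_R[OF assms] by blast
qed

lemma degree_two: "has_degree_onto_image R_set f 2"
  unfolding has_degree_onto_image_def
proof
  fix y assume "y \<in> f ` R_set"
  then obtain c where c: "c \<in> R_set" "y = f c" by blast
  have "flip c \<noteq> c"
  proof
    assume "flip c = c"
    then have "- c $ 1 = c $ 1" using flip_nth(2)[of 1 c] by simp
    then have "2 * c $ 1 = 0" by (metis add.right_inverse mult_2)
    then show False using R_nonzero(1)[OF c(1), of 1] by simp
  qed
  then show "card {d \<in> R_set. f d = y} = 2"
    unfolding c(2) fibre[OF c(1)] by simp
qed

text \<open>
  A matrix \<open>m\<close> with \<open>den m \<noteq> 0\<close> determines a point \<open>c\<close> up to sign. It is in the image if and only if
  this \<open>c\<close> lies in \<open>R\<close>, which is an inequation, and the entries of \<open>f c\<close> are those of \<open>m\<close>, which are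
  equations after the denominators have been cleared. Both are even in \<open>c\<close>, hence conditions on \<open>m\<close>.
\<close>
lemma image_principal:
  obtains Z h where "zar_closed Mat27 Z" "h \<in> polyfuns Mat27" "f ` R_set = {m \<in> Z. h m \<noteq> 0}"
proof -
  let ?Q = "\<lambda>c :: 'f alg_closure vec. c $ 0 * quartic c"
  have Q_poly: "?Q \<in> polyfuns A6" by (intro polyfuns_intros quartic_poly polyfuns_A6_coord) simp
  have Q_even: "?Q (flip c) = ?Q c" for c by (simp add: quartic_def flip_nth)
  obtain Q0 l where Q0: "Q0 \<in> polyfuns Mat27" "\<And>c m. matches c m \<Longrightarrow> ?Q c * den m ^ l = Q0 m"
    using descend_even_poly[OF Q_poly] Q_even by blast
  obtain h0 kh where h0: "h0 \<in> polyfuns Mat27" "\<And>c m. matches c m \<Longrightarrow> R_fun c * den m ^ kh = h0 m"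
    using descend_even_poly[OF R_fun_poly] R_fun_flip by blast
  let ?I = "{..<27} \<times> {..<27::nat}"
  have "\<exists>e k. e \<in> polyfuns A6 \<and> (\<forall>c\<in>R_set. f c $$ ij * ?Q c ^ k = e c)" if "ij \<in> ?I" for ij
    using f_entry[of "fst ij" "snd ij"] that unfolding prod.collapse mem_Times_iff lessThan_iff by blast
  then obtain e k where e: "\<And>ij. ij \<in> ?I \<Longrightarrow> e ij \<in> polyfuns A6"
      "\<And>ij c. ij \<in> ?I \<Longrightarrow> c \<in> R_set \<Longrightarrow> f c $$ ij * ?Q c ^ k ij = e ij c" by metis
  have "\<exists>a n. a \<in> polyfuns Mat27 \<and> (\<forall>c m. matches c m \<and> e ij (flip c) = e ij c \<longrightarrow> e ij c * den m ^ n = a m)"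
    if "ij \<in> ?I" for ij
    using descend_even_poly[OF e(1)[OF that]] by blast
  then obtain a n where a: "\<And>ij. ij \<in> ?I \<Longrightarrow> a ij \<in> polyfuns Mat27"
      "\<And>ij c m. ij \<in> ?I \<Longrightarrow> matches c m \<Longrightarrow> e ij (flip c) = e ij c \<Longrightarrow> e ij c * den m ^ n ij = a ij m" by metis
  have e_even: "e ij (flip c) = e ij c" if "ij \<in> ?I" "c \<in> R_set" for ij c
    using e(2)[OF that(1) that(2)] e(2)[OF that(1) flip_R[OF that(2)]] f_flip[OF that(2)] Q_even[of c] by simp
  define rel where "rel ij m = m $$ ij * (Q0 m ^ k ij * den m ^ n ij) - a ij m * (den m ^ l) ^ k ij" for ij m
  define Z where "Z = {m \<in> points Mat27. \<forall>g\<in>rel ` ?I. g m = 0}"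
  define h where "h m = den m * h0 m" for m
  have rel_poly: "rel ij \<in> polyfuns Mat27" if "ij \<in> ?I" for ij
    unfolding rel_def[abs_def]
    by (intro polyfuns_intros Q0 den_poly a that) (use that polyfuns_Mat27_coord[of "fst ij" "snd ij"] in auto)
  have rel_iff: "rel ij m = 0 \<longleftrightarrow> m $$ ij = f c $$ ij" if "ij \<in> ?I" "c \<in> R_set" "matches c m" for ij c m
  proof -
    let ?d = "?Q c ^ k ij * (den m ^ l) ^ k ij * den m ^ n ij"
    have nz: "?d \<noteq> 0" using R_nonzero[OF that(2)] that(3) by (auto simp: matches_def)
    have "a ij m = f c $$ ij * ?Q c ^ k ij * den m ^ n ij"
      using a(2)[OF that(1,3) e_even[OF that(1,2)]] e(2)[OF that(1,2)] by simp
    moreover have "Q0 m ^ k ij = ?Q c ^ k ij * (den m ^ l) ^ k ij"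
      unfolding Q0(2)[OF that(3), symmetric] by (rule power_mult_distrib)
    ultimately have "rel ij m = (m $$ ij - f c $$ ij) * ?d"
      by (simp add: rel_def algebra_simps)
    moreover have "x * d = 0 \<longleftrightarrow> x = 0" if "d \<noteq> 0" for x d :: "'f alg_closure"
      using that by simp
    from this[OF nz] have "(m $$ ij - f c $$ ij) * ?d = 0 \<longleftrightarrow> m $$ ij - f c $$ ij = 0" .
    ultimately show ?thesis by (simp only: right_minus_eq)
  qed
  show ?thesis
  proof (rule that[of Z h])
    show "zar_closed Mat27 Z" unfolding zar_closed_def Z_def using rel_poly by blast
    show "h \<in> polyfuns Mat27" unfolding h_def[abs_def] by (intro polyfuns_intros den_poly h0)
    show "f ` R_set = {m \<in> Z. h m \<noteq> 0}"
    proof (intro equalityI subsetI)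
      fix m assume "m \<in> f ` R_set"
      then obtain c where c: "c \<in> R_set" "m = f c" by blast
      note mt = matches_f[OF c(1)]
      have "h m \<noteq> 0"
        using h0(2)[OF mt] c mt by (auto simp: h_def R_set_principal matches_def)
      moreover have "m \<in> Z"
        using rel_iff[OF _ c(1) mt] c(2) f_carrier[OF c(1)] by (auto simp: Z_def Mat27_def)
      ultimately show "m \<in> {m \<in> Z. h m \<noteq> 0}" by simp
    next
      fix m assume "m \<in> {m \<in> Z. h m \<noteq> 0}"
      then have m: "m \<in> carrier_mat 27 27" "\<And>ij. ij \<in> ?I \<Longrightarrow> rel ij m = 0" "den m \<noteq> 0" "h0 m \<noteq> 0"
        by (auto simp: Z_def Mat27_def h_def)
      obtain c where mt: "matches c m" using matches_exists[OF m(3)] .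
      have c: "c \<in> R_set"
        using h0(2)[OF mt] m(4) mt by (auto simp: R_set_principal matches_def)
      have "m = f c"
        by (rule eq_matI) (use m f_carrier[OF c] rel_iff[OF _ c mt] in auto)
      then show "m \<in> f ` R_set" using c by blast
    qed
  qed
qed

lemma f_entry_regular:
  assumes "i < 27" "j < 27"
  shows "(\<lambda>c. if c \<in> R_set then f c $$ (i, j) else 0) \<in> regular_funs A6 R_set"
proof (rule regular_funsI)
  obtain e k where e: "e \<in> polyfuns A6" "\<And>c. c \<in> R_set \<Longrightarrow> f c $$ (i, j) * (c $ 0 * quartic c) ^ k = e c"
    using f_entry[OF assms] by blast
  fix c :: "'f alg_closure vec" assume c: "c \<in> R_set"
  show "\<exists>g\<in>polyfuns A6. \<exists>h\<in>polyfuns A6. h c \<noteq> 0 \<and>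
      (\<forall>q\<in>R_set. h q * (if q \<in> R_set then f q $$ (i, j) else 0) = g q)"
    by (intro bexI[of _ e] bexI[of _ "\<lambda>c. (c $ 0 * quartic c) ^ k"])
      (use c R_nonzero e in \<open>auto intro!: polyfuns_intros quartic_poly polyfuns_A6_coord simp: mult.commute\<close>)
qed simp

text \<open>
  The function is constant on the fibres. A local fraction \<open>g / h\<close> for it, valid at both points of the
  fibre, is replaced by one with even numerator and denominator; these are polynomials in the image.
\<close>
lemma descend_regular:
  assumes \<phi>: "\<phi> \<in> regular_funs A6 R_set" and even: "\<And>c. c \<in> R_set \<Longrightarrow> \<phi> (flip c) = \<phi> c"
  shows "\<exists>\<psi>\<in>regular_funs Mat27 (f ` R_set). \<forall>c\<in>R_set. \<psi> (f c) = \<phi> c"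
proof -
  define \<psi> where "\<psi> m = (if m \<in> f ` R_set then \<phi> (SOME c. c \<in> R_set \<and> f c = m) else 0)" for m
  have \<psi>_f: "\<psi> (f c) = \<phi> c" if c: "c \<in> R_set" for c
  proof -
    let ?d = "SOME d. d \<in> R_set \<and> f d = f c"
    have "?d \<in> R_set \<and> f ?d = f c" using c by (rule_tac someI[of _ c]) simp
    then have "?d = c \<or> ?d = flip c" using fibre[OF c] by blast
    then show ?thesis using c even[OF c] by (auto simp: \<psi>_def)
  qed
  have "\<psi> \<in> regular_funs Mat27 (f ` R_set)"
  proof (rule regular_funsI)
    fix m assume "m \<in> f ` R_set"
    then obtain c where c: "c \<in> R_set" "m = f c" by blast
    obtain g h where gh: "g \<in> polyfuns A6" "h \<in> polyfuns A6" "h c \<noteq> 0" "h (flip c) \<noteq> 0"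
        "\<And>d. d \<in> R_set \<Longrightarrow> h d * \<phi> d = g d"
      using regular_funs_two_points[OF \<phi> c(1) flip_R[OF c(1)]] by metis
    define G where "G d = g d * h (flip d) + g (flip d) * h d" for d
    define H where "H d = 2 * (h d * h (flip d))" for d
    have GH_poly: "G \<in> polyfuns A6" "H \<in> polyfuns A6"
      unfolding G_def[abs_def] H_def[abs_def] by (intro polyfuns_intros gh(1,2) polyfuns_numeral polyfuns_flip[OF gh(1)] polyfuns_flip[OF gh(2)])+
    have GH: "H d * \<phi> d = G d" if d: "d \<in> R_set" for d
      unfolding G_def H_def gh(5)[OF d, symmetric] gh(5)[OF flip_R[OF d], symmetric] even[OF d]
      by (simp only: mult_2 ring_distribs mult_ac)
    have GH_even: "G (flip d) = G d" "H (flip d) = H d" if d: "d \<in> R_set" for d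
      by (simp_all add: G_def H_def flip_flip R_carrier d)
    obtain G0 k where G0: "G0 \<in> polyfuns Mat27"
        "\<And>d m. matches d m \<Longrightarrow> G (flip d) = G d \<Longrightarrow> G d * den m ^ k = G0 m"
      using descend_even_poly[OF GH_poly(1)] by blast
    obtain H0 l where H0: "H0 \<in> polyfuns Mat27"
        "\<And>d m. matches d m \<Longrightarrow> H (flip d) = H d \<Longrightarrow> H d * den m ^ l = H0 m"
      using descend_even_poly[OF GH_poly(2)] by blast
    have G0': "G0 (f d) = G d * den (f d) ^ k" and H0': "H0 (f d) = H d * den (f d) ^ l"
      and den: "den (f d) \<noteq> 0" if "d \<in> R_set" for d
      using G0(2)[OF matches_f[OF that]] H0(2)[OF matches_f[OF that]] GH_even[OF that] matches_f[OF that]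
      by (simp_all add: matches_def)
    show "\<exists>g\<in>polyfuns Mat27. \<exists>h\<in>polyfuns Mat27. h m \<noteq> 0 \<and> (\<forall>q\<in>f ` R_set. h q * \<psi> q = g q)"
    proof (rule bexI[of _ "\<lambda>m. G0 m * den m ^ l"], rule bexI[of _ "\<lambda>m. H0 m * den m ^ k"], intro conjI ballI)
      show "H0 m * den m ^ k \<noteq> 0"
        using gh(3,4) den[OF c(1)] by (simp add: c(2) H0'[OF c(1)] H_def)
      fix q assume "q \<in> f ` R_set"
      then obtain d where d: "d \<in> R_set" "q = f d" by blast
      have "H0 q * den q ^ k * \<psi> q = (H d * \<phi> d) * den q ^ l * den q ^ k"
        by (simp add: d(2) \<psi>_f[OF d(1)] H0'[OF d(1)])
      also have "\<dots> = G0 q * den q ^ l"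
        by (simp add: d(2) GH[OF d(1)] G0'[OF d(1)])
      finally show "H0 q * den q ^ k * \<psi> q = G0 q * den q ^ l" .
    qed (auto intro!: polyfuns_intros G0 H0 den_poly)
  qed (simp add: \<psi>_def)
  then show ?thesis using \<psi>_f by blast
qed

lemma regular_flip:
  fixes \<phi> :: "'f alg_closure vec \<Rightarrow> 'f alg_closure"
  assumes "\<phi> \<in> regular_funs A6 R_set"
  shows "(\<lambda>c. if c \<in> R_set then \<phi> (flip c) else 0) \<in> regular_funs A6 R_set"
proof (rule regular_funsI)
  fix c :: "'f alg_closure vec" assume c: "c \<in> R_set"
  obtain g h where gh: "g \<in> polyfuns A6" "h \<in> polyfuns A6" "h (flip c) \<noteq> 0"
      "\<And>d. d \<in> R_set \<Longrightarrow> h d * \<phi> d = g d"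
    using regular_funsD[OF assms flip_R[OF c]] by metis
  show "\<exists>g\<in>polyfuns A6. \<exists>h\<in>polyfuns A6. h c \<noteq> 0 \<and>
      (\<forall>q\<in>R_set. h q * (if q \<in> R_set then \<phi> (flip q) else 0) = g q)"
    by (intro bexI[OF _ polyfuns_flip[OF gh(1)]] bexI[OF _ polyfuns_flip[OF gh(2)]])
      (use gh flip_R in auto)
qed simp

lemma etale_double_cover: "etale_onto_image A6 R_set Mat27 f"
proof -
  obtain Z h where Zh: "zar_closed Mat27 Z" "h \<in> polyfuns Mat27" and img: "f ` R_set = {m \<in> Z. h m \<noteq> 0}"
    using image_principal .
  have "Z \<subseteq> points Mat27" using Zh(1) by (auto simp: zar_closed_def)
  then have "f ` R_set = Z - {m \<in> points Mat27. h m = 0}" unfolding img by auto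
  then have lc: "locally_closed Mat27 (f ` R_set)"
    unfolding locally_closed_def zar_openin_def using Zh(1) zar_closed_zero_locus[OF Zh(2)] by blast
  have mor: "morphism A6 R_set Mat27 (f ` R_set) f"
    unfolding morphism_def using f_entry_regular by (auto simp: Mat27_def)
  have pV: "principal_affine Mat27 (f ` R_set)"
    unfolding principal_affine_def using Zh img by blast
  have "zar_closed A6 (points (A6 :: ('f alg_closure vec, _) aff_space))"
    unfolding zar_closed_def by (intro exI[of _ "{}"]) auto
  moreover have "(R_set :: 'f alg_closure vec set) = {c \<in> points A6. R_fun c \<noteq> 0}"
    by (simp add: R_set_principal A6_def)
  ultimately have pU: "principal_affine A6 (R_set :: 'f alg_closure vec set)"
    unfolding principal_affine_def using R_fun_poly by blast
  have "etale_chart A6 R_set Mat27 (f ` R_set) f"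
  proof (rule etale_chart_double_cover[where \<sigma> = flip and b = "\<lambda>c. if c \<in> R_set then c $ 5 else 0"])
    show "(\<lambda>c :: 'f alg_closure vec. if c \<in> R_set then c $ 5 else 0) \<in> regular_funs A6 R_set"
      by (intro regular_funs_restrict polyfuns_A6_coord) simp
  qed (auto simp: flip_R flip_flip R_carrier f_flip R_nonzero flip_nth intro!: regular_flip descend_regular)
  then show ?thesis
    unfolding etale_onto_image_def etale_def using lc mor pU pV
    by (intro conjI ballI exI[of _ R_set] exI[of _ "f ` R_set"]) (simp_all add: zar_openin_self)
qed

end

section \<open>Matrices of size 27 as a ring, and sparse integer matrices\<close>

text \<open>
  On this type the ring laws hold without side conditions on dimensions, so that the simplifier can
  compute with products of root elements.
\<close>
typedef (overloaded) ('k::field) m27 = "carrier_mat 27 27 :: 'k mat set"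
  morphisms mat_of of_mat by (rule exI[of _ "0\<^sub>m 27 27"]) simp

setup_lifting type_definition_m27

instantiation m27 :: (field) ring_1
begin
lift_definition zero_m27 :: "'a m27" is "0\<^sub>m 27 27" by simp
lift_definition one_m27 :: "'a m27" is "1\<^sub>m 27" by simp
lift_definition plus_m27 :: "'a m27 \<Rightarrow> 'a m27 \<Rightarrow> 'a m27" is "(+)" by simp
lift_definition minus_m27 :: "'a m27 \<Rightarrow> 'a m27 \<Rightarrow> 'a m27" is "(-)" by (rule minus_carrier_mat)
lift_definition times_m27 :: "'a m27 \<Rightarrow> 'a m27 \<Rightarrow> 'a m27" is "(*)" by simp
lift_definition uminus_m27 :: "'a m27 \<Rightarrow> 'a m27" is "uminus" by simp
instance
proof
  show "(0 :: 'a m27) \<noteq> 1"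
  proof (transfer, rule notI)
    assume "0\<^sub>m 27 27 = (1\<^sub>m 27 :: 'a mat)"
    from arg_cong[OF this, of "\<lambda>m. m $$ (0, 0)"] show False by simp
  qed
qed (transfer; auto simp: assoc_mult_mat[where ?n\<^sub>1.0 = 27 and ?n\<^sub>2.0 = 27 and ?n\<^sub>3.0 = 27 and ?n\<^sub>4.0 = 27]
  comm_add_mat[where nr = 27 and nc = 27] assoc_add_mat[where nr = 27 and nc = 27]
  add_mult_distrib_mat[where nr = 27 and n = 27 and nc = 27] mult_add_distrib_mat[where nr = 27 and n = 27 and nc = 27]
  add_uminus_minus_mat[where nr = 27 and nc = 27] intro!: eq_matI)+
end

lift_definition scl :: "'k::field \<Rightarrow> 'k m27 \<Rightarrow> 'k m27" is "(\<cdot>\<^sub>m)" by simp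
lift_definition trn :: "'k::field m27 \<Rightarrow> 'k m27" is transpose_mat by simp
lift_definition ent :: "'k::field m27 \<Rightarrow> nat \<Rightarrow> nat \<Rightarrow> 'k" is "\<lambda>m i j. m $$ (i, j)" .

lemma m27_eqI: "(\<And>i j. i < 27 \<Longrightarrow> j < 27 \<Longrightarrow> ent A i j = ent B i j) \<Longrightarrow> A = B"
  by transfer (auto intro: eq_matI)

lemma ent_simps [simp]:
  assumes "i < 27" "j < 27"
  shows "ent 0 i j = 0" "ent 1 i j = (if i = j then 1 else 0)" "ent (A + B) i j = ent A i j + ent B i j"
    "ent (A - B) i j = ent A i j - ent B i j" "ent (- A) i j = - ent A i j"
    "ent (scl t A) i j = t * ent A i j" "ent (trn A) i j = ent A j i"
  using assms by (transfer; auto)+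

lemma ent_mult:
  assumes "i < 27" "j < 27" shows "ent (A * B) i j = (\<Sum>l<27. ent A i l * ent B l j)"
  using assms by transfer (auto simp: scalar_prod_def lessThan_atLeast0 intro!: sum.cong)

lemma scl_simps [simp]:
  "scl t (scl u A) = scl (t * u) A" "scl 0 A = 0" "scl t 0 = 0" "scl 1 A = A"
  "scl t A * B = scl t (A * B)" "A * scl t B = scl t (A * B)" "scl (- t) A = - scl t A" "scl t (- A) = - scl t A"
  by (rule m27_eqI; simp add: ent_mult sum_distrib_left mult_ac)+

lemma scl_distrib: "scl t (A + B) = scl t A + scl t B" "scl (t + u) A = scl t A + scl u A"
  "scl t (A - B) = scl t A - scl t B" "scl (t - u) A = scl t A - scl u A"
  by (rule m27_eqI; simp add: algebra_simps)+

lemma trn_simps [simp]: "trn (trn A) = A" "trn (A * B) = trn B * trn A" "trn (A + B) = trn A + trn B"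
  "trn (A - B) = trn A - trn B" "trn (- A) = - trn A" "trn 1 = 1" "trn (scl t A) = scl t (trn A)"
  by (rule m27_eqI; simp add: ent_mult mult.commute)+

lemma mat_of_carrier [simp]: "mat_of A \<in> carrier_mat 27 27"
  using mat_of by blast

text \<open>
  The entries \<open>(row, column, value)\<close>. The operations keep the lists sorted and free of zeros, so that equal
  matrices are equal lists and identities can be checked by evaluation.
\<close>
type_synonym sparse = "(int \<times> int \<times> int) list"

definition spent :: "sparse \<Rightarrow> nat \<Rightarrow> nat \<Rightarrow> int" where
  "spent L i j = (\<Sum>(r, s, k)\<leftarrow>L. if r = int i \<and> s = int j then k else 0)"

lift_definition sp :: "sparse \<Rightarrow> 'k::field m27" is "\<lambda>L. mat 27 27 (\<lambda>(i, j). of_int (spent L i j))" by simp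

lemma ent_sp [simp]: "i < 27 \<Longrightarrow> j < 27 \<Longrightarrow> ent (sp L) i j = of_int (spent L i j)"
  by transfer simp

definition valid :: "sparse \<Rightarrow> bool" where
  "valid L \<longleftrightarrow> list_all (\<lambda>(r, s, k). 0 \<le> r \<and> r < 27 \<and> 0 \<le> s \<and> s < 27) L"

fun ins :: "int \<Rightarrow> int \<Rightarrow> int \<Rightarrow> sparse \<Rightarrow> sparse" where
  "ins r s k [] = [(r, s, k)]"
| "ins r s k ((r', s', k') # L) =
     (if r < r' then (r, s, k) # (r', s', k') # L
      else if r' < r then (r', s', k') # ins r s k L
      else if s < s' then (r, s, k) # (r', s', k') # L
      else if s' < s then (r', s', k') # ins r s k L
      else if k + k' = 0 then L else (r, s, k + k') # L)"

text \<open>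
  Adds to \<open>M\<close> the row of \<open>B\<close> with index \<open>k\<close>, multiplied by \<open>a\<close> and moved to row \<open>r\<close>.
\<close>
fun sprow :: "int \<Rightarrow> int \<Rightarrow> int \<Rightarrow> sparse \<Rightarrow> sparse \<Rightarrow> sparse" where
  "sprow r k a [] M = M"
| "sprow r k a ((k', s, b) # B) M = (if k = k' then ins r s (a * b) (sprow r k a B M) else sprow r k a B M)"

fun spmul :: "sparse \<Rightarrow> sparse \<Rightarrow> sparse" where
  "spmul [] B = []"
| "spmul ((r, k, a) # A) B = sprow r k a B (spmul A B)"

fun spadd :: "sparse \<Rightarrow> sparse \<Rightarrow> sparse" where
  "spadd [] B = B"
| "spadd ((r, s, k) # A) B = ins r s k (spadd A B)"

fun sptrn :: "sparse \<Rightarrow> sparse" where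
  "sptrn [] = []"
| "sptrn ((r, s, k) # A) = ins s r k (sptrn A)"

fun spneg :: "sparse \<Rightarrow> sparse" where
  "spneg [] = []"
| "spneg ((r, s, k) # A) = (r, s, - k) # spneg A"

definition spone :: sparse where
  "spone = [(0,0,1), (1,1,1), (2,2,1), (3,3,1), (4,4,1), (5,5,1), (6,6,1), (7,7,1), (8,8,1),
    (9,9,1), (10,10,1), (11,11,1), (12,12,1), (13,13,1), (14,14,1), (15,15,1), (16,16,1), (17,17,1),
    (18,18,1), (19,19,1), (20,20,1), (21,21,1), (22,22,1), (23,23,1), (24,24,1), (25,25,1), (26,26,1)]"

lemma spent_simps: "spent [] i j = 0"
  "spent ((r, s, k) # L) i j = (if r = int i \<and> s = int j then k else 0) + spent L i j"
  by (simp_all add: spent_def)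

lemma spent_ins: "spent (ins r s k L) i j = (if r = int i \<and> s = int j then k else 0) + spent L i j"
  by (induction r s k L rule: ins.induct) (auto simp: spent_simps)

lemma spent_sprow: "k = int l \<Longrightarrow> spent (sprow r k a B M) i j = (if r = int i then a * spent B l j else 0) + spent M i j"
  by (induction r k a B M rule: sprow.induct) (auto simp: spent_simps spent_ins algebra_simps)

lemma sp_add: "sp (spadd A B) = sp A + sp B"
proof -
  have "spent (spadd A B) i j = spent A i j + spent B i j" for i j
    by (induction A B rule: spadd.induct) (auto simp: spent_simps spent_ins)
  then show ?thesis by (intro m27_eqI) simp
qed

lemma sp_neg: "sp (spneg A) = - sp A"
proof -
  have "spent (spneg A) i j = - spent A i j" for i j
    by (induction A rule: spneg.induct) (auto simp: spent_simps)
  then show ?thesis by (intro m27_eqI) simp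
qed

lemma sp_trn: "sp (sptrn A) = trn (sp A)"
proof -
  have "spent (sptrn A) i j = spent A j i" for i j
    by (induction A rule: sptrn.induct) (auto simp: spent_simps spent_ins)
  then show ?thesis by (intro m27_eqI) simp
qed

lemma sp_mult:
  assumes "valid A" shows "sp (spmul A B) = sp A * sp B"
proof -
  have "spent (spmul A B) i j = (\<Sum>l<27. spent A i l * spent B l j)" for i j
    using assms
  proof (induction A B rule: spmul.induct)
    case (2 r k a A B)
    from 2(2) have k: "0 \<le> k" "k < 27" and "valid A" by (auto simp: valid_def)
    have "(\<Sum>l<27. spent ((r, k, a) # A) i l * spent B l j) =
        (\<Sum>l<27. if l = nat k then (if r = int i then a * spent B l j else 0) else 0) + (\<Sum>l<27. spent A i l * spent B l j)"
      unfolding sum.distrib[symmetric]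
      by (rule sum.cong) (use k in \<open>auto simp: spent_simps algebra_simps\<close>)
    also have "(\<Sum>l<27. if l = nat k then (if r = int i then a * spent B l j else 0) else 0) = (if r = int i then a * spent B (nat k) j else 0)"
      using k by (subst sum.delta) auto
    finally show ?case
      using 2(1)[OF \<open>valid A\<close>] spent_sprow[of k "nat k" r a B "spmul A B" i j] k by simp
  qed (simp add: spent_simps)
  then show ?thesis by (intro m27_eqI) (simp add: ent_mult)
qed

lemma sp_Nil: "sp [] = 0"
  by (rule m27_eqI) (simp add: spent_simps)

lemma sp_one: "sp spone = 1"
proof (rule m27_eqI)
  fix i j :: nat assume "i < 27" "j < 27"
  have "spent spone i j = (if i = j then 1 else 0)"
  proof -
    have 1: "spent (map (\<lambda>l. (int l, int l, 1)) [0..<n]) i j = (if i = j \<and> i < n then 1 else 0)" for n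
      by (induction n) (auto simp: spent_def)
    have 2: "spone = map (\<lambda>l. (int l, int l, 1)) [0..<27]"
      by (simp add: spone_def upt_conv_Cons)
    show ?thesis unfolding 2 1 using \<open>i < 27\<close> by simp
  qed
  then show "ent (sp spone) i j = ent (1 :: 'a m27) i j" using \<open>i < 27\<close> \<open>j < 27\<close> by simp
qed

section \<open>A table of root vectors\<close>

text \<open>
  For each positive root an integral root vector; those of the simple roots are the matrices
  \<open>raising_mat i\<close>. The other ones are determined up to sign by the action of the simple reflections
  (\<open>refl_ok\<close>). The signs are one possible choice; those of a given Chevalley system are compared with
  it by \<open>sg\<close> below. The transposed matrices are the root vectors of the negative roots.
\<close>
definition pos_table :: "(int list \<times> sparse) list" where
  "pos_table = [
     ([1,0,0,0,0,0], [(0,1,1), (10,12,1), (13,15,1), (16,17,1), (18,19,1), (20,21,1)]),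
     ([0,1,0,0,0,0], [(3,4,1), (5,6,1), (7,9,1), (18,20,1), (19,21,1), (22,23,1)]),
     ([0,0,1,0,0,0], [(1,2,1), (8,10,1), (11,13,1), (14,16,1), (19,22,1), (21,23,1)]),
     ([0,0,0,1,0,0], [(2,3,1), (6,8,1), (9,11,1), (16,18,1), (17,19,1), (23,24,1)]),
     ([0,0,0,0,1,0], [(3,5,1), (4,6,1), (11,14,1), (13,16,1), (15,17,1), (24,25,1)]),
     ([0,0,0,0,0,1], [(5,7,1), (6,9,1), (8,11,1), (10,13,1), (12,15,1), (25,26,1)]),
     ([1,0,1,0,0,0], [(0,2,-1), (8,12,1), (11,15,1), (14,17,1), (18,22,-1), (20,23,-1)]),
     ([0,1,0,1,0,0], [(2,4,1), (5,8,-1), (7,11,-1), (16,20,1), (17,21,1), (22,24,-1)]),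
     ([0,0,1,1,0,0], [(1,3,-1), (6,10,1), (9,13,1), (14,18,-1), (17,22,1), (21,24,-1)]),
     ([0,0,0,1,1,0], [(2,5,-1), (4,8,1), (9,14,-1), (13,18,1), (15,19,1), (23,25,-1)]),
     ([0,0,0,0,1,1], [(3,7,-1), (4,9,-1), (8,14,1), (10,16,1), (12,17,1), (24,26,-1)]),
     ([1,0,1,1,0,0], [(0,3,1), (6,12,1), (9,15,1), (14,19,-1), (16,22,-1), (20,24,1)]),
     ([0,1,1,1,0,0], [(1,4,1), (5,10,1), (7,13,1), (14,20,1), (17,23,-1), (19,24,-1)]),
     ([0,1,0,1,1,0], [(2,6,-1), (3,8,-1), (7,14,1), (13,20,1), (15,21,1), (22,25,1)]),
     ([0,0,1,1,1,0], [(1,5,1), (4,10,1), (9,16,-1), (11,18,-1), (15,22,1), (21,25,1)]),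
     ([0,0,0,1,1,1], [(2,7,1), (4,11,-1), (6,14,-1), (10,18,1), (12,19,1), (23,26,1)]),
     ([1,1,1,1,0,0], [(0,4,-1), (5,12,1), (7,15,1), (14,21,1), (16,23,1), (18,24,1)]),
     ([1,0,1,1,1,0], [(0,5,-1), (4,12,1), (9,17,-1), (11,19,-1), (13,22,-1), (20,25,-1)]),
     ([0,1,1,1,1,0], [(1,6,-1), (3,10,1), (7,16,-1), (11,20,1), (15,23,-1), (19,25,1)]),
     ([0,1,0,1,1,1], [(2,9,1), (3,11,1), (5,14,1), (10,20,1), (12,21,1), (22,26,-1)]),
     ([0,0,1,1,1,1], [(1,7,-1), (4,13,-1), (6,16,-1), (8,18,-1), (12,22,1), (21,26,-1)]),
     ([1,1,1,1,1,0], [(0,6,1), (3,12,1), (7,17,-1), (11,21,1), (13,23,1), (18,25,-1)]),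
     ([1,0,1,1,1,1], [(0,7,1), (4,15,-1), (6,17,-1), (8,19,-1), (10,22,-1), (20,26,1)]),
     ([0,1,1,2,1,0], [(1,8,1), (2,10,1), (7,18,1), (9,20,1), (15,24,1), (17,25,1)]),
     ([0,1,1,1,1,1], [(1,9,1), (3,13,-1), (5,16,-1), (8,20,1), (12,23,-1), (19,26,-1)]),
     ([1,1,1,2,1,0], [(0,8,-1), (2,12,1), (7,19,1), (9,21,1), (13,24,-1), (16,25,-1)]),
     ([1,1,1,1,1,1], [(0,9,-1), (3,15,-1), (5,17,-1), (8,21,1), (10,23,1), (18,26,1)]),
     ([0,1,1,2,1,1], [(1,11,-1), (2,13,-1), (5,18,1), (6,20,1), (12,24,1), (17,26,-1)]),
     ([1,1,2,2,1,0], [(0,10,1), (1,12,1), (7,22,-1), (9,23,-1), (11,24,-1), (14,25,-1)]),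
     ([1,1,1,2,1,1], [(0,11,1), (2,15,-1), (5,19,1), (6,21,1), (10,24,-1), (16,26,1)]),
     ([0,1,1,2,2,1], [(1,14,1), (2,16,1), (3,18,1), (4,20,1), (12,25,-1), (15,26,-1)]),
     ([1,1,2,2,1,1], [(0,13,-1), (1,15,-1), (5,22,-1), (6,23,-1), (8,24,-1), (14,26,1)]),
     ([1,1,1,2,2,1], [(0,14,-1), (2,17,1), (3,19,1), (4,21,1), (10,25,1), (13,26,1)]),
     ([1,1,2,2,2,1], [(0,16,1), (1,17,1), (3,22,-1), (4,23,-1), (8,25,1), (11,26,1)]),
     ([1,1,2,3,2,1], [(0,18,-1), (1,19,-1), (2,22,-1), (4,24,1), (6,25,1), (9,26,1)]),
     ([1,2,2,3,2,1], [(0,20,1), (1,21,1), (2,23,1), (3,24,1), (5,25,1), (7,26,1)])]"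

text \<open>The \<open>i\<close>-th simple reflection in coordinates with respect to the simple roots.\<close>
fun srefl :: "int \<Rightarrow> int list \<Rightarrow> int list" where
  "srefl i [a, b, c, d, e, f] =
    (if i = 1 then [c - a, b, c, d, e, f]
     else if i = 2 then [a, d - b, c, d, e, f]
     else if i = 3 then [a, b, a + d - c, d, e, f]
     else if i = 4 then [a, b, c, b + c + e - d, e, f]
     else if i = 5 then [a, b, c, d, d + f - e, f]
     else [a, b, c, d, e, e - f])"
| "srefl i _ = []"

definition simple_vec :: "int \<Rightarrow> int list" where
  "simple_vec i = map (\<lambda>j. if j = i then 1 else 0) [1, 2, 3, 4, 5, 6]"

definition is_root :: "int list \<Rightarrow> bool" where
  "is_root \<beta> \<longleftrightarrow> \<beta> \<in> fst ` set pos_table \<or> map uminus \<beta> \<in> fst ` set pos_table"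

definition rootL :: "int list \<Rightarrow> sparse" where
  "rootL \<beta> = (case map_of pos_table \<beta> of Some L \<Rightarrow> L
     | None \<Rightarrow> sptrn (the (map_of pos_table (map uminus \<beta>))))"

text \<open>
  The representative of a simple reflection with root vector \<open>L\<close> sends the \<open>s\<close>-th basis vector to a basis
  vector up to sign; this is its index and the sign.
\<close>
fun mv :: "sparse \<Rightarrow> int \<Rightarrow> int \<times> int" where
  "mv [] s = (s, 1)"
| "mv ((a, b, k) # L) s = (if s = b then (a, 1) else if s = a then (b, - 1) else mv L s)"

text \<open>The conjugate of a matrix by the representative of a simple reflection.\<close>
fun relabel :: "sparse \<Rightarrow> sparse \<Rightarrow> sparse" where
  "relabel L0 [] = []"
| "relabel L0 ((r, s, k) # L) = (case mv L0 r of (r', a) \<Rightarrow> case mv L0 s of (s', b) \<Rightarrow> ins r' s' (a * b * k) (relabel L0 L))"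

text \<open>
  Conjugation by the representative of the \<open>i\<close>-th simple reflection permutes the tabulated root vectors
  up to sign; the only positive root that becomes negative is the simple root \<open>\<alpha>\<close> itself.
\<close>
fun chk :: "int \<Rightarrow> int list \<Rightarrow> sparse \<Rightarrow> (int list \<times> sparse) list \<Rightarrow> (int list \<times> sparse) list \<Rightarrow> bool" where
  "chk i \<alpha> L0 T [] = True"
| "chk i \<alpha> L0 T ((\<beta>, L) # S) = ((let c = relabel L0 L in
     case map_of T (srefl i \<beta>) of None \<Rightarrow> \<beta> = \<alpha> \<and> c = spneg (sptrn L0)
       | Some L' \<Rightarrow> c = L' \<or> c = spneg L') \<and> chk i \<alpha> L0 T S)"

fun mv_list :: "sparse \<Rightarrow> sparse \<Rightarrow> sparse" where
  "mv_list L0 [] = []"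
| "mv_list L0 ((s, _, _) # L) = (case mv L0 s of (r, k) \<Rightarrow> ins r s k (mv_list L0 L))"

definition refl_ok :: "int \<Rightarrow> bool" where
  "refl_ok i = (let L0 = rootL (simple_vec i); A = spadd spone L0; B = spadd spone (spneg (sptrn L0)); n = mv_list L0 spone in
     valid A \<and> valid B \<and> valid n \<and> spmul A (spmul B A) = n \<and>
     spmul n (sptrn n) = spone \<and> spmul (sptrn n) n = spone \<and> valid (sptrn n) \<and>
     chk i (simple_vec i) L0 pos_table pos_table)"

lemma refl_ok1: "refl_ok 1" by code_simp
lemma refl_ok2: "refl_ok 2" by code_simp
lemma refl_ok3: "refl_ok 3" by code_simp
lemma refl_ok4: "refl_ok 4" by code_simp
lemma refl_ok5: "refl_ok 5" by code_simp
lemma refl_ok6: "refl_ok 6" by code_simp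

text \<open>The entry at integer indices; evaluation with numerals of type \<open>int\<close> is fast.\<close>
fun spentI :: "sparse \<Rightarrow> int \<Rightarrow> int \<Rightarrow> int" where
  "spentI [] i j = 0"
| "spentI ((r, s, k) # L) i j = (if r = i \<and> s = j then k + spentI L i j else spentI L i j)"

lemma spent_spentI: "spent L i j = spentI L (int i) (int j)"
  by (induction L "int i" "int j" rule: spentI.induct) (auto simp: spent_simps)

definition index_weights :: "(int \<times> int list) list" where
  "index_weights = zip (map (fst \<circ> snd) spone) weights"

definition raising_ok :: "int \<Rightarrow> int list \<Rightarrow> bool" where
  "raising_ok i c = (let L = rootL (simple_vec i); Z = index_weights in
     list_all (\<lambda>(r, v). list_all (\<lambda>(s, w). spentI L r s = (if v = map2 (+) w c then 1 else 0)) Z) Z)"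

lemma cartan_rows:
  "map (cartan 1) [1..<7] = [2, 0, -1, 0, 0, 0]" "map (cartan 2) [1..<7] = [0, 2, 0, -1, 0, 0]"
  "map (cartan 3) [1..<7] = [-1, 0, 2, -1, 0, 0]" "map (cartan 4) [1..<7] = [0, -1, -1, 2, -1, 0]"
  "map (cartan 5) [1..<7] = [0, 0, 0, -1, 2, -1]" "map (cartan 6) [1..<7] = [0, 0, 0, 0, -1, 2]"
  by (simp_all add: upt_conv_Cons cartan_def doubleton_eq_iff)

lemma raising_ok:
  "raising_ok 1 [2, 0, -1, 0, 0, 0]" "raising_ok 2 [0, 2, 0, -1, 0, 0]"
  "raising_ok 3 [-1, 0, 2, -1, 0, 0]" "raising_ok 4 [0, -1, -1, 2, -1, 0]"
  "raising_ok 5 [0, 0, 0, -1, 2, -1]" "raising_ok 6 [0, 0, 0, 0, -1, 2]"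
  by code_simp+

lemma index_weights_nth:
  assumes "r < 27" shows "(int r, weights ! r) \<in> set index_weights"
proof -
  have 1: "map (fst \<circ> snd) spone = map int [0..<27]"
    by (simp add: spone_def upt_conv_Cons)
  have "length weights = 27" by (simp add: weights_def)
  then have "index_weights ! r = (int r, weights ! r)" "r < length index_weights"
    using assms by (simp_all add: index_weights_def 1)
  then show ?thesis by (metis nth_mem)
qed

lemma raising_mat_sparse:
  assumes "i \<in> {1..6}" shows "raising_mat i = (mat_of (sp (rootL (simple_vec (int i)))) :: 'k::field mat)"
proof -
  have *: "raising_ok (int i) (map (cartan i) [1..<7])"
  proof -
    have "i = 1 \<or> i = 2 \<or> i = 3 \<or> i = 4 \<or> i = 5 \<or> i = 6" using assms by auto
    then show ?thesis by (elim disjE) (simp_all only: cartan_rows raising_ok of_nat_1 of_nat_numeral)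
  qed
  have "of_mat (raising_mat i) = (sp (rootL (simple_vec (int i))) :: 'k m27)"
  proof (rule m27_eqI)
    fix r s :: nat assume rs: "r < 27" "s < 27"
    have "spent (rootL (simple_vec (int i))) r s = (if weights ! r = map2 (+) (weights ! s) (map (cartan i) [1..<7]) then 1 else 0)"
      using * index_weights_nth[OF rs(1)] index_weights_nth[OF rs(2)]
      unfolding spent_spentI raising_ok_def Let_def list_all_iff by fastforce
    then show "ent (of_mat (raising_mat i)) r s = ent (sp (rootL (simple_vec (int i))) :: 'k m27) r s"
      using rs by (simp add: ent.rep_eq of_mat_inverse raising_mat_def sp.rep_eq)
  qed
  then show ?thesis
    by (metis mat_carrier of_mat_inverse raising_mat_def)
qed

lemma simple_root_vec: "i \<in> {1..6} \<Longrightarrow> simple_root i = simple_vec (int i)"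
proof -
  assume "i \<in> {1..6}"
  then have "i = 1 \<or> i = 2 \<or> i = 3 \<or> i = 4 \<or> i = 5 \<or> i = 6" by auto
  then show ?thesis by (elim disjE) (simp_all add: simple_root_def simple_vec_def upt_conv_Cons)
qed

lemma sum_1_6: "(\<Sum>i\<in>{1..6::nat}. g i) = g 1 + g 2 + g 3 + g 4 + g 5 + (g 6 :: int)"
proof -
  have "{1..6::nat} = {1, 2, 3, 4, 5, 6}" by auto
  then show ?thesis by simp
qed

lemma cartan_values:
  "cartan 1 1 = 2" "cartan 1 2 = 0" "cartan 1 3 = -1" "cartan 1 4 = 0" "cartan 1 5 = 0" "cartan 1 6 = 0"
  "cartan 2 1 = 0" "cartan 2 2 = 2" "cartan 2 3 = 0" "cartan 2 4 = -1" "cartan 2 5 = 0" "cartan 2 6 = 0"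
  "cartan 3 1 = -1" "cartan 3 2 = 0" "cartan 3 3 = 2" "cartan 3 4 = -1" "cartan 3 5 = 0" "cartan 3 6 = 0"
  "cartan 4 1 = 0" "cartan 4 2 = -1" "cartan 4 3 = -1" "cartan 4 4 = 2" "cartan 4 5 = -1" "cartan 4 6 = 0"
  "cartan 5 1 = 0" "cartan 5 2 = 0" "cartan 5 3 = 0" "cartan 5 4 = -1" "cartan 5 5 = 2" "cartan 5 6 = -1"
  "cartan 6 1 = 0" "cartan 6 2 = 0" "cartan 6 3 = 0" "cartan 6 4 = 0" "cartan 6 5 = -1" "cartan 6 6 = 2"
  by (simp_all add: cartan_def doubleton_eq_iff)

lemma length_6:
  assumes "length xs = 6" obtains a b c d e f where "xs = [a, b, c, d, e, f]"
  using assms by (auto simp: length_Suc_conv eval_nat_numeral)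

lemma root_pairing_explicit:
  "root_pairing [a, b, c, d, e, f] [a', b', c', d', e', f'] =
     a * (2 * a' - c') + b * (2 * b' - d') + c * (2 * c' - a' - d') + d * (2 * d' - b' - c' - e') +
     e * (2 * e' - d' - f') + f * (2 * f' - e')"
  unfolding root_pairing_def sum_1_6 cartan_values by (simp add: algebra_simps)

lemma root_refl_simple:
  assumes "i \<in> {1..6}" "length \<beta> = 6" shows "root_refl (simple_root i) \<beta> = srefl (int i) \<beta>"
proof -
  obtain a b c d e f where \<beta>: "\<beta> = [a, b, c, d, e, f]" using length_6[OF assms(2)] .
  have "i = 1 \<or> i = 2 \<or> i = 3 \<or> i = 4 \<or> i = 5 \<or> i = 6" using assms(1) by auto
  then show ?thesis
    unfolding simple_root_vec[OF assms(1)] root_refl_def \<beta>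
    by (elim disjE) (simp_all add: simple_vec_def root_pairing_explicit)
qed

lemma table_ok:
  "list_all (\<lambda>(\<beta>, L). valid L \<and> valid (sptrn L) \<and> spmul L L = [] \<and> spmul L (spmul (sptrn L) L) = L) pos_table"
  by code_simp

lemma table_keys:
  "distinct (map fst pos_table)"
  "list_all (\<lambda>(\<beta>, L). length \<beta> = 6 \<and> list_all (\<lambda>b. 0 \<le> b) \<beta> \<and> list_ex (\<lambda>b. 0 < b) \<beta>) pos_table"
  by code_simp+

section \<open>Simple reflections acting on root elements\<close>

text \<open>
  The representative of the simple reflection in the group, as a signed permutation matrix; see \<open>nmat_eq\<close>.
\<close>
definition nmat :: "nat \<Rightarrow> 'k::field m27" where
  "nmat i = sp (mv_list (rootL (simple_vec (int i))) spone)"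

lemma refl_ok: "i \<in> {1..6} \<Longrightarrow> refl_ok (int i)"
proof -
  assume "i \<in> {1..6}"
  then have "i = 1 \<or> i = 2 \<or> i = 3 \<or> i = 4 \<or> i = 5 \<or> i = 6" by auto
  then show ?thesis
    using refl_ok1 refl_ok2 refl_ok3 refl_ok4 refl_ok5 refl_ok6 by (elim disjE) simp_all
qed

lemma spone_map: "spone = map (\<lambda>l. (int l, int l, 1)) [0..<27]"
  by (simp add: spone_def upt_conv_Cons)

lemma sp_Cons: "sp ((r, s, k) # L) = sp [(r, s, k)] + sp L"
  by (rule m27_eqI) (simp add: spent_simps)

lemma sp_ins: "sp (ins r s k L) = sp [(r, s, k)] + sp L"
  by (rule m27_eqI) (simp add: spent_simps spent_ins)

lemma spent_mv_list:
  "spent (mv_list L0 (map (\<lambda>l. (int l, int l, 1)) [0..<n])) i j =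
    (if j < n \<and> fst (mv L0 (int j)) = int i then snd (mv L0 (int j)) else 0)"
proof -
  have "spent (mv_list L0 (map (\<lambda>l. (int l, int l, 1)) [m..<n])) i j =
      (if m \<le> j \<and> j < n \<and> fst (mv L0 (int j)) = int i then snd (mv L0 (int j)) else 0)" if "m \<le> n" for m
    using that
  proof (induction "n - m" arbitrary: m)
    case 0 then show ?case by (simp add: spent_simps)
  next
    case (Suc d)
    then have "[m..<n] = m # [Suc m..<n]" by (simp add: upt_conv_Cons)
    then show ?case
      using Suc.hyps(1)[of "Suc m"] Suc.hyps(2) Suc.prems by (cases "j = m") (auto simp: spent_ins split: prod.splits)
  qed
  from this[of 0] show ?thesis by simp
qed

lemma ent_nmat:
  assumes "i < 27" "j < 27"
  shows "ent (nmat n) i j = (if fst (mv (rootL (simple_vec (int n))) (int j)) = int i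
    then of_int (snd (mv (rootL (simple_vec (int n))) (int j))) else 0)"
  using assms unfolding nmat_def by (simp add: spone_map spent_mv_list)

lemma conj_entry:
  assumes "valid [(r, s, k)]" "mv (rootL (simple_vec (int n))) r = (r', a)" "mv (rootL (simple_vec (int n))) s = (s', b)"
  shows "nmat n * sp [(r, s, k)] * trn (nmat n) = (sp [(r', s', a * b * k)] :: 'k::field m27)"
proof (rule m27_eqI)
  let ?N = "nmat n :: 'k m27"
  fix i j :: nat assume ij: "i < 27" "j < 27"
  from assms(1) obtain rn sn where rs: "r = int rn" "s = int sn" "rn < 27" "sn < 27"
    by (auto simp: valid_def dest!: zero_le_imp_eq_int)
  have "ent (?N * sp [(r, s, k)] * trn (?N)) i j =
      (\<Sum>b'<27. (\<Sum>a'<27. ent (?N) i a' * of_int (if rn = a' \<and> sn = b' then k else 0)) * ent (?N) j b')"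
    using ij rs by (simp add: ent_mult spent_simps)
  also have "\<dots> = (\<Sum>b'<27. (if sn = b' then ent (?N) i rn * of_int k else 0) * ent (?N) j b')"
  proof (rule sum.cong[OF HOL.refl], rule arg_cong2[where f = "(*)"], goal_cases)
    case (1 b')
    have "(\<Sum>a'<27. ent (?N) i a' * of_int (if rn = a' \<and> sn = b' then k else 0)) =
        (\<Sum>a'<27. if rn = a' then (if sn = b' then ent (?N) i rn * of_int k else 0) else 0)"
      by (rule sum.cong) auto
    also have "\<dots> = (if sn = b' then ent (?N) i rn * of_int k else 0)" using rs by simp
    finally show ?case .
  qed simp
  also have "\<dots> = (\<Sum>b'<27. if sn = b' then ent (?N) i rn * of_int k * ent (?N) j sn else 0)"
    by (rule sum.cong) auto
  also have "\<dots> = ent (?N) i rn * of_int k * ent (?N) j sn" using rs by simp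
  also have "\<dots> = ent (sp [(r', s', a * b * k)]) i j"
    using assms(2,3) rs ij by (simp add: ent_nmat spent_simps)
  finally show "ent (?N * sp [(r, s, k)] * trn (?N)) i j = ent (sp [(r', s', a * b * k)] :: 'k m27) i j" .
qed

lemma conj_sparse: "valid L \<Longrightarrow> nmat n * sp L * trn (nmat n) = sp (relabel (rootL (simple_vec (int n))) L)"
proof (induction L)
  case Nil then show ?case by (simp add: sp_Nil)
next
  case (Cons e L)
  obtain r s k where e: "e = (r, s, k)" by (cases e)
  obtain r' a where 1: "mv (rootL (simple_vec (int n))) r = (r', a)" by fastforce
  obtain s' b where 2: "mv (rootL (simple_vec (int n))) s = (s', b)" by fastforce
  have v: "valid [(r, s, k)]" "valid L" using Cons.prems by (auto simp: valid_def e)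
  show ?case
    using Cons.IH[OF v(2)] conj_entry[OF v(1) 1 2]
    by (simp add: e sp_Cons[of r s k L] sp_ins 1 2 distrib_left distrib_right)
qed

lemma uminus_uminus: "map uminus (map uminus \<beta>) = (\<beta> :: int list)"
  by (simp add: o_def)

lemma is_root_neg: "is_root (map uminus \<beta>) \<longleftrightarrow> is_root \<beta>"
  unfolding is_root_def uminus_uminus by blast

lemma pos_length: "(\<beta>, L) \<in> set pos_table \<Longrightarrow> length \<beta> = 6"
  using table_keys(2) by (auto simp: list_all_iff)

lemma is_root_length: "is_root \<beta> \<Longrightarrow> length \<beta> = 6"
  unfolding is_root_def using pos_length by (metis imageE length_map prod.collapse)

lemma rootL_pos: "(\<beta>, L) \<in> set pos_table \<Longrightarrow> rootL \<beta> = L"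
  using map_of_is_SomeI[OF table_keys(1)] by (simp add: rootL_def)

lemma rootL_neg: "(\<beta>, L) \<in> set pos_table \<Longrightarrow> rootL (map uminus \<beta>) = sptrn L"
proof -
  assume \<beta>: "(\<beta>, L) \<in> set pos_table"
  have "map_of pos_table (map uminus \<beta>) = None"
  proof (rule ccontr)
    assume "map_of pos_table (map uminus \<beta>) \<noteq> None"
    then obtain L' where "(map uminus \<beta>, L') \<in> set pos_table" by (auto dest: map_of_SomeD)
    then have "list_all (\<lambda>b. 0 \<le> b) (map uminus \<beta>)" using table_keys(2) by (auto simp: list_all_iff)
    moreover have "list_ex (\<lambda>b. 0 < b) \<beta>" using \<beta> table_keys(2) by (auto simp: list_all_iff)
    ultimately show False by (auto simp: list_all_iff list_ex_iff)
  qed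
  then show ?thesis
    using map_of_is_SomeI[OF table_keys(1) \<beta>] by (simp add: rootL_def uminus_uminus o_def)
qed

lemma is_root_cases:
  assumes "is_root \<beta>"
  obtains L where "(\<beta>, L) \<in> set pos_table" | \<alpha> L where "(\<alpha>, L) \<in> set pos_table" "\<beta> = map uminus \<alpha>"
  using assms unfolding is_root_def by (metis imageE prod.collapse uminus_uminus)

definition rm :: "int list \<Rightarrow> 'k::field m27" where
  "rm \<beta> = sp (rootL \<beta>)"

lemma rm_neg: "is_root \<beta> \<Longrightarrow> rm (map uminus \<beta>) = trn (rm \<beta>)"
  by (erule is_root_cases) (simp_all add: rm_def rootL_pos rootL_neg sp_trn uminus_uminus o_def)

lemma rm_sq_pos: "(\<beta>, L) \<in> set pos_table \<Longrightarrow> rm \<beta> * rm \<beta> = (0 :: 'k::field m27) \<and> rm \<beta> * trn (rm \<beta>) * rm \<beta> = (rm \<beta> :: 'k m27)"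
proof -
  assume \<beta>: "(\<beta>, L) \<in> set pos_table"
  then have v: "valid L" "valid (sptrn L)" and 1: "spmul L L = []" and 2: "spmul L (spmul (sptrn L) L) = L"
    using table_ok by (auto simp: list_all_iff)
  show ?thesis
    using arg_cong[OF 1, of "sp :: _ \<Rightarrow> 'k m27"] arg_cong[OF 2, of "sp :: _ \<Rightarrow> 'k m27"]
    by (simp add: rm_def rootL_pos[OF \<beta>] sp_mult v sp_Nil sp_trn mult.assoc)
qed

lemma rm_sq:
  assumes "is_root \<beta>"
  shows "rm \<beta> * rm \<beta> = (0 :: 'k::field m27)" "rm \<beta> * trn (rm \<beta>) * rm \<beta> = (rm \<beta> :: 'k m27)"
proof -
  have "rm \<beta> * rm \<beta> = (0 :: 'k m27) \<and> rm \<beta> * trn (rm \<beta>) * rm \<beta> = (rm \<beta> :: 'k m27)"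
    using assms
  proof (cases rule: is_root_cases)
    case (2 \<alpha> L)
    have r: "is_root \<alpha>" using 2 by (force simp: is_root_def)
    note p = rm_sq_pos[OF 2(1), where 'k = 'k]
    have "trn (rm \<alpha> * rm \<alpha>) = (0 :: 'k m27)" using p by (simp, intro m27_eqI) simp
    moreover have "trn (rm \<alpha> * trn (rm \<alpha>) * rm \<alpha>) = (trn (rm \<alpha>) :: 'k m27)" using p by simp
    ultimately show ?thesis by (simp add: 2(2) rm_neg[OF r] mult.assoc)
  qed (rule rm_sq_pos)
  then show "rm \<beta> * rm \<beta> = (0 :: 'k m27)" "rm \<beta> * trn (rm \<beta>) * rm \<beta> = (rm \<beta> :: 'k m27)" by auto
qed

lemma chkD:
  assumes "chk i \<alpha> L0 T S" "(\<beta>, L) \<in> set S"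
  shows "(map_of T (srefl i \<beta>) = None \<and> \<beta> = \<alpha> \<and> relabel L0 L = spneg (sptrn L0)) \<or>
    (\<exists>L'. map_of T (srefl i \<beta>) = Some L' \<and> (relabel L0 L = L' \<or> relabel L0 L = spneg L'))"
  using assms by (induction S) (auto simp: Let_def split: option.splits)

lemma nmat_eq:
  assumes "i \<in> {1..6}"
  defines "\<alpha> \<equiv> simple_vec (int i)"
  shows "nmat i = (1 + rm \<alpha>) * (1 - trn (rm \<alpha>)) * (1 + rm \<alpha> :: 'k::field m27)"
    "nmat i * trn (nmat i) = (1 :: 'k m27)" "trn (nmat i) * nmat i = (1 :: 'k m27)"
proof -
  let ?L = "rootL \<alpha>" let ?A = "spadd spone ?L" let ?B = "spadd spone (spneg (sptrn ?L))" let ?n = "mv_list ?L spone"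
  have v: "valid ?A" "valid ?B" "valid ?n" "valid (sptrn ?n)" and e: "spmul ?A (spmul ?B ?A) = ?n"
      "spmul ?n (sptrn ?n) = spone" "spmul (sptrn ?n) ?n = spone"
    using refl_ok[OF assms(1)] unfolding refl_ok_def Let_def \<alpha>_def by blast+
  note arg_cong[OF e(1), of "sp :: _ \<Rightarrow> 'k m27"] arg_cong[OF e(2), of "sp :: _ \<Rightarrow> 'k m27"] arg_cong[OF e(3), of "sp :: _ \<Rightarrow> 'k m27"]
  then show "nmat i = (1 + rm \<alpha>) * (1 - trn (rm \<alpha>)) * (1 + rm \<alpha> :: 'k m27)"
    "nmat i * trn (nmat i) = (1 :: 'k m27)" "trn (nmat i) * nmat i = (1 :: 'k m27)"
    unfolding nmat_def \<alpha>_def[symmetric]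
    by (simp_all add: sp_mult v sp_add sp_neg sp_trn sp_one rm_def mult.assoc)
qed

lemma srefl_neg: "length \<beta> = 6 \<Longrightarrow> srefl i (map uminus \<beta>) = map uminus (srefl i \<beta>)"
  by (erule length_6) simp

lemma srefl_simple: "i \<in> {1..6} \<Longrightarrow> srefl (int i) (simple_vec (int i)) = map uminus (simple_vec (int i))"
proof -
  assume "i \<in> {1..6}"
  then have "i = 1 \<or> i = 2 \<or> i = 3 \<or> i = 4 \<or> i = 5 \<or> i = 6" by auto
  then show ?thesis by (elim disjE) (simp_all add: simple_vec_def)
qed

lemma simple_in_table:
  assumes "i \<in> {1..6}" shows "(simple_vec (int i), rootL (simple_vec (int i))) \<in> set pos_table"
proof -
  have "\<forall>i\<in>{1,2,3,4,5,6}. (simple_vec i, rootL (simple_vec i)) \<in> set pos_table" by code_simp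
  moreover have "int i \<in> {1,2,3,4,5,6}" using assms by auto
  ultimately show ?thesis by blast
qed

lemma conj_root_pos:
  assumes "(\<beta>, L) \<in> set pos_table" "i \<in> {1..6}"
  shows "is_root (srefl (int i) \<beta>) \<and> (nmat i * rm \<beta> * trn (nmat i) = (rm (srefl (int i) \<beta>) :: 'k::field m27)
    \<or> nmat i * rm \<beta> * trn (nmat i) = - (rm (srefl (int i) \<beta>) :: 'k m27))"
proof -
  let ?\<alpha> = "simple_vec (int i)"
  have v: "valid L" using table_ok assms(1) by (auto simp: list_all_iff)
  have c: "nmat i * rm \<beta> * trn (nmat i) = (sp (relabel (rootL ?\<alpha>) L) :: 'k m27)"
    by (simp add: rm_def rootL_pos[OF assms(1)] conj_sparse[OF v])
  have "chk (int i) ?\<alpha> (rootL ?\<alpha>) pos_table pos_table"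
    using refl_ok[OF assms(2)] unfolding refl_ok_def Let_def by blast
  from chkD[OF this assms(1)] show ?thesis
  proof (elim disjE conjE exE)
    assume \<beta>: "\<beta> = ?\<alpha>" and r: "relabel (rootL ?\<alpha>) L = spneg (sptrn (rootL ?\<alpha>))"
    have a: "is_root ?\<alpha>" using simple_in_table[OF assms(2)] by (force simp: is_root_def)
    show ?thesis
      using c a unfolding r \<beta> srefl_simple[OF assms(2)] rm_neg[OF a] is_root_neg
      by (simp add: sp_neg sp_trn rm_def)
  next
    fix L' assume m: "map_of pos_table (srefl (int i) \<beta>) = Some L'" and "relabel (rootL ?\<alpha>) L = L'"
    then show ?thesis using c map_of_SomeD[OF m] by (force simp: rm_def rootL_pos is_root_def)
  next
    fix L' assume m: "map_of pos_table (srefl (int i) \<beta>) = Some L'" and "relabel (rootL ?\<alpha>) L = spneg L'"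
    then show ?thesis using c map_of_SomeD[OF m] by (force simp: rm_def rootL_pos is_root_def sp_neg)
  qed
qed

lemma conj_root:
  assumes "is_root \<beta>" "i \<in> {1..6}"
  shows "is_root (srefl (int i) \<beta>)" "nmat i * rm \<beta> * trn (nmat i) = (rm (srefl (int i) \<beta>) :: 'k::field m27)
    \<or> nmat i * rm \<beta> * trn (nmat i) = - (rm (srefl (int i) \<beta>) :: 'k m27)"
proof -
  have "is_root (srefl (int i) \<beta>) \<and> (nmat i * rm \<beta> * trn (nmat i) = (rm (srefl (int i) \<beta>) :: 'k::field m27)
    \<or> nmat i * rm \<beta> * trn (nmat i) = - (rm (srefl (int i) \<beta>) :: 'k m27))"
    using assms(1)
  proof (cases rule: is_root_cases)
    case (1 L) then show ?thesis using conj_root_pos[OF 1 assms(2)] by blast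
  next
    case (2 \<alpha> L)
    have a: "is_root \<alpha>" using 2 by (force simp: is_root_def)
    have s: "srefl (int i) (map uminus \<alpha>) = map uminus (srefl (int i) \<alpha>)"
      by (rule srefl_neg[OF is_root_length[OF a]])
    note p = conj_root_pos[OF 2(1) assms(2), where 'k = 'k]
    have t: "nmat i * trn (rm \<alpha>) * trn (nmat i) = trn (nmat i * rm \<alpha> * trn (nmat i) :: 'k m27)"
      by (simp add: mult.assoc)
    show ?thesis
      using p unfolding 2(2) s is_root_neg rm_neg[OF a] t
      by (elim conjE disjE) (simp_all only: rm_neg trn_simps simp_thms)
  qed
  then show "is_root (srefl (int i) \<beta>)" "nmat i * rm \<beta> * trn (nmat i) = (rm (srefl (int i) \<beta>) :: 'k::field m27)
    \<or> nmat i * rm \<beta> * trn (nmat i) = - (rm (srefl (int i) \<beta>) :: 'k m27)" by auto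
qed

lemma roots_is_root: "\<beta> \<in> roots \<Longrightarrow> is_root \<beta>"
proof (induction rule: roots.induct)
  case (simple i)
  then show ?case
    using simple_in_table[OF simple] by (force simp: is_root_def simple_root_vec)
next
  case (refl \<beta> i)
  then show ?case
    using conj_root(1)[OF refl(3,2)] root_refl_simple[OF refl(2) is_root_length[OF refl(3)]] by simp
qed

section \<open>The group and its root elements\<close>

definition re :: "int list \<Rightarrow> 'k::field \<Rightarrow> 'k m27" where
  "re \<beta> t = 1 + scl t (rm \<beta>)"

lemma re_0 [simp]: "re \<beta> 0 = 1"
  by (simp add: re_def)

lemma re_add: "is_root \<beta> \<Longrightarrow> re \<beta> t * re \<beta> u = re \<beta> (t + u)"
  by (simp add: re_def distrib_left distrib_right rm_sq scl_distrib)

lemma re_inverse: "is_root \<beta> \<Longrightarrow> re \<beta> t * re \<beta> (- t) = 1" "is_root \<beta> \<Longrightarrow> re \<beta> (- t) * re \<beta> t = 1"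
  by (simp_all add: re_add)

lemma is_root_simple: "i \<in> {1..6} \<Longrightarrow> is_root (simple_vec (int i))"
  using simple_in_table by (force simp: is_root_def)

lemma x_simple_re: "i \<in> {1..6} \<Longrightarrow> x_simple i t = mat_of (re (simple_vec (int i)) t)"
  by (simp add: x_simple_def re_def raising_mat_sparse rm_def plus_m27.rep_eq one_m27.rep_eq scl.rep_eq)

lemma x_neg_simple_re: "i \<in> {1..6} \<Longrightarrow> x_neg_simple i t = mat_of (re (map uminus (simple_vec (int i))) t)"
  unfolding re_def rm_neg[OF is_root_simple]
  by (simp add: x_neg_simple_def raising_mat_sparse rm_def plus_m27.rep_eq one_m27.rep_eq scl.rep_eq trn.rep_eq)

lemma GL27_group: "group (GL27 :: 'k::field mat monoid)"
  unfolding GL27_def by (intro monoid.units_group ring.is_monoid ring_mat)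

lemma GL27_simps: "x \<otimes>\<^bsub>GL27\<^esub> y = x * y" "\<one>\<^bsub>GL27\<^esub> = 1\<^sub>m 27"
  by (simp_all add: GL27_def units_of_def ring_mat_def)

lemma E6_simps: "x \<otimes>\<^bsub>E6\<^esub> y = x * y" "\<one>\<^bsub>E6\<^esub> = 1\<^sub>m 27"
  by (simp_all add: E6_def GL27_simps)

lemma GL27_I: "A * B = 1 \<Longrightarrow> B * A = 1 \<Longrightarrow> mat_of A \<in> carrier GL27"
  unfolding GL27_def units_of_def Units_def
  by (auto simp: ring_mat_def one_m27.rep_eq[symmetric] times_m27.rep_eq[symmetric] intro!: bexI[of _ "mat_of B"])

lemma E6_generators:
  "(\<Union>i\<in>{1..6}. range (x_simple i) \<union> range (x_neg_simple i)) \<subseteq> carrier (GL27 :: 'k::field mat monoid)"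
proof -
  have "mat_of (re (simple_vec (int i)) t) \<in> carrier GL27"
    "mat_of (re (map uminus (simple_vec (int i))) t) \<in> carrier GL27" if "i \<in> {1..6}" for i and t :: 'k
    using is_root_simple[OF that] by (auto intro!: GL27_I[OF re_inverse] simp: is_root_neg)
  then show ?thesis by (auto simp: x_simple_re x_neg_simple_re)
qed

lemma E6_subgroup: "subgroup (carrier E6) (GL27 :: 'k::field mat monoid)"
  using group.generate_is_subgroup[OF GL27_group E6_generators] by (simp add: E6_def)

lemma E6_group: "group (E6 :: 'k::field mat monoid)"
  using subgroup.subgroup_is_group[OF E6_subgroup GL27_group] by (simp add: E6_def)

interpretation E6: group "E6 :: 'k::field mat monoid" by (rule E6_group)

lemma E6_carrier: "g \<in> carrier E6 \<Longrightarrow> g \<in> carrier_mat 27 27"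
  using subgroup.subset[OF E6_subgroup] by (auto simp: GL27_def units_of_def Units_def ring_mat_def)

definition EE :: "'k::field m27 set" where
  "EE = {A. mat_of A \<in> carrier E6}"

lemma E6_mat_of: "g \<in> carrier E6 \<Longrightarrow> \<exists>A\<in>EE. g = mat_of A"
  using E6_carrier[of g] by (intro bexI[of _ "of_mat g"]) (auto simp: EE_def of_mat_inverse)

lemma EE_one: "1 \<in> EE" using E6.one_closed by (simp add: EE_def one_m27.rep_eq E6_simps)

lemma EE_mult: "A \<in> EE \<Longrightarrow> B \<in> EE \<Longrightarrow> A * B \<in> EE"
  using E6.m_closed[of "mat_of A" "mat_of B"] by (simp add: EE_def times_m27.rep_eq E6_simps)

text \<open>The inverse in the group; it is the matrix inverse for every element of the group.\<close>
definition minv :: "'k::field m27 \<Rightarrow> 'k m27" where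
  "minv A = of_mat (inv\<^bsub>E6\<^esub> (mat_of A))"

lemma minv:
  assumes "A \<in> EE"
  shows "mat_of (minv A) = inv\<^bsub>E6\<^esub> (mat_of A)" "minv A \<in> EE" "A * minv A = 1" "minv A * A = 1"
proof -
  have A: "mat_of A \<in> carrier E6" using assms by (simp add: EE_def)
  show 1: "mat_of (minv A) = inv\<^bsub>E6\<^esub> (mat_of A)"
    using E6_carrier[OF E6.inv_closed[OF A]] by (simp add: minv_def of_mat_inverse)
  then show "minv A \<in> EE" using E6.inv_closed[OF A] by (simp add: EE_def)
  have "mat_of (A * minv A) = mat_of 1"
    using E6.r_inv[OF A] 1 by (simp add: times_m27.rep_eq one_m27.rep_eq E6_simps)
  then show "A * minv A = 1" by (simp add: mat_of_inject)
  have "mat_of (minv A * A) = mat_of 1"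
    using E6.l_inv[OF A] 1 by (simp add: times_m27.rep_eq one_m27.rep_eq E6_simps)
  then show "minv A * A = 1" by (simp add: mat_of_inject)
qed

lemma minv_eqI: "A \<in> EE \<Longrightarrow> A * B = 1 \<Longrightarrow> minv A = B"
  by (metis minv(4) mult.assoc mult.left_neutral mult.right_neutral)

lemma conj_E6_m27:
  assumes "A \<in> EE" shows "conj_E6 (mat_of A) (mat_of B) = mat_of (A * B * minv A)"
  by (simp add: conj_E6_def times_m27.rep_eq minv(1)[OF assms])

lemma EE_simple:
  assumes "i \<in> {1..6}"
  shows "re (simple_vec (int i)) t \<in> EE" "re (map uminus (simple_vec (int i))) t \<in> EE"
proof -
  have "x_simple i t \<in> carrier E6" "x_neg_simple i t \<in> carrier E6"
    using assms by (auto simp: E6_def intro!: generate.incl)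
  then show "re (simple_vec (int i)) t \<in> EE" "re (map uminus (simple_vec (int i))) t \<in> EE"
    unfolding EE_def mem_Collect_eq x_simple_re[OF assms, symmetric] x_neg_simple_re[OF assms, symmetric] .
qed

lemma nmat_re:
  assumes "i \<in> {1..6}"
  shows "nmat i = re (simple_vec (int i)) 1 * re (map uminus (simple_vec (int i))) (- 1) * re (simple_vec (int i)) 1"
  unfolding nmat_eq(1)[OF assms] re_def rm_neg[OF is_root_simple[OF assms]] by simp

lemma nmat_EE: "i \<in> {1..6} \<Longrightarrow> nmat i \<in> EE"
  unfolding nmat_re by (intro EE_mult EE_simple)

lemma minv_nmat: "i \<in> {1..6} \<Longrightarrow> minv (nmat i) = trn (nmat i)"
  by (rule minv_eqI[OF nmat_EE nmat_eq(2)])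

lemma conj_re:
  assumes "is_root \<beta>" "i \<in> {1..6}"
  obtains \<epsilon> where "\<epsilon> \<in> {1, - 1 :: 'k::field}"
    "\<And>t. nmat i * re \<beta> t * trn (nmat i) = re (srefl (int i) \<beta>) (\<epsilon> * t)"
proof -
  have "nmat i * re \<beta> t * trn (nmat i) = 1 + scl t (nmat i * rm \<beta> * trn (nmat i))" for t :: 'k
    by (simp add: re_def distrib_left distrib_right nmat_eq(2)[OF assms(2)])
  then show ?thesis using conj_root(2)[OF assms, where 'k = 'k] that[of 1] that[of "- 1"]
    by (auto simp: re_def)
qed

lemma roots_EE: "\<beta> \<in> roots \<Longrightarrow> re \<beta> (t :: 'k::field) \<in> EE"
proof (induction arbitrary: t rule: roots.induct)
  case (simple i) then show ?case using EE_simple(1) by (simp add: simple_root_vec)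
next
  case (refl \<beta> i)
  have r: "is_root \<beta>" using roots_is_root[OF refl(1)] .
  obtain \<epsilon> where e: "\<epsilon> \<in> {1, - 1 :: 'k}"
      "\<And>t. nmat i * re \<beta> t * trn (nmat i) = re (srefl (int i) \<beta>) (\<epsilon> * t)"
    using conj_re[OF r refl(2)] by blast
  have "nmat i * re \<beta> (\<epsilon> * t) * trn (nmat i) \<in> EE"
    by (intro EE_mult refl(3) nmat_EE refl(2) minv(2)[OF nmat_EE[OF refl(2)], unfolded minv_nmat[OF refl(2)]])
  also have "nmat i * re \<beta> (\<epsilon> * t) * trn (nmat i) = re (root_refl (simple_root i) \<beta>) t"
    using e root_refl_simple[OF refl(2) is_root_length[OF r]] by auto
  finally show ?case .
qed

lemma srefl_invol: "length \<beta> = 6 \<Longrightarrow> srefl i (srefl i \<beta>) = \<beta>"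
  by (erule length_6) simp

text \<open>In the order of the table every root is simple or a simple reflection of an earlier root.\<close>
fun reached :: "int list list \<Rightarrow> int list list \<Rightarrow> bool" where
  "reached S [] = True"
| "reached S (\<beta> # T) = (list_ex (\<lambda>i. \<beta> = simple_vec i \<or> (length \<beta> = 6 \<and> srefl i \<beta> \<in> set S)) [1,2,3,4,5,6] \<and> reached (\<beta> # S) T)"

lemma pos_table_roots: "(\<beta>, L) \<in> set pos_table \<Longrightarrow> \<beta> \<in> roots"
proof -
  have "set T \<subseteq> roots" if "reached S T" "set S \<subseteq> roots" for S T
    using that
  proof (induction S T rule: reached.induct)
    case (2 S \<beta> T)
    then obtain j where j: "j \<in> {1,2,3,4,5,6}" "\<beta> = simple_vec j \<or> (length \<beta> = 6 \<and> srefl j \<beta> \<in> set S)"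
      by (auto simp: list_ex_iff)
    then obtain i :: nat where i: "i \<in> {1..6}" "j = int i" by (intro that[of "nat j"]) auto
    have "\<beta> \<in> roots"
    proof (cases "\<beta> = simple_vec j")
      case True then show ?thesis using roots.simple[OF i(1)] by (simp add: i simple_root_vec[OF i(1)])
    next
      case False
      then have "srefl (int i) \<beta> \<in> roots" "length \<beta> = 6" using j(2) i(2) 2(3) by auto
      then show ?thesis
        using roots.refl[OF \<open>srefl (int i) \<beta> \<in> roots\<close> i(1)]
          root_refl_simple[OF i(1) is_root_length[OF roots_is_root[OF \<open>srefl (int i) \<beta> \<in> roots\<close>]]]
        by (simp add: srefl_invol)
    qed
    then show ?case using 2 by auto
  qed simp
  moreover have "reached [] (map fst pos_table)" by code_simp
  ultimately show "(\<beta>, L) \<in> set pos_table \<Longrightarrow> \<beta> \<in> roots" by force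
qed

lemma roots_neg: "\<beta> \<in> roots \<Longrightarrow> map uminus \<beta> \<in> roots"
proof (induction rule: roots.induct)
  case (simple i)
  have "root_refl (simple_root i) (simple_root i) \<in> roots" using simple by (intro roots.refl roots.simple)
  then show ?case
    using root_refl_simple[OF simple] is_root_length[OF is_root_simple[OF simple]]
    by (simp add: simple_root_vec[OF simple] srefl_simple[OF simple])
next
  case (refl \<beta> i)
  then show ?case
    using roots.refl[OF refl(3,2)] root_refl_simple[OF refl(2)] is_root_length[OF roots_is_root[OF refl(1)]]
    by (simp add: srefl_neg)
qed

lemma roots_eq: "roots = {\<beta>. is_root \<beta>}"
proof -
  have "\<beta> \<in> roots" if "is_root \<beta>" for \<beta>
    using that by (cases rule: is_root_cases) (auto intro: roots_neg pos_table_roots)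
  then show ?thesis using roots_is_root by blast
qed

text \<open>The invariant quadratic form, with value 2 at all roots.\<close>
fun sqnorm :: "int list \<Rightarrow> int" where
  "sqnorm [a, b, c, d, e, f] = a * (2 * a - c) + b * (2 * b - d) + c * (2 * c - a - d) +
     d * (2 * d - b - c - e) + e * (2 * e - d - f) + f * (2 * f - e)"
| "sqnorm _ = 0"

lemma table_nonzero:
  "list_all (\<lambda>(\<beta>, L). sqnorm \<beta> = 2 \<and> (case L of [] \<Rightarrow> False | (r, s, k) # L' \<Rightarrow> 0 \<le> r \<and> r < 27 \<and> 0 \<le> s \<and> s < 27 \<and> spentI L r s \<noteq> 0)) pos_table"
  by code_simp

lemma rm_nonzero: "is_root \<beta> \<Longrightarrow> rm \<beta> \<noteq> (0 :: 'k::field_char_0 m27)"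
proof -
  have pos: "rm \<beta> \<noteq> (0 :: 'k m27)" if \<beta>: "(\<beta>, L) \<in> set pos_table" for \<beta> L
  proof -
    obtain r s where rs: "0 \<le> r" "r < 27" "0 \<le> s" "s < 27" "spentI L r s \<noteq> 0"
      using bspec[OF table_nonzero[unfolded list_all_iff] \<beta>] by (auto split: list.splits)
    then have "ent (rm \<beta> :: 'k m27) (nat r) (nat s) = of_int (spentI L r s)"
      by (simp add: rm_def rootL_pos[OF \<beta>] spent_spentI)
    then show ?thesis using rs by force
  qed
  assume "is_root \<beta>"
  then show ?thesis
  proof (cases rule: is_root_cases)
    case (2 \<alpha> L)
    then have "is_root \<alpha>" by (force simp: is_root_def)
    then have "rm \<alpha> = trn (rm \<beta> :: 'k m27)" unfolding 2(2) by (simp add: rm_neg)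
    moreover have "trn 0 = (0 :: 'k m27)" by (rule m27_eqI) simp
    ultimately show ?thesis using pos[OF 2(1)] by metis
  qed (rule pos)
qed

lemma root_refl_self: "is_root \<beta> \<Longrightarrow> root_refl \<beta> \<beta> = map uminus \<beta>"
proof -
  assume r: "is_root \<beta>"
  obtain a b c d e f where \<beta>: "\<beta> = [a, b, c, d, e, f]" using length_6[OF is_root_length[OF r]] .
  have n: "sqnorm \<alpha> = 2" if "(\<alpha>, L) \<in> set pos_table" for \<alpha> L
    using table_nonzero that by (auto simp: list_all_iff)
  have "sqnorm \<beta> = 2"
    using r
  proof (cases rule: is_root_cases)
    case (2 \<alpha> L)
    obtain a b c d e f where "\<alpha> = [a, b, c, d, e, f]" using length_6[OF pos_length[OF 2(1)]] .
    then show ?thesis using n[OF 2(1)] 2(2) by (simp add: algebra_simps)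
  qed (rule n)
  then have "root_pairing \<beta> \<beta> = 2" unfolding \<beta> root_pairing_explicit by simp
  then show ?thesis by (simp add: root_refl_def \<beta>)
qed

lemma scl_eq_0: "scl t A = 0 \<Longrightarrow> t \<noteq> 0 \<Longrightarrow> A = 0"
proof -
  assume A: "scl t A = 0" and t: "t \<noteq> 0"
  from arg_cong[OF A, of "scl (inverse t)"] have "scl (inverse t * t) A = 0" by simp
  then show "A = 0" using t by simp
qed

lemma re_inject: "is_root \<beta> \<Longrightarrow> re \<beta> t = re \<beta> (u :: 'k::field_char_0) \<longleftrightarrow> t = u"
proof
  assume r: "is_root \<beta>" and "re \<beta> t = re \<beta> u"
  then have "scl (t - u) (rm \<beta>) = 0" by (simp add: re_def scl_distrib)
  then show "t = u" using rm_nonzero[OF r, where 'k = 'k] scl_eq_0[of "t - u" "rm \<beta>"] by auto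
qed simp

section \<open>Chevalley systems\<close>

locale chevalley =
  fixes x :: "int list \<Rightarrow> 'k::field_char_0 \<Rightarrow> 'k mat"
  assumes chevalley: "chevalley_system x"
begin

lemma x_simple_roots: "i \<in> {1..6} \<Longrightarrow> x (simple_vec (int i)) t = mat_of (re (simple_vec (int i)) t)"
    "i \<in> {1..6} \<Longrightarrow> x (map uminus (simple_vec (int i))) t = mat_of (re (map uminus (simple_vec (int i))) t)"
  using chevalley by (auto simp: chevalley_system_def simple_root_vec neg_root_def x_simple_re x_neg_simple_re)

lemma weyl_rep_simple: "i \<in> {1..6} \<Longrightarrow> weyl_rep x (simple_root i) = mat_of (nmat i)"
  by (simp add: weyl_rep_def simple_root_vec neg_root_def x_simple_roots nmat_re times_m27.rep_eq)

lemma x_conj: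
  assumes "\<alpha> \<in> roots" "\<beta> \<in> roots"
  obtains \<epsilon> where "\<epsilon> \<in> {1, - 1}" "\<And>t. conj_E6 (weyl_rep x \<alpha>) (x \<beta> t) = x (root_refl \<alpha> \<beta>) (\<epsilon> * t)"
  using chevalley assms unfolding chevalley_system_def by blast

text \<open>
  Simple reflections generate all roots from the simple ones, and they act on the root elements of a
  Chevalley system and on those of the table in the same way up to sign.
\<close>
lemma x_re: "\<beta> \<in> roots \<Longrightarrow> \<exists>\<epsilon>\<in>{1, - 1}. \<forall>t. x \<beta> t = mat_of (re \<beta> (\<epsilon> * t))"
proof (induction rule: roots.induct)
  case (simple i) then show ?case by (intro bexI[of _ 1]) (simp_all add: simple_root_vec x_simple_roots)
next
  case (refl \<beta> i)
  have r: "is_root \<beta>" using roots_is_root[OF refl(1)] .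
  from refl(3) obtain \<epsilon> where e: "\<epsilon> \<in> {1, - 1}" "\<And>t. x \<beta> t = mat_of (re \<beta> (\<epsilon> * t))" by blast
  obtain \<epsilon>' where e': "\<epsilon>' \<in> {1, - 1 :: 'k}"
      "\<And>t. nmat i * re \<beta> t * trn (nmat i) = re (srefl (int i) \<beta>) (\<epsilon>' * t)"
    using conj_re[OF r refl(2)] by blast
  obtain \<eta> where h: "\<eta> \<in> {1, - 1}"
      "\<And>t. conj_E6 (weyl_rep x (simple_root i)) (x \<beta> t) = x (root_refl (simple_root i) \<beta>) (\<eta> * t)"
    using x_conj[OF roots.simple[OF refl(2)] refl(1)] by blast
  have "x (root_refl (simple_root i) \<beta>) (\<eta> * t) = mat_of (re (root_refl (simple_root i) \<beta>) (\<epsilon>' * \<epsilon> * t))" for t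
  proof -
    have "x (root_refl (simple_root i) \<beta>) (\<eta> * t) = conj_E6 (weyl_rep x (simple_root i)) (x \<beta> t)"
      by (rule h(2)[symmetric])
    also have "\<dots> = mat_of (re (srefl (int i) \<beta>) (\<epsilon>' * (\<epsilon> * t)))"
      unfolding weyl_rep_simple[OF refl(2)] e(2) conj_E6_m27[OF nmat_EE[OF refl(2)]] minv_nmat[OF refl(2)] e'(2) ..
    finally show ?thesis by (simp only: root_refl_simple[OF refl(2) is_root_length[OF r]] mult.assoc)
  qed
  from this[of "\<eta> * _"] have "x (root_refl (simple_root i) \<beta>) t = mat_of (re (root_refl (simple_root i) \<beta>) ((\<epsilon>' * \<epsilon> * \<eta>) * t))" for t
    using h(1) by (auto simp: mult.assoc)
  then show ?case using e(1) e'(1) h(1) by (intro bexI[of _ "\<epsilon>' * \<epsilon> * \<eta>"]) auto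
qed

text \<open>The sign by which the Chevalley system differs at \<open>\<beta>\<close> from the table.\<close>
definition sg :: "int list \<Rightarrow> 'k" where
  "sg \<beta> = (SOME \<epsilon>. \<epsilon> \<in> {1, - 1} \<and> (\<forall>t. x \<beta> t = mat_of (re \<beta> (\<epsilon> * t))))"

lemma sg: assumes "\<beta> \<in> roots" shows "sg \<beta> \<in> {1, - 1}" "x \<beta> t = mat_of (re \<beta> (sg \<beta> * t))" "sg \<beta> * sg \<beta> = 1"
proof -
  have "sg \<beta> \<in> {1, - 1} \<and> (\<forall>t. x \<beta> t = mat_of (re \<beta> (sg \<beta> * t)))"
    unfolding sg_def by (rule someI_ex) (use x_re[OF assms] in blast)
  then show "sg \<beta> \<in> {1, - 1}" "x \<beta> t = mat_of (re \<beta> (sg \<beta> * t))" "sg \<beta> * sg \<beta> = 1" by auto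
qed

lemma re_x: "\<beta> \<in> roots \<Longrightarrow> mat_of (re \<beta> t) = x \<beta> (sg \<beta> * t)"
  using sg(2)[of \<beta> "sg \<beta> * t"] sg(3)[of \<beta>] by (simp add: mult.assoc[symmetric])

lemma sg_simple: "i \<in> {1..6} \<Longrightarrow> sg (simple_vec (int i)) = 1"
proof -
  assume i: "i \<in> {1..6}"
  have "simple_vec (int i) \<in> roots" using roots.simple[OF i] by (simp add: simple_root_vec[OF i])
  then have "mat_of (re (simple_vec (int i)) (sg (simple_vec (int i)))) = mat_of (re (simple_vec (int i)) 1)"
    using sg(2)[of "simple_vec (int i)" 1] x_simple_roots(1)[OF i, of 1] by simp
  then show ?thesis by (simp add: mat_of_inject re_inject[OF is_root_simple[OF i]])
qed

text \<open>
  If the signs at \<open>\<beta>\<close> and \<open>- \<beta>\<close> were different, the product of root elements in the definition of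
  \<open>weyl_rep\<close> would not represent the reflection: on a two-dimensional piece it would be a matrix
  with entries 2 and 3.
\<close>
lemma sg_neg: assumes "\<beta> \<in> roots" shows "sg (map uminus \<beta>) = sg \<beta>"
proof -
  let ?a = "sg \<beta>" and ?b = "sg (map uminus \<beta>)"
  let ?A = "rm \<beta> :: 'k m27" let ?B = "trn ?A"
  have r: "is_root \<beta>" using roots_is_root[OF assms] .
  note nroot = roots_neg[OF assms]
  define w where "w = (1 + scl ?a ?A) * (1 - scl ?b ?B) * (1 + scl ?a ?A)"
  have w: "weyl_rep x \<beta> = mat_of w"
    unfolding weyl_rep_def neg_root_def sg(2)[OF assms] sg(2)[OF nroot] re_def rm_neg[OF r] w_def
    by (simp add: times_m27.rep_eq)
  have wE: "w \<in> EE"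
    using EE_mult[OF EE_mult[OF roots_EE[OF assms, of ?a] roots_EE[OF nroot, of "- ?b"]] roots_EE[OF assms, of ?a]]
    by (simp add: re_def rm_neg[OF r] w_def)
  obtain \<epsilon> where "conj_E6 (weyl_rep x \<beta>) (x \<beta> 1) = x (root_refl \<beta> \<beta>) (\<epsilon> * 1)"
    using x_conj[OF assms assms] by blast
  then have "w * re \<beta> ?a * minv w = re (map uminus \<beta>) (?b * \<epsilon>)"
    by (simp add: w sg(2)[OF assms] conj_E6_m27[OF wE] root_refl_self[OF r] sg(2)[OF nroot] mat_of_inject)
  from arg_cong[OF this, of "\<lambda>Z. Z * w"] have "w * re \<beta> ?a = re (map uminus \<beta>) (?b * \<epsilon>) * w"
    by (simp add: mult.assoc minv(4)[OF wE])
  then have e: "scl ?a (w * ?A) = scl (?b * \<epsilon>) (?B * w)"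
    by (simp add: re_def rm_neg[OF r] distrib_left distrib_right)
  have BB: "?B * ?B = 0" using rm_sq(1)[OF is_root_neg[THEN iffD2, OF r], where 'k = 'k] by (simp add: rm_neg[OF r])
  have BB': "?B * (?B * Z) = 0" for Z by (simp add: mult.assoc[symmetric] BB)
  have "?B * w * ?A = scl (1 - ?a * ?b) (?B * ?A)"
  proof -
    have 1: "?A * ?A = 0" "?A * (?B * ?A) = ?A" "\<And>Z. ?A * (?A * Z) = 0"
      using rm_sq[OF r, where 'k = 'k] by (simp_all add: mult.assoc) (simp add: mult.assoc[symmetric])
    have "w * ?A = scl (1 - ?a * ?b) ?A - scl ?b (?B * ?A)"
      unfolding w_def by (simp add: distrib_left distrib_right left_diff_distrib right_diff_distrib mult.assoc 1 scl_distrib mult.commute)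
    then show ?thesis by (simp add: mult.assoc right_diff_distrib BB')
  qed
  moreover have "scl ?a (?B * w * ?A) = 0"
    using arg_cong[OF e, of "\<lambda>Z. ?B * Z"] by (simp add: mult.assoc BB')
  ultimately have "scl (?a * (1 - ?a * ?b)) (?B * ?A) = 0" by simp
  from arg_cong[OF this, of "\<lambda>Z. ?A * Z"] have "scl (?a * (1 - ?a * ?b)) (?A * ?B * ?A) = 0"
    by (simp add: mult.assoc)
  then have s: "scl (?a * (1 - ?a * ?b)) ?A = 0" by (simp add: rm_sq[OF r])
  have "?a * (1 - ?a * ?b) = 0"
  proof (rule ccontr)
    assume n: "?a * (1 - ?a * ?b) \<noteq> 0"
    have "?A = 0" by (rule scl_eq_0[OF s n])
    then show False using rm_nonzero[OF r, where 'k = 'k] by simp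
  qed
  then show ?thesis using sg(1)[OF assms] sg(1)[OF nroot] by auto
qed

end

section \<open>Weights, the torus and the grading\<close>

text \<open>The coordinates of a root with respect to the fundamental weights.\<close>
fun cvec :: "int list \<Rightarrow> int list" where
  "cvec [a, b, c, d, e, f] = [2 * a - c, 2 * b - d, 2 * c - a - d, 2 * d - b - c - e, 2 * e - d - f, 2 * f - e]"
| "cvec _ = []"

fun shift_ok :: "int list \<Rightarrow> sparse \<Rightarrow> (int \<times> int list) list \<Rightarrow> bool" where
  "shift_ok c [] Z = True"
| "shift_ok c ((r, s, k) # L) Z = ((case map_of Z r of None \<Rightarrow> False | Some v \<Rightarrow>
      case map_of Z s of None \<Rightarrow> False | Some w \<Rightarrow> v = map2 (+) w c) \<and> shift_ok c L Z)"

lemma table_shift: "(let Z = index_weights in list_all (\<lambda>(\<beta>, L). shift_ok (cvec \<beta>) L Z) pos_table)"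
  by code_simp

lemma index_weights_map_of: "r < 27 \<Longrightarrow> map_of index_weights (int r) = Some (weights ! r)"
proof -
  have "map (fst \<circ> snd) spone = map int [0..<27]"
    by (simp add: spone_def upt_conv_Cons)
  then have "distinct (map fst index_weights)"
    by (simp add: index_weights_def weights_def distinct_map)
  then show "r < 27 \<Longrightarrow> map_of index_weights (int r) = Some (weights ! r)"
    using index_weights_nth map_of_is_SomeI by metis
qed

lemma weights_length: "length weights = 27" "r < 27 \<Longrightarrow> length (weights ! r) = 6"
proof -
  show 1: "length weights = 27" by (simp add: weights_def)
  have "list_all (\<lambda>w. length w = 6) weights" by code_simp
  then show "r < 27 \<Longrightarrow> length (weights ! r) = 6"
    unfolding list_all_length 1 by blast
qed

lemma spent_shift:
  assumes "shift_ok c L index_weights" "spent L r s \<noteq> 0" "r < 27" "s < 27"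
  shows "weights ! r = map2 (+) (weights ! s) c"
  using assms(1,2)
proof (induction L)
  case (Cons e L)
  obtain r' s' k where e: "e = (r', s', k)" by (cases e)
  show ?case
    using Cons index_weights_map_of[OF assms(3)] index_weights_map_of[OF assms(4)]
    by (auto simp: e spent_simps split: if_splits option.splits)
qed (simp add: spent_simps)

text \<open>The pairing of a combination of simple coroots with a weight.\<close>
fun prw :: "int list \<Rightarrow> int list \<Rightarrow> int" where
  "prw [a, b, c, d, e, f] [a', b', c', d', e', f'] = a * a' + b * b' + c * c' + d * d' + e * e' + f * f'"
| "prw _ _ = 0"

lemma prw_shift: "length l = 6 \<Longrightarrow> length v = 6 \<Longrightarrow> length c = 6 \<Longrightarrow> prw l (map2 (+) v c) = prw l v + prw l c"
  by (erule length_6, erule length_6, erule length_6) (simp add: algebra_simps)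

lemma prw_cvec: "length l = 6 \<Longrightarrow> length \<beta> = 6 \<Longrightarrow> prw l (cvec \<beta>) = root_pairing \<beta> l"
  by (erule length_6, erule length_6) (simp add: root_pairing_explicit algebra_simps)

lemma length_cvec: "length \<beta> = 6 \<Longrightarrow> length (cvec \<beta>) = 6"
  by (erule length_6) simp

lemma cvec_neg: "length \<beta> = 6 \<Longrightarrow> cvec (map uminus \<beta>) = map uminus (cvec \<beta>)"
  by (erule length_6) simp

lemma map2_neg: "length v = 6 \<Longrightarrow> length w = 6 \<Longrightarrow> length c = 6 \<Longrightarrow> v = map2 (+) w c \<Longrightarrow> w = map2 (+) v (map uminus (c :: int list))"
  by (erule length_6, erule length_6, erule length_6) simp

lemma rm_shift:
  assumes "is_root \<beta>" "ent (rm \<beta> :: 'k::field m27) r s \<noteq> 0" "r < 27" "s < 27"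
  shows "weights ! r = map2 (+) (weights ! s) (cvec \<beta>)"
proof -
  have pos: "weights ! r = map2 (+) (weights ! s) (cvec \<beta>)"
    if "(\<beta>, L) \<in> set pos_table" "ent (rm \<beta> :: 'k m27) r s \<noteq> 0" "r < 27" "s < 27" for \<beta> L r s
  proof (rule spent_shift)
    show "shift_ok (cvec \<beta>) L index_weights"
      using table_shift that(1) by (auto simp: list_all_iff Let_def)
    show "spent L r s \<noteq> 0" using that by (auto simp: rm_def rootL_pos)
  qed (use that in auto)
  show ?thesis
    using assms(1)
  proof (cases rule: is_root_cases)
    case (1 L) then show ?thesis using pos assms by blast
  next
    case (2 \<alpha> L)
    have a: "is_root \<alpha>" using 2 by (force simp: is_root_def)
    have "ent (rm \<alpha> :: 'k m27) s r \<noteq> 0" using assms 2(2) by (simp add: rm_neg[OF a])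
    then have "weights ! s = map2 (+) (weights ! r) (cvec \<alpha>)" using pos[OF 2(1)] assms by blast
    then show ?thesis
      unfolding 2(2) cvec_neg[OF is_root_length[OF a]]
      by (intro map2_neg weights_length assms length_cvec is_root_length[OF a])
  qed
qed

definition dg :: "(nat \<Rightarrow> 'k::field) \<Rightarrow> 'k m27" where
  "dg f = of_mat (mat 27 27 (\<lambda>(r, s). if r = s then f r else 0))"

lemma mat_of_dg: "mat_of (dg f) = mat 27 27 (\<lambda>(r, s). if r = s then f r else 0)"
  by (simp add: dg_def of_mat_inverse)

lemma ent_dg [simp]: "i < 27 \<Longrightarrow> j < 27 \<Longrightarrow> ent (dg f) i j = (if i = j then f i else 0)"
  by (simp add: ent.rep_eq mat_of_dg)

lemma ent_dg_mult [simp]: "i < 27 \<Longrightarrow> j < 27 \<Longrightarrow> ent (dg f * A) i j = f i * ent A i j"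
  by (simp add: ent_mult if_distrib[of "\<lambda>z. z * _"] cong: if_cong)

lemma ent_mult_dg [simp]: "i < 27 \<Longrightarrow> j < 27 \<Longrightarrow> ent (A * dg f) i j = ent A i j * f j"
  by (simp add: ent_mult if_distrib[of "\<lambda>z. _ * z"] cong: if_cong)

lemma dg_mult: "dg f * dg g = dg (\<lambda>r. f r * g r)"
  by (rule m27_eqI) simp

text \<open>
  The value at \<open>t\<close> of the cocharacter that is the combination \<open>l\<close> of the simple coroots.
\<close>
definition tor :: "int list \<Rightarrow> 'k::field \<Rightarrow> 'k m27" where
  "tor l t = dg (\<lambda>r. t powi prw l (weights ! r))"

lemma tor_mult: "tor l t * tor l u = tor l (t * u)"
  by (simp add: tor_def dg_mult power_int_mult_distrib)

lemma tor_1 [simp]: "tor l 1 = 1"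
  by (rule m27_eqI) (simp add: tor_def)

lemma tor_re:
  assumes "is_root \<beta>" "length l = 6" "t \<noteq> 0"
  shows "re \<beta> u * tor l t = tor l t * re \<beta> (u * t powi (- root_pairing \<beta> l))"
proof -
  have "rm \<beta> * tor l t = tor l t * scl (t powi (- root_pairing \<beta> l)) (rm \<beta>)"
  proof (rule m27_eqI)
    fix r s :: nat assume rs: "r < 27" "s < 27"
    show "ent (rm \<beta> * tor l t) r s = ent (tor l t * scl (t powi (- root_pairing \<beta> l)) (rm \<beta>)) r s"
    proof (cases "ent (rm \<beta> :: 'a m27) r s = 0")
      case True then show ?thesis using rs by (simp add: tor_def)
    next
      case False
      have "prw l (weights ! r) = prw l (weights ! s) + root_pairing \<beta> l"
        unfolding rm_shift[OF assms(1) False rs]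
        by (simp add: prw_shift weights_length rs length_cvec is_root_length[OF assms(1)] prw_cvec assms(2))
      then show ?thesis using rs assms(3) by (simp add: tor_def power_int_add power_int_minus)
    qed
  qed
  then show ?thesis by (simp add: re_def distrib_left distrib_right mult.commute)
qed

text \<open>
  The value at \<open>t\<close> of the coroot of \<open>\<beta>\<close>, written with the root vectors of \<open>\<beta>\<close> and \<open>- \<beta>\<close>: their products
  project onto the weight spaces where the coroot has value 1 and -1.
\<close>
definition sl2_tor :: "int list \<Rightarrow> 'k::field \<Rightarrow> 'k m27" where
  "sl2_tor \<beta> t = 1 + scl (t - 1) (rm \<beta> * trn (rm \<beta>)) + scl (inverse t - 1) (trn (rm \<beta>) * rm \<beta>)"

text \<open>
  The projection onto the weight spaces where the coroot of \<open>\<beta>\<close> has value \<open>k\<close>.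
\<close>
fun eigen_list :: "int list \<Rightarrow> int \<Rightarrow> (int \<times> int list) list \<Rightarrow> sparse" where
  "eigen_list \<beta> k [] = []"
| "eigen_list \<beta> k ((r, v) # Z) = (if prw \<beta> v = k then (r, r, 1) # eigen_list \<beta> k Z else eigen_list \<beta> k Z)"

definition diag_ok :: "int list \<Rightarrow> bool" where
  "diag_ok \<beta> = (let L = rootL \<beta>; Z = index_weights in
     spmul L (sptrn L) = eigen_list \<beta> 1 Z \<and> spmul (sptrn L) L = eigen_list \<beta> (- 1) Z \<and>
     list_all (\<lambda>(r, v). (let p = prw \<beta> v in p = 1 \<or> p = 0 \<or> p = - 1)) Z)"

lemma index_weights_map: "index_weights = map (\<lambda>r. (int r, weights ! r)) [0..<27]"
proof -
  have 1: "map (fst \<circ> snd) spone = map int [0..<27]"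
    by (simp add: spone_def upt_conv_Cons)
  have "length weights = 27" by (simp add: weights_def)
  then show ?thesis
    unfolding index_weights_def 1 by (intro nth_equalityI) simp_all
qed

lemma spent_eigen_list:
  assumes "i < 27" shows "spent (eigen_list \<beta> k index_weights) i j = (if i = j \<and> prw \<beta> (weights ! i) = k then 1 else 0)"
proof -
  have "spent (eigen_list \<beta> k (map (\<lambda>r. (int r, weights ! r)) [m..<n])) i j =
      (if m \<le> i \<and> i < n \<and> i = j \<and> prw \<beta> (weights ! i) = k then 1 else 0)" if "m \<le> n" for m n
    using that
  proof (induction "n - m" arbitrary: m)
    case 0 then show ?case by (simp add: spent_simps)
  next
    case (Suc d)
    then have "[m..<n] = m # [Suc m..<n]" by (simp add: upt_conv_Cons)
    then show ?case
      using Suc.hyps(1)[of "Suc m"] Suc.hyps(2) Suc.prems by (cases "i = m") (auto simp: spent_simps)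
  qed
  from this[of 0 27] assms show ?thesis by (simp add: index_weights_map)
qed

lemma diag_ok: "list_all diag_ok ([1,2,2,3,2,1] # map simple_vec [1,2,3,4,5,6])"
  by code_simp

lemma sl2_tor_eq:
  assumes "(\<beta>, L) \<in> set pos_table" "diag_ok \<beta>" "t \<noteq> 0"
  shows "sl2_tor \<beta> t = (tor \<beta> t :: 'k::field m27)"
proof -
  have v: "valid L" "valid (sptrn L)" using table_ok assms(1) by (auto simp: list_all_iff)
  have P: "rm \<beta> * trn (rm \<beta>) = (sp (spmul L (sptrn L)) :: 'k m27)" "trn (rm \<beta>) * rm \<beta> = (sp (spmul (sptrn L) L) :: 'k m27)"
    by (simp_all add: rm_def rootL_pos[OF assms(1)] sp_mult v sp_trn)
  show ?thesis
  proof (rule m27_eqI)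
    fix r s :: nat assume rs: "r < 27" "s < 27"
    let ?p = "prw \<beta> (weights ! r)"
    have p: "?p = 1 \<or> ?p = 0 \<or> ?p = - 1"
      using assms(2) index_weights_nth[OF rs(1)] unfolding diag_ok_def Let_def list_all_iff by fastforce
    have "spmul L (sptrn L) = eigen_list \<beta> 1 index_weights" "spmul (sptrn L) L = eigen_list \<beta> (- 1) index_weights"
      using assms(2) unfolding diag_ok_def Let_def rootL_pos[OF assms(1)] by blast+
    with p have "(?p = 1 \<or> ?p = 0 \<or> ?p = - 1) \<and>
        spent (spmul L (sptrn L)) r s = (if r = s \<and> ?p = 1 then 1 else 0) \<and>
        spent (spmul (sptrn L) L) r s = (if r = s \<and> ?p = - 1 then 1 else 0)"
      using spent_eigen_list[OF rs(1)] by simp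
    then show "ent (sl2_tor \<beta> t :: 'k m27) r s = ent (tor \<beta> t) r s"
      using rs assms(3) by (auto simp: sl2_tor_def P tor_def)
  qed
qed

text \<open>
  The coroot of \<open>\<gamma>\<^sub>0\<close> is the fundamental coweight dual to \<open>\<alpha>\<^sub>2\<close>. So a root vector raises the degree by
  the coefficient of the root at \<open>\<alpha>\<^sub>2\<close>.
\<close>
definition gr :: "nat \<Rightarrow> int" where
  "gr r = prw [1,2,2,3,2,1] (weights ! r)"

lemma gr_range: "r < 27 \<Longrightarrow> gr r \<in> {-1, 0, 1}"
proof -
  have "diag_ok [1,2,2,3,2,1]" using diag_ok by simp
  then show "r < 27 \<Longrightarrow> gr r \<in> {-1, 0, 1}"
    using index_weights_nth[of r] unfolding diag_ok_def Let_def list_all_iff gr_def by fastforce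
qed

lemma rm_grade:
  assumes "is_root \<beta>" "ent (rm \<beta> :: 'k::field m27) r s \<noteq> 0" "r < 27" "s < 27"
  shows "gr r = gr s + \<beta> ! 1"
proof -
  obtain a b c d e f where \<beta>: "\<beta> = [a, b, c, d, e, f]" using length_6[OF is_root_length[OF assms(1)]] .
  have "prw [1,2,2,3,2,1] (cvec \<beta>) = \<beta> ! 1" by (simp add: \<beta>)
  then show ?thesis
    unfolding gr_def rm_shift[OF assms]
    by (simp add: prw_shift weights_length assms length_cvec is_root_length[OF assms(1)])
qed

definition blk_diag :: "'k::field m27 \<Rightarrow> bool" where
  "blk_diag A \<longleftrightarrow> (\<forall>r<27. \<forall>s<27. ent A r s \<noteq> 0 \<longrightarrow> gr r = gr s)"

definition blk_upper :: "'k::field m27 \<Rightarrow> bool" where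
  "blk_upper A \<longleftrightarrow> (\<forall>r<27. \<forall>s<27. gr r \<le> gr s \<longrightarrow> ent A r s = (if r = s then 1 else 0))"

definition blk_lower :: "'k::field m27 \<Rightarrow> bool" where
  "blk_lower A \<longleftrightarrow> (\<forall>r<27. \<forall>s<27. gr s \<le> gr r \<longrightarrow> ent A r s = (if r = s then 1 else 0))"

lemma blk_diag_mult: "blk_diag A \<Longrightarrow> blk_diag B \<Longrightarrow> blk_diag (A * B)"
  unfolding blk_diag_def[of "A * B"]
proof (intro allI impI)
  fix r s :: nat assume AB: "blk_diag A" "blk_diag B" and rs: "r < 27" "s < 27" "ent (A * B) r s \<noteq> 0"
  have "\<exists>l<27. ent A r l * ent B l s \<noteq> 0"
  proof (rule ccontr)
    assume "\<not> (\<exists>l<27. ent A r l * ent B l s \<noteq> 0)"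
    then have "ent (A * B) r s = 0" unfolding ent_mult[OF rs(1,2)] by (intro sum.neutral) auto
    with rs(3) show False by simp
  qed
  then obtain l where l: "l < 27" "ent A r l * ent B l s \<noteq> 0" by blast
  then have "gr r = gr l" "gr l = gr s" using AB rs by (auto simp: blk_diag_def)
  then show "gr r = gr s" by simp
qed

lemma ent_upper_mult:
  assumes "blk_upper A" "r < 27" "s < 27" "gr r \<le> gr s"
    "\<And>l. l < 27 \<Longrightarrow> gr r > gr l \<Longrightarrow> ent B l s = 0"
  shows "ent (A * B) r s = ent B r s"
proof -
  have "ent (A * B) r s = (\<Sum>l<27. if r = l then ent B r s else 0)"
    unfolding ent_mult[OF assms(2,3)]
  proof (rule sum.cong[OF HOL.refl])
    fix l :: nat assume l: "l \<in> {..<27}"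
    show "ent A r l * ent B l s = (if r = l then ent B r s else 0)"
      using assms(1,2) assms(5)[of l] l unfolding blk_upper_def by (cases "gr r \<le> gr l") auto
  qed
  then show ?thesis using assms(2) by simp
qed

lemma blk_upper_mult: "blk_upper A \<Longrightarrow> blk_upper B \<Longrightarrow> blk_upper (A * B)"
  unfolding blk_upper_def[of "A * B"]
proof (intro allI impI)
  fix r s :: nat assume AB: "blk_upper A" "blk_upper B" and rs: "r < 27" "s < 27" "gr r \<le> gr s"
  have "ent (A * B) r s = ent B r s"
    by (rule ent_upper_mult) (use AB rs in \<open>auto simp: blk_upper_def\<close>)
  then show "ent (A * B) r s = (if r = s then 1 else 0)" using AB rs by (simp add: blk_upper_def)
qed

lemma blk_trn: "blk_lower A \<longleftrightarrow> blk_upper (trn A)"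
proof
  assume "blk_lower A"
  then show "blk_upper (trn A)" unfolding blk_lower_def blk_upper_def by auto
next
  assume A: "blk_upper (trn A)"
  show "blk_lower A"
    unfolding blk_lower_def
  proof (intro allI impI)
    fix r s :: nat assume rs: "r < 27" "s < 27" "gr s \<le> gr r"
    then have "ent (trn A) s r = (if s = r then 1 else 0)" using A unfolding blk_upper_def by blast
    then show "ent A r s = (if r = s then 1 else 0)" using rs by auto
  qed
qed

lemma blk_lower_mult: "blk_lower A \<Longrightarrow> blk_lower B \<Longrightarrow> blk_lower (A * B)"
  unfolding blk_trn by (simp add: blk_upper_mult)

lemma blk_one: "blk_diag 1" "blk_upper 1" "blk_lower 1"
  by (auto simp: blk_diag_def blk_upper_def blk_lower_def split: if_splits)

lemma blk_re:
  assumes "is_root \<beta>"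
  shows "\<beta> ! 1 = 0 \<Longrightarrow> blk_diag (re \<beta> (t :: 'k::field))" "\<beta> ! 1 > 0 \<Longrightarrow> blk_upper (re \<beta> t)" "\<beta> ! 1 < 0 \<Longrightarrow> blk_lower (re \<beta> t)"
proof -
  have g: "ent (rm \<beta> :: 'k m27) r s = 0" if "gr r \<noteq> gr s + \<beta> ! 1" "r < 27" "s < 27" for r s
    using rm_grade[OF assms, of r s, where 'k = 'k] that by auto
  show "\<beta> ! 1 = 0 \<Longrightarrow> blk_diag (re \<beta> t)"
    unfolding blk_diag_def re_def using g by (auto split: if_splits)
  show "\<beta> ! 1 > 0 \<Longrightarrow> blk_upper (re \<beta> t)"
    unfolding blk_upper_def re_def using g by auto
  show "\<beta> ! 1 < 0 \<Longrightarrow> blk_lower (re \<beta> t)"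
    unfolding blk_lower_def re_def using g by auto
qed

lemma blk_dg: "blk_diag (dg f)"
  by (auto simp: blk_diag_def split: if_splits)

text \<open>
  An upper unipotent, a block diagonal and an upper unipotent matrix have a lower unipotent product
  only if the block diagonal one is 1; this gives the uniqueness of the decomposition \<open>m n' nb\<close>.
\<close>
lemma upper_diag_lower:
  assumes "blk_upper A" "blk_diag D" "blk_upper A'" "blk_lower B" "A * (D * A') = B"
  shows "D = 1" "B = 1"
proof -
  have DA: "ent (D * A') r s = ent D r s" if rs: "r < 27" "s < 27" "gr r \<le> gr s" for r s
  proof -
    have "ent (D * A') r s = (\<Sum>l<27. if l = s then ent D r s else 0)"
      unfolding ent_mult[OF rs(1,2)]
    proof (rule sum.cong[OF HOL.refl])
      fix l :: nat assume l: "l \<in> {..<27}"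
      show "ent D r l * ent A' l s = (if l = s then ent D r s else 0)"
      proof (cases "ent D r l = 0")
        case False
        then have "gr l \<le> gr s" using assms(2) rs l by (auto simp: blk_diag_def)
        then show ?thesis using assms(3) rs l by (simp add: blk_upper_def)
      qed (auto)
    qed
    then show ?thesis using rs by simp
  qed
  have AD: "ent (A * (D * A')) r s = ent D r s" if rs: "r < 27" "s < 27" "gr r \<le> gr s" for r s
  proof -
    have "ent (A * (D * A')) r s = ent (D * A') r s"
    proof (rule ent_upper_mult[OF assms(1) rs])
      fix l :: nat assume l: "l < 27" "gr r > gr l"
      then have "ent (D * A') l s = ent D l s" using DA[of l s] rs by simp
      then show "ent (D * A') l s = 0" using assms(2) l rs by (force simp: blk_diag_def)
    qed
    then show ?thesis using DA[OF rs] by simp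
  qed
  show D: "D = 1"
  proof (rule m27_eqI)
    fix r s :: nat assume rs: "r < 27" "s < 27"
    show "ent D r s = ent 1 r s"
    proof (cases "gr r = gr s")
      case True
      then have "ent D r s = ent B r s" using AD[OF rs] assms(5) by simp
      then show ?thesis using assms(4) rs True by (simp add: blk_lower_def)
    next
      case False
      then have "r \<noteq> s" by auto
      then show ?thesis using assms(2) rs False by (auto simp: blk_diag_def)
    qed
  qed
  then have "A * A' = B" using assms(5) by simp
  moreover have "blk_upper (A * A')" using assms(1,3) by (rule blk_upper_mult)
  ultimately show "B = 1"
    using assms(4) by (intro m27_eqI) (metis blk_lower_def blk_upper_def ent_simps(2) linear)
qed

section \<open>Identities in rank one\<close>

lemma rm_sl2:
  assumes "is_root \<beta>"
  defines "E \<equiv> rm \<beta> :: 'k::field m27"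
  shows "E * E = 0" "E * (E * Z) = 0" "trn E * trn E = 0" "trn E * (trn E * Z) = 0"
    "E * (trn E * E) = E" "E * (trn E * (E * Z)) = E * Z" "trn E * (E * trn E) = trn E" "trn E * (E * (trn E * Z)) = trn E * Z"
proof -
  note r = rm_sq[OF assms(1), where 'k = 'k, folded E_def]
  have t0: "trn 0 = (0 :: 'k m27)" by (rule m27_eqI) simp
  show 1: "E * E = 0" "E * (trn E * E) = E" using r by (simp_all add: mult.assoc)
  show 2: "trn E * trn E = 0" "trn E * (E * trn E) = trn E"
    using arg_cong[OF 1(1), of trn] arg_cong[OF 1(2), of trn] by (simp_all add: t0 mult.assoc)
  show "E * (E * Z) = 0" "trn E * (trn E * Z) = 0" "E * (trn E * (E * Z)) = E * Z" "trn E * (E * (trn E * Z)) = trn E * Z"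
    using 1 2 by (simp_all add: mult.assoc[symmetric])
qed

lemmas ring_expand = distrib_left distrib_right left_diff_distrib right_diff_distrib scl_distrib mult.assoc

lemmas ring_normal = ring_expand scl_simps mult_1_left mult_1_right mult_zero_right mult_zero_left
  mult_minus_left mult_minus_right inverse_inverse_eq minus_minus

text \<open>
  As for matrices of size 2, where the order of a lower and an upper unipotent factor can be
  exchanged if the lower right entry \<open>d\<close> of the product is not 0.
\<close>
lemma sl2_lower_upper:
  assumes "is_root \<beta>" "d = 1 + b * c" "d \<noteq> (0 :: 'k::field)"
  shows "re (map uminus \<beta>) b * re \<beta> c = sl2_tor \<beta> (inverse d) * re \<beta> (c * d) * re (map uminus \<beta>) (b / d)"
proof -
  let ?A = "rm \<beta> :: 'k m27" let ?B = "trn ?A"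
  have "sl2_tor \<beta> (inverse d) * re \<beta> (c * d) * re (map uminus \<beta>) (b / d) =
     1 + scl (c * d + (inverse d - 1) * (c * d)) ?A + scl (b / d + (d - 1) * (b / d)) ?B
       + scl (inverse d - 1 + c * d * (b / d) + (inverse d - 1) * (c * d * (b / d))) (?A * ?B) + scl (d - 1) (?B * ?A)"
    unfolding sl2_tor_def re_def rm_neg[OF assms(1)]
    by (simp only: ring_normal rm_sl2[OF assms(1)], rule m27_eqI, simp add: algebra_simps)
  also have "c * d + (inverse d - 1) * (c * d) = c" using assms(3) by (simp add: field_simps)
  also have "b / d + (d - 1) * (b / d) = b" using assms(3) by (simp add: field_simps)
  also have "inverse d - 1 + c * d * (b / d) + (inverse d - 1) * (c * d * (b / d)) = (1 + b * c - d) / d"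
    using assms(3) by (simp add: field_simps)
  also have "1 + b * c - d = 0" using assms(2) by simp
  also have "d - 1 = b * c" using assms(2) by simp
  finally show ?thesis
    unfolding re_def rm_neg[OF assms(1)] by (simp add: ring_expand mult.commute)
qed

text \<open>The first step of the computation of the Levi component, inside the rank one group of a root.\<close>
lemma sl2_weyl:
  assumes "is_root \<beta>" "a * a = 1" "c \<noteq> (0 :: 'k::field)"
  shows "re \<beta> (- a) * re (map uminus \<beta>) a * re \<beta> (- a) * re \<beta> (a * c) =
    re \<beta> (- (a / c)) * sl2_tor \<beta> (inverse c) * re (map uminus \<beta>) (a / c)"
proof -
  let ?A = "rm \<beta> :: 'k m27" let ?B = "trn ?A"
  have a: "a * (a * z) = z" for z using assms(2) by (simp add: mult.assoc[symmetric])
  have 1: "re \<beta> (- a) * re \<beta> (a * c) = re \<beta> (a * c - a)" using re_add[OF assms(1), of "- a" "a * c"] by simp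
  have "re \<beta> (- a) * re (map uminus \<beta>) a * (re \<beta> (- a) * re \<beta> (a * c)) =
     1 - scl a ?A + scl a ?B + scl (a * c - a) ?A - ?A * ?B + scl (c - 1) (?B * ?A) - scl (a * c - a) ?A"
    unfolding 1 re_def rm_neg[OF assms(1)]
    by (simp only: ring_normal rm_sl2[OF assms(1)], rule m27_eqI, simp add: algebra_simps a assms(2))
  also have "\<dots> = 1 - scl a ?A + scl a ?B - ?A * ?B + scl (c - 1) (?B * ?A)" by simp
  also have "\<dots> = re \<beta> (- (a / c)) * sl2_tor \<beta> (inverse c) * re (map uminus \<beta>) (a / c)"
  proof -
    have "re \<beta> (- (a / c)) * sl2_tor \<beta> (inverse c) * re (map uminus \<beta>) (a / c) =
      1 - scl (a / c + (a / c) * (c - 1)) ?A + scl (a / c + (c - 1) * (a / c)) ?B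
      + scl (inverse c - 1 - (a / c) * (a / c) - (c - 1) * (a / c) * (a / c)) (?A * ?B) + scl (c - 1) (?B * ?A)"
      unfolding re_def sl2_tor_def rm_neg[OF assms(1)]
      by (simp only: ring_normal rm_sl2[OF assms(1)], rule m27_eqI, simp add: algebra_simps)
    also have "a / c + (a / c) * (c - 1) = a" using assms(3) by (simp add: field_simps)
    also have "a / c + (c - 1) * (a / c) = a" using assms(3) by (simp add: field_simps)
    also have "inverse c - 1 - (a / c) * (a / c) - (c - 1) * (a / c) * (a / c) = inverse c - 1 - (a * a) / c"
      using assms(3) by (simp add: field_simps)
    also have "\<dots> = - 1" using assms(2,3) by (simp add: field_simps)
    finally show ?thesis by simp
  qed
  finally show ?thesis by (simp add: mult.assoc)
qed

lemma sl2_torus: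
  assumes "is_root \<beta>" "t \<noteq> (0 :: 'k::field)"
  shows "re \<beta> t * re (map uminus \<beta>) (- (1 / t)) * re \<beta> t * (re \<beta> (- 1) * re (map uminus \<beta>) 1 * re \<beta> (- 1)) = sl2_tor \<beta> t"
proof -
  let ?A = "rm \<beta> :: 'k m27" let ?B = "trn ?A"
  have 1: "re \<beta> t * re (map uminus \<beta>) (- (1 / t)) * re \<beta> t = 1 + scl t ?A - scl (1 / t) ?B - ?A * ?B - ?B * ?A"
    unfolding re_def rm_neg[OF assms(1)]
    by (simp only: ring_normal rm_sl2[OF assms(1)], rule m27_eqI, use assms(2) in \<open>simp add: algebra_simps\<close>)
  have 2: "re \<beta> (- 1) * re (map uminus \<beta>) 1 * re \<beta> (- 1) = 1 - ?A + ?B - ?A * ?B - ?B * ?A"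
    unfolding re_def rm_neg[OF assms(1)]
    by (simp only: ring_normal rm_sl2[OF assms(1)], rule m27_eqI, simp add: algebra_simps)
  show ?thesis
    unfolding 1 2 sl2_tor_def
    by (simp only: ring_normal rm_sl2[OF assms(1)], rule m27_eqI, use assms(2) in \<open>simp add: field_simps\<close>)
qed

section \<open>Commutator relations\<close>

text \<open>
  \<open>Z\<close> is the commutator of \<open>A\<close> and \<open>B\<close>. The two vanishing products make the commutator of the root elements
  a single root element.
\<close>
definition comm_ok :: "sparse \<Rightarrow> sparse \<Rightarrow> sparse \<Rightarrow> bool" where
  "comm_ok A B Z \<longleftrightarrow> valid A \<and> valid B \<and> valid Z \<and> spadd (spmul A B) (spneg (spmul B A)) = Z \<and>
     spmul B Z = [] \<and> spmul Z A = []"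

lemma comm:
  assumes "comm_ok (rootL \<alpha>) (rootL \<beta>) Z"
  shows "re \<alpha> t * re \<beta> u = re \<beta> u * ((1 + scl (t * u) (sp Z)) * re \<alpha> (t :: 'k::field))"
proof -
  let ?A = "rm \<alpha> :: 'k m27" let ?B = "rm \<beta> :: 'k m27" let ?Z = "sp Z :: 'k m27"
  from assms have v: "valid (rootL \<alpha>)" "valid (rootL \<beta>)" "valid Z"
    and "spadd (spmul (rootL \<alpha>) (rootL \<beta>)) (spneg (spmul (rootL \<beta>) (rootL \<alpha>))) = Z"
    "spmul (rootL \<beta>) Z = []" "spmul Z (rootL \<alpha>) = []" by (auto simp: comm_ok_def)
  note s = this(4-6)
  have Z: "?A * ?B - ?B * ?A = ?Z" "?B * ?Z = 0" "?Z * ?A = 0"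
    using arg_cong[OF s(1), of "sp :: _ \<Rightarrow> 'k m27"] arg_cong[OF s(2), of "sp :: _ \<Rightarrow> 'k m27"] arg_cong[OF s(3), of "sp :: _ \<Rightarrow> 'k m27"]
    by (simp_all add: sp_add sp_neg sp_mult v sp_Nil rm_def)
  have AB: "?A * ?B = ?Z + ?B * ?A" using Z(1) by (simp add: algebra_simps)
  have BZ: "?B * (?Z * ?A) = 0" using Z(3) by simp
  show ?thesis
    unfolding re_def by (simp add: ring_expand AB Z(2,3) BZ mult.commute)
qed

lemma comm_pos: "comm_ok (rootL \<alpha>) (rootL \<beta>) (rootL \<gamma>) \<Longrightarrow>
    re \<alpha> t * (re \<beta> u * Z) = re \<beta> u * (re \<gamma> (t * u) * (re \<alpha> (t :: 'k::field) * Z))"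
  using comm[of \<alpha> \<beta> "rootL \<gamma>" t u] by (simp add: re_def[of \<gamma>] rm_def mult.assoc[symmetric])

lemma comm_neg: "comm_ok (rootL \<alpha>) (rootL \<beta>) (spneg (rootL \<gamma>)) \<Longrightarrow>
    re \<alpha> t * (re \<beta> u * Z) = re \<beta> u * (re \<gamma> (- (t * u)) * (re \<alpha> (t :: 'k::field) * Z))"
  using comm[of \<alpha> \<beta> "spneg (rootL \<gamma>)" t u] by (simp add: re_def[of \<gamma>] rm_def mult.assoc[symmetric] sp_neg)

lemma comm_zero: "comm_ok (rootL \<alpha>) (rootL \<beta>) [] \<Longrightarrow>
    re \<alpha> t * (re \<beta> u * Z) = re \<beta> u * (re \<alpha> (t :: 'k::field) * Z)"
  using comm[of \<alpha> \<beta> "[]" t u] by (simp add: mult.assoc[symmetric] sp_Nil)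

text \<open>
  The roots that occur in the computation: \<open>n\<^sub>i = - \<gamma>\<^sub>i\<close>, \<open>d\<^sub>i = \<gamma>\<^sub>i - \<gamma>\<^sub>0\<close> and \<open>e\<^sub>i\<^sub>j = \<gamma>\<^sub>i + \<gamma>\<^sub>j - \<gamma>\<^sub>0\<close>.
\<close>
abbreviation "g0 \<equiv> [1, 2, 2, 3, 2, 1] :: int list"
abbreviation "g1 \<equiv> [1, 1, 2, 3, 2, 1] :: int list"
abbreviation "g2 \<equiv> [1, 1, 2, 2, 2, 1] :: int list"
abbreviation "g3 \<equiv> [1, 1, 1, 2, 1, 1] :: int list"
abbreviation "g4 \<equiv> [0, 1, 1, 2, 1, 0] :: int list"
abbreviation "g5 \<equiv> [0, 1, 0, 0, 0, 0] :: int list"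
abbreviation "n0 \<equiv> [-1, -2, -2, -3, -2, -1] :: int list"
abbreviation "n1 \<equiv> [-1, -1, -2, -3, -2, -1] :: int list"
abbreviation "n5 \<equiv> [0, -1, 0, 0, 0, 0] :: int list"
abbreviation "d2 \<equiv> [0, -1, 0, -1, 0, 0] :: int list"
abbreviation "d3 \<equiv> [0, -1, -1, -1, -1, 0] :: int list"
abbreviation "d4 \<equiv> [-1, -1, -1, -1, -1, -1] :: int list"
abbreviation "e23 \<equiv> [1, 0, 1, 1, 1, 1] :: int list"
abbreviation "e24 \<equiv> [0, 0, 1, 1, 1, 0] :: int list"
abbreviation "e34 \<equiv> [0, 0, 0, 1, 0, 0] :: int list"
abbreviation "e25 \<equiv> [0, 0, 0, -1, 0, 0] :: int list"
abbreviation "e35 \<equiv> [0, 0, -1, -1, -1, 0] :: int list"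
abbreviation "e45 \<equiv> [-1, 0, -1, -1, -1, -1] :: int list"

lemma named_roots: "list_all is_root [g0, g1, g2, g3, g4, g5, n0, n1, n5, d2, d3, d4, e23, e24, e34, e25, e35, e45]"
  by code_simp

lemma comm_table:
  "comm_ok (rootL n0) (rootL g1) (spneg (rootL n5))"
  "comm_ok (rootL n0) (rootL g2) (rootL d2)" "comm_ok (rootL n0) (rootL g3) (rootL d3)"
  "comm_ok (rootL n0) (rootL g4) (rootL d4)" "comm_ok (rootL n0) (rootL g5) (rootL n1)"
  "comm_ok (rootL d2) (rootL g3) (rootL e23)" "comm_ok (rootL d2) (rootL g4) (rootL e24)"
  "comm_ok (rootL d3) (rootL g4) (spneg (rootL e34))" "comm_ok (rootL e23) (rootL g4) (spneg (rootL g1))"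
  "comm_ok (rootL d2) (rootL e34) (rootL n5)" "comm_ok (rootL d2) (rootL g5) (spneg (rootL e25))"
  "comm_ok (rootL d3) (rootL g5) (rootL e35)" "comm_ok (rootL d4) (rootL g5) (rootL e45)"
  "comm_ok (rootL n5) (rootL g2) []" "comm_ok (rootL n5) (rootL g3) []" "comm_ok (rootL n5) (rootL g4) []"
  "comm_ok (rootL n5) (rootL d2) []" "comm_ok (rootL n5) (rootL d3) []" "comm_ok (rootL n5) (rootL d4) []"
  "comm_ok (rootL n5) (rootL n0) []" "comm_ok (rootL n5) (rootL g1) []"
  "comm_ok (rootL n5) (rootL e23) []" "comm_ok (rootL n5) (rootL e24) []" "comm_ok (rootL n5) (rootL e34) []"
  by code_simp+

text \<open>
  The factors are sorted by degree, apart from some that can be moved later because the roots of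
  degree 0 normalize the unipotent radicals. The only step that can fail
  is the exchange of \<open>x(-\<gamma>\<^sub>5, b)\<close> and \<open>x(\<gamma>\<^sub>5, t\<^sub>5)\<close> in rank one, which needs \<open>d \<noteq> 0\<close>.
\<close>
lemma big_cell:
  fixes u t1 t2 t3 t4 t5 :: "'k::field"
  defines "b \<equiv> - (u * t1) - u * u * t2 * t3 * t4"
  defines "d \<equiv> 1 + b * t5"
  assumes d: "d \<noteq> 0"
  shows "re n0 u * (re g1 t1 * (re g2 t2 * (re g3 t3 * (re g4 t4 * re g5 t5)))) =
    re g1 t1 * (re g2 t2 * (re g3 t3 * (re g4 t4 * (re g1 (- (u * t2 * t3 * t4)) *
    (re e23 (u * t2 * t3) * (re e24 (u * t2 * t4) * (re e34 (- (u * t3 * t4)) *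
    (tor g5 (inverse d) * (re g5 (t5 * d) *
    (re e25 (- (u * t2 * t5)) * (re d2 (u * t2 / d) * (re e35 (u * t3 * t5) * (re d3 (u * t3 / d) *
    (re e45 (u * t4 * t5) * (re d4 (u * t4 / d) * (re n1 (u * t5) * (re n0 (u / d) * re n5 (b / d))))))))))))))))))"
proof -
  have r5: "is_root g5" "is_root n5" using named_roots by simp_all
  have "sl2_tor g5 (inverse d) = tor g5 (inverse d)"
  proof (rule sl2_tor_eq)
    show "(g5, rootL g5) \<in> set pos_table" using simple_in_table[of 2] by (simp add: simple_vec_def)
    show "diag_ok g5" using diag_ok by (simp add: simple_vec_def)
  qed (use d in simp)
  moreover have "map uminus g5 = n5" by simp
  ultimately have s: "re n5 b * (re g5 t5 * Z) = tor g5 (inverse d) * (re g5 (t5 * d) * (re n5 (b / d) * Z))" for Z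
    using arg_cong[OF sl2_lower_upper[OF r5(1), of d b t5], of "\<lambda>A. A * Z"] d unfolding d_def by (simp add: mult.assoc)
  have t: "re \<beta> v * (tor g5 (inverse d) * Z) = tor g5 (inverse d) * (re \<beta> (v / d) * Z)"
    if "\<beta> \<in> {d2, d3, d4, n0}" for \<beta> v Z
  proof -
    have "is_root \<beta>" "root_pairing \<beta> g5 = - 1" using that named_roots by (auto simp: root_pairing_explicit)
    then show ?thesis
      using arg_cong[OF tor_re[of \<beta> g5 "inverse d" v], of "\<lambda>A. A * Z"] d by (simp add: mult.assoc divide_inverse)
  qed
  note c = comm_neg[OF comm_table(1)] comm_pos[OF comm_table(2)] comm_pos[OF comm_table(3)] comm_pos[OF comm_table(4)]
    comm_pos[OF comm_table(5)] comm_pos[OF comm_table(6)] comm_pos[OF comm_table(7)] comm_neg[OF comm_table(8)]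
    comm_neg[OF comm_table(9)] comm_pos[OF comm_table(10)] comm_neg[OF comm_table(11)] comm_pos[OF comm_table(12)]
    comm_pos[OF comm_table(13)] comm_table(14-24)[THEN comm_zero]
  have a: "re n5 v * (re n5 w * Z) = re n5 (v + w) * Z" for v w :: 'k and Z
    using re_add[OF r5(2), of v w] by (simp add: mult.assoc[symmetric])
  have 1: "re n0 u * (re g1 t1 * (re g2 t2 * (re g3 t3 * (re g4 t4 * Z)))) =
    re g1 t1 * (re g2 t2 * (re g3 t3 * (re g4 t4 * (re g1 (- (u * t2 * t3 * t4)) *
    (re e23 (u * t2 * t3) * (re e24 (u * t2 * t4) * (re e34 (- (u * t3 * t4)) *
    (re d2 (u * t2) * (re d3 (u * t3) * (re d4 (u * t4) * (re n0 u * (re n5 b * Z))))))))))))" for Z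
    by (simp only: c a) (simp add: b_def mult_ac)
  have q: "v / d * (t5 * d) = v * t5" for v using d by simp
  have "re d2 (u * t2) * (re d3 (u * t3) * (re d4 (u * t4) * (re n0 u * (re n5 b * (re g5 t5 * 1))))) =
    tor g5 (inverse d) * (re g5 (t5 * d) *
    (re e25 (- (u * t2 * t5)) * (re d2 (u * t2 / d) * (re e35 (u * t3 * t5) * (re d3 (u * t3 / d) *
    (re e45 (u * t4 * t5) * (re d4 (u * t4 / d) * (re n1 (u * t5) * (re n0 (u / d) * (re n5 (b / d) * 1))))))))))"
    by (simp only: s t insert_iff simp_thms c q)
  then show ?thesis by (simp only: 1[of "re g5 t5"] mult_1_right)
qed

section \<open>Subgroups generated by root elements and tori\<close>

definition genm :: "'k::field m27 set \<Rightarrow> 'k m27 set" where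
  "genm S = {A. mat_of A \<in> generate E6 (mat_of ` S)}"

lemma genm_incl: "A \<in> S \<Longrightarrow> A \<in> genm S"
  by (auto simp: genm_def intro: generate.incl)

lemma genm_one: "1 \<in> genm S"
  using generate.one[of E6] by (simp add: genm_def one_m27.rep_eq E6_simps)

lemma genm_mult: "A \<in> genm S \<Longrightarrow> B \<in> genm S \<Longrightarrow> A * B \<in> genm S"
  using generate.eng[of "mat_of A" E6 _ "mat_of B"] by (simp add: genm_def times_m27.rep_eq E6_simps)

lemma genm_EE: "S \<subseteq> EE \<Longrightarrow> genm S \<subseteq> EE"
  using E6.generate_in_carrier[of "mat_of ` S"] by (auto simp: genm_def EE_def)

lemma genm_minv:
  assumes "S \<subseteq> EE" "A \<in> genm S" shows "minv A \<in> genm S"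
proof -
  have "A \<in> EE" using genm_EE[OF assms(1)] assms(2) by blast
  moreover have "mat_of ` S \<subseteq> carrier E6" using assms(1) by (auto simp: EE_def)
  ultimately show ?thesis
    using E6.generate_m_inv_closed[of "mat_of ` S" "mat_of A"] assms(2) by (simp add: genm_def minv(1))
qed

lemma genm_mat_of: "S \<subseteq> EE \<Longrightarrow> g \<in> generate E6 (mat_of ` S) \<Longrightarrow> \<exists>A\<in>genm S. g = mat_of A"
  using E6.generate_in_carrier[of "mat_of ` S" g] E6_mat_of[of g] by (auto simp: genm_def EE_def)

lemma genm_induct [consumes 2, case_names one gen minv mult]:
  assumes "A \<in> genm S" "S \<subseteq> EE"
    and "P 1" "\<And>A. A \<in> S \<Longrightarrow> P A" "\<And>A. A \<in> S \<Longrightarrow> P (minv A)" "\<And>A B. P A \<Longrightarrow> P B \<Longrightarrow> P (A * B)"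
  shows "P A"
proof -
  have "\<exists>B. g = mat_of B \<and> P B" if "g \<in> generate E6 (mat_of ` S)" for g
    using that
  proof (induction rule: generate.induct)
    case one then show ?case using assms(3) by (intro exI[of _ 1]) (simp add: one_m27.rep_eq E6_simps)
  next
    case (incl h) then show ?case using assms(4) by blast
  next
    case (inv h)
    then obtain B where "B \<in> S" "h = mat_of B" by blast
    then show ?case using assms(2,5) minv(1)[of B] by (intro exI[of _ "minv B"]) auto
  next
    case (eng h1 h2)
    then obtain B C where "h1 = mat_of B" "P B" "h2 = mat_of C" "P C" by blast
    then show ?case using assms(6) by (intro exI[of _ "B * C"]) (simp add: times_m27.rep_eq E6_simps)
  qed
  then obtain B where "mat_of A = mat_of B" "P B" using assms(1) unfolding genm_def by blast
  then show ?thesis by (simp add: mat_of_inject)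
qed

lemma minv_re: "\<beta> \<in> roots \<Longrightarrow> minv (re \<beta> t) = re \<beta> (- t)"
  by (intro minv_eqI roots_EE re_inverse roots_is_root)

lemma length_simple: "length (simple_vec i) = 6"
  by (simp add: simple_vec_def)

lemma tor_simple_EE:
  assumes "i \<in> {1..6}" "t \<noteq> 0" shows "tor (simple_vec (int i)) (t :: 'k::field) \<in> EE"
proof -
  let ?a = "simple_vec (int i)"
  have r: "?a \<in> roots" "map uminus ?a \<in> roots"
    using roots.simple[OF assms(1)] roots_neg by (simp_all add: simple_root_vec[OF assms(1)])
  have "int i \<in> {1,2,3,4,5,6}" using assms(1) by auto
  then have "diag_ok ?a" using diag_ok by auto
  then have "tor ?a t = sl2_tor ?a t" by (rule sl2_tor_eq[OF simple_in_table[OF assms(1)] _ assms(2), symmetric])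
  also have "\<dots> \<in> EE"
    unfolding sl2_torus[OF is_root_simple[OF assms(1)] assms(2), symmetric]
    by (intro EE_mult roots_EE r)
  finally show ?thesis .
qed

text \<open>
  Generators of \<open>M\<close>, and below of \<open>N\<close> and its opposite. As all parameters occur, the sets are the same for
  the root elements of a Chevalley system.
\<close>
definition MS :: "'k::field m27 set" where
  "MS = {tor (simple_vec (int i)) t |i t. i \<in> {1..6} \<and> t \<noteq> 0} \<union> {re \<beta> t |\<beta> t. \<beta> \<in> roots \<and> \<beta> ! 1 = 0}"

definition NS :: "'k::field m27 set" where
  "NS = {re \<beta> t |\<beta> t. \<beta> \<in> roots \<and> \<beta> ! 1 > 0}"

definition LS :: "'k::field m27 set" where
  "LS = {re \<beta> t |\<beta> t. \<beta> \<in> roots \<and> \<beta> ! 1 < 0}"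

lemma gens_EE: "MS \<subseteq> EE" "NS \<subseteq> EE" "LS \<subseteq> EE"
  by (auto simp: MS_def NS_def LS_def intro: roots_EE tor_simple_EE)

lemma minv_tor: "i \<in> {1..6} \<Longrightarrow> t \<noteq> 0 \<Longrightarrow> minv (tor (simple_vec (int i)) t) = tor (simple_vec (int i)) (inverse t)"
  by (intro minv_eqI tor_simple_EE) (simp_all add: tor_mult)

lemma minv_gens: "A \<in> MS \<Longrightarrow> minv A \<in> MS" "A \<in> NS \<Longrightarrow> minv A \<in> NS" "A \<in> LS \<Longrightarrow> minv A \<in> LS"
proof -
  show "minv A \<in> NS" if A: "A \<in> NS"
  proof -
    obtain \<beta> t where "A = re \<beta> t" "\<beta> \<in> roots" "\<beta> ! 1 > 0" using A unfolding NS_def by blast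
    then show ?thesis using minv_re[of \<beta> t] unfolding NS_def by blast
  qed
  show "minv A \<in> LS" if A: "A \<in> LS"
  proof -
    obtain \<beta> t where "A = re \<beta> t" "\<beta> \<in> roots" "\<beta> ! 1 < 0" using A unfolding LS_def by blast
    then show ?thesis using minv_re[of \<beta> t] unfolding LS_def by blast
  qed
  assume "A \<in> MS"
  then consider i t where "A = tor (simple_vec (int i)) t" "i \<in> {1..6}" "t \<noteq> 0"
    | \<beta> t where "A = re \<beta> t" "\<beta> \<in> roots" "\<beta> ! 1 = 0" unfolding MS_def by blast
  then show "minv A \<in> MS"
  proof cases
    case 1
    then have "inverse t \<noteq> 0" by simp
    then show ?thesis using 1 minv_tor[OF 1(2,3)] unfolding MS_def by blast
  next
    case 2 then show ?thesis using minv_re[OF 2(2), of t] unfolding MS_def by blast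
  qed
qed

lemma blk_gens: "A \<in> genm MS \<Longrightarrow> blk_diag A" "A \<in> genm NS \<Longrightarrow> blk_upper A" "A \<in> genm LS \<Longrightarrow> blk_lower A"
proof -
  have M: "blk_diag A" if "A \<in> MS" for A :: "'a m27"
    using that blk_re(1)[OF roots_is_root] by (auto simp: MS_def tor_def blk_dg)
  have N: "blk_upper A" if "A \<in> NS" for A :: "'a m27"
    using that blk_re(2)[OF roots_is_root] by (auto simp: NS_def)
  have L: "blk_lower A" if "A \<in> LS" for A :: "'a m27"
    using that blk_re(3)[OF roots_is_root] by (auto simp: LS_def)
  show "blk_diag A" if "A \<in> genm MS"
    by (rule genm_induct[OF that gens_EE(1)]) (auto intro: blk_one blk_diag_mult M minv_gens)
  show "blk_upper A" if "A \<in> genm NS"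
    by (rule genm_induct[OF that gens_EE(2)]) (auto intro: blk_one blk_upper_mult N minv_gens)
  show "blk_lower A" if "A \<in> genm LS"
    by (rule genm_induct[OF that gens_EE(3)]) (auto intro: blk_one blk_lower_mult L minv_gens)
qed

lemma decomposition_unique:
  assumes "m \<in> genm MS" "m' \<in> genm MS" "n \<in> genm NS" "n' \<in> genm NS" "b \<in> genm LS" "b' \<in> genm LS"
    "m * n * b = m' * n' * b'"
  shows "m = m'"
proof -
  note E = genm_EE[OF gens_EE(1)] genm_EE[OF gens_EE(2)] genm_EE[OF gens_EE(3)]
  have e: "m' \<in> EE" "n' \<in> EE" "b \<in> EE" using assms E by auto
  have "minv n' * ((minv m' * m) * n) = minv n' * (minv m' * (m * n * b)) * minv b"
    using minv(3)[OF e(3)] by (simp add: mult.assoc)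
  also have "\<dots> = b' * minv b"
    unfolding assms(7) using minv(4)[OF e(1)] minv(4)[OF e(2)] by (simp add: mult.assoc) (simp add: mult.assoc[symmetric])
  finally have eq: "minv n' * ((minv m' * m) * n) = b' * minv b" .
  have "minv m' * m = 1"
    by (rule upper_diag_lower(1)[OF _ _ _ _ eq])
      (intro blk_gens genm_mult genm_minv gens_EE assms)+
  then have "m' * (minv m' * m) = m'" by simp
  then show ?thesis using minv(3)[OF e(1)] by (simp add: mult.assoc[symmetric])
qed

lemma tor_g0: "t \<noteq> 0 \<Longrightarrow> tor g0 t \<in> genm MS"
proof -
  assume t: "t \<noteq> 0"
  have "tor g0 t = tor (simple_vec 1) t * (tor (simple_vec 2) (t^2) * (tor (simple_vec 3) (t^2) *
      (tor (simple_vec 4) (t^3) * (tor (simple_vec 5) (t^2) * tor (simple_vec 6) t))))"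
  proof -
    have "t powi prw g0 (weights ! r) = t powi prw (simple_vec 1) (weights ! r) * ((t^2) powi prw (simple_vec 2) (weights ! r) *
       ((t^2) powi prw (simple_vec 3) (weights ! r) * ((t^3) powi prw (simple_vec 4) (weights ! r) *
       ((t^2) powi prw (simple_vec 5) (weights ! r) * t powi prw (simple_vec 6) (weights ! r)))))" if r: "r < 27" for r
    proof -
      obtain a b c d e f where w: "weights ! r = [a, b, c, d, e, f]" using length_6[OF weights_length(2)[OF r]] .
      have p: "(t ^ n) powi k = t powi (int n * k)" for n k
        by (simp add: power_int_power)
      show ?thesis
        unfolding w p simple_vec_def using t by (simp add: power_int_add[symmetric] algebra_simps)
    qed
    then show ?thesis unfolding tor_def dg_mult by (intro m27_eqI) simp
  qed
  also have "\<dots> \<in> genm MS"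
  proof -
    have s: "tor (simple_vec (int i)) u \<in> genm MS" if "i \<in> {1..6}" "u \<noteq> 0" for i u
      by (rule genm_incl) (use that in \<open>auto simp: MS_def\<close>)
    have p: "t ^ 2 \<noteq> 0" "t ^ 3 \<noteq> 0" using t by simp_all
    show ?thesis
      using s[of 1 t] s[of 2 "t ^ 2"] s[of 3 "t ^ 2"] s[of 4 "t ^ 3"] s[of 5 "t ^ 2"] s[of 6 t] t p
      by (intro genm_mult) simp_all
  qed
  finally show "tor g0 t \<in> genm MS" .
qed

lemma tor_g5: "t \<noteq> 0 \<Longrightarrow> tor g5 t \<in> genm MS"
proof (rule genm_incl)
  assume "t \<noteq> 0"
  then show "tor g5 t \<in> MS" unfolding MS_def
    by (intro UnI1 CollectI exI[of _ 2] exI[of _ t]) (simp add: simple_vec_def)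
qed

section \<open>The Levi factor normalizes the unipotent radicals\<close>

text \<open>
  \<open>A\<close> normalizes \<open>N\<close> and its opposite, in the form in which factors are moved to the right.
\<close>
definition normalizes :: "'k::field m27 \<Rightarrow> bool" where
  "normalizes A \<longleftrightarrow> (\<forall>n\<in>genm NS. \<exists>n'\<in>genm NS. n * A = A * n') \<and> (\<forall>n\<in>genm LS. \<exists>n'\<in>genm LS. n * A = A * n')"

lemma normalizesI:
  assumes "\<And>\<gamma> u. \<gamma> \<in> roots \<Longrightarrow> \<gamma> ! 1 > 0 \<Longrightarrow> \<exists>n'\<in>genm NS. re \<gamma> u * A = A * n'"
    and "\<And>\<gamma> u. \<gamma> \<in> roots \<Longrightarrow> \<gamma> ! 1 < 0 \<Longrightarrow> \<exists>n'\<in>genm LS. re \<gamma> u * A = A * n'"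
  shows "normalizes A"
proof -
  have P: "\<exists>n'\<in>genm S. n * A = A * n'"
    if "n \<in> genm S" "S \<subseteq> EE" "\<And>B. B \<in> S \<Longrightarrow> \<exists>n'\<in>genm S. B * A = A * n'" "\<And>B. B \<in> S \<Longrightarrow> minv B \<in> S" for n S
    using that(1,2)
  proof (induction rule: genm_induct)
    case one then show ?case using genm_one by (intro bexI[of _ 1]) auto
  next
    case (mult B C)
    then obtain b c where "b \<in> genm S" "B * A = A * b" "c \<in> genm S" "C * A = A * c" by blast
    then have "B * C * A = A * (b * c)" by (simp add: mult.assoc) (simp add: mult.assoc[symmetric])
    then show ?case using genm_mult[OF \<open>b \<in> _\<close> \<open>c \<in> _\<close>] by blast
  qed (use that(3,4) in blast)+
  have N: "\<exists>n'\<in>genm NS. B * A = A * n'" if "B \<in> NS" for B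
    using that assms(1) unfolding NS_def by blast
  have L: "\<exists>n'\<in>genm LS. B * A = A * n'" if "B \<in> LS" for B
    using that assms(2) unfolding LS_def by blast
  show ?thesis
    unfolding normalizes_def using P[OF _ gens_EE(2) N minv_gens(2)] P[OF _ gens_EE(3) L minv_gens(3)] by blast
qed

lemma tor_normalizes:
  assumes "length l = 6" "t \<noteq> 0" shows "normalizes (tor l t)"
proof (rule normalizesI)
  fix \<gamma> u assume g: "\<gamma> \<in> roots"
  let ?n = "re \<gamma> (u * t powi (- root_pairing \<gamma> l))"
  have e: "re \<gamma> u * tor l t = tor l t * ?n" by (rule tor_re[OF roots_is_root[OF g] assms])
  show "\<exists>n'\<in>genm NS. re \<gamma> u * tor l t = tor l t * n'" if "\<gamma> ! 1 > 0"
    by (rule bexI[of _ ?n], rule e, rule genm_incl, use that g in \<open>auto simp: NS_def\<close>)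
  show "\<exists>n'\<in>genm LS. re \<gamma> u * tor l t = tor l t * n'" if "\<gamma> ! 1 < 0"
    by (rule bexI[of _ ?n], rule e, rule genm_incl, use that g in \<open>auto simp: LS_def\<close>)
qed

text \<open>
  The commutators of the root vectors of nonzero degree with the one of \<open>\<beta>\<close> are root vectors up to sign, or 0.
\<close>
fun normal_ok :: "int list \<Rightarrow> sparse \<Rightarrow> (int list \<times> sparse) list \<Rightarrow> (int list \<times> sparse) list \<Rightarrow> bool" where
  "normal_ok \<beta> B T [] = True"
| "normal_ok \<beta> B T ((\<gamma>, A) # S) = ((\<gamma> ! 1 = 0 \<or>
     (let Z = spadd (spmul A B) (spneg (spmul B A)) in comm_ok A B Z \<and>
       (if Z = [] then True else case map_of T (map2 (+) \<gamma> \<beta>) of None \<Rightarrow> False | Some L \<Rightarrow> Z = L \<or> Z = spneg L))) \<and>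
     normal_ok \<beta> B T S)"

lemma normal_ok:
  "normal_ok e23 (rootL e23) pos_table pos_table" "normal_ok e24 (rootL e24) pos_table pos_table"
  "normal_ok e34 (rootL e34) pos_table pos_table" "normal_ok e25 (rootL e25) pos_table pos_table"
  "normal_ok e35 (rootL e35) pos_table pos_table" "normal_ok e45 (rootL e45) pos_table pos_table"
  by code_simp+

lemma normal_okD:
  "normal_ok \<beta> B T S \<Longrightarrow> (\<gamma>, A) \<in> set S \<Longrightarrow> \<gamma> ! 1 \<noteq> 0 \<Longrightarrow> comm_ok A B (spadd (spmul A B) (spneg (spmul B A))) \<and>
    (spadd (spmul A B) (spneg (spmul B A)) = [] \<or> (\<exists>L. map_of T (map2 (+) \<gamma> \<beta>) = Some L \<and>
      (spadd (spmul A B) (spneg (spmul B A)) = L \<or> spadd (spmul A B) (spneg (spmul B A)) = spneg L)))"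
  by (induction \<beta> B T S rule: normal_ok.induct) (auto simp: Let_def split: if_splits option.splits)

text \<open>
  The conjugate of a root element by one of degree 0 is a product of at most two root elements of the same
  degree. The transposed statement is the one for negative roots.
\<close>
lemma root_commutator:
  assumes "normal_ok \<beta> (rootL \<beta>) pos_table pos_table" "(\<gamma>, A) \<in> set pos_table" "\<gamma> ! 1 > 0"
    "length \<beta> = 6" "\<beta> ! 1 = 0"
  shows "\<exists>n'\<in>genm NS. re \<gamma> (u :: 'k::field) * re \<beta> t = re \<beta> t * n' \<and> trn n' \<in> genm LS"
proof -
  have trn_re: "trn (re \<delta> v) = re (map uminus \<delta>) v" if "is_root \<delta>" for \<delta> and v :: 'k
    unfolding re_def rm_neg[OF that] by simp
  have pos: "re \<delta> v \<in> genm NS \<and> trn (re \<delta> v) \<in> genm LS" if "(\<delta>, L) \<in> set pos_table" "\<delta> ! 1 > 0" for \<delta> L and v :: 'k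
  proof -
    have r: "\<delta> \<in> roots" by (rule pos_table_roots[OF that(1)])
    have l: "length \<delta> = 6" by (rule pos_length[OF that(1)])
    have "re \<delta> v \<in> NS" unfolding NS_def using r that(2) by blast
    moreover have "re (map uminus \<delta>) v \<in> LS"
      unfolding LS_def using roots_neg[OF r] that(2) l by (intro CollectI exI[of _ "map uminus \<delta>"] exI[of _ v]) simp
    ultimately show ?thesis unfolding trn_re[OF roots_is_root[OF r]] by (blast intro: genm_incl)
  qed
  let ?Z = "spadd (spmul A (rootL \<beta>)) (spneg (spmul (rootL \<beta>) A))"
  have A: "rootL \<gamma> = A" by (rule rootL_pos[OF assms(2)])
  from normal_okD[OF assms(1,2)] assms(3) have c: "comm_ok (rootL \<gamma>) (rootL \<beta>) ?Z"
    and Z: "?Z = [] \<or> (\<exists>L. map_of pos_table (map2 (+) \<gamma> \<beta>) = Some L \<and> (?Z = L \<or> ?Z = spneg L))"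
    unfolding A by auto
  define n' where "n' = (1 + scl (u * t) (sp ?Z)) * re \<gamma> u"
  note g = pos[OF assms(2,3), of u]
  have "n' \<in> genm NS \<and> trn n' \<in> genm LS"
  proof (cases "?Z = []")
    case True then show ?thesis using g by (simp add: n'_def sp_Nil)
  next
    case False
    then obtain L where m: "map_of pos_table (map2 (+) \<gamma> \<beta>) = Some L" and Z: "?Z = L \<or> ?Z = spneg L"
      using Z by blast
    note t = map_of_SomeD[OF m]
    have "map2 (+) \<gamma> \<beta> ! 1 = \<gamma> ! 1"
      using assms(4,5) pos_length[OF assms(2)] by simp
    then have p: "re (map2 (+) \<gamma> \<beta>) v \<in> genm NS \<and> trn (re (map2 (+) \<gamma> \<beta>) v) \<in> genm LS" for v :: 'k
      using pos[OF t] assms(3) by simp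
    have "1 + scl (u * t) (sp ?Z) \<in> range (re (map2 (+) \<gamma> \<beta>))"
    proof -
      have "1 + scl (u * t) (sp ?Z) = re (map2 (+) \<gamma> \<beta>) (u * t) \<or> 1 + scl (u * t) (sp ?Z) = re (map2 (+) \<gamma> \<beta>) (- (u * t))"
        using Z unfolding re_def rm_def rootL_pos[OF t] by (auto simp: sp_neg)
      then show ?thesis by auto
    qed
    then obtain v where v: "1 + scl (u * t) (sp ?Z) = re (map2 (+) \<gamma> \<beta>) v" by blast
    show ?thesis unfolding n'_def v using p[of v] g by (simp add: genm_mult)
  qed
  moreover have "re \<gamma> u * re \<beta> t = re \<beta> t * n'" unfolding n'_def by (rule comm[OF c])
  ultimately show ?thesis by blast
qed

lemma re_normalizes:
  assumes "normal_ok \<beta> (rootL \<beta>) pos_table pos_table" "normal_ok (map uminus \<beta>) (rootL (map uminus \<beta>)) pos_table pos_table"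
    "is_root \<beta>" "\<beta> ! 1 = 0"
  shows "normalizes (re \<beta> (t :: 'k::field))"
proof (rule normalizesI)
  have l: "length \<beta> = 6" by (rule is_root_length[OF assms(3)])
  have tab: "\<exists>A. (\<gamma>, A) \<in> set pos_table" if "\<gamma> \<in> roots" "\<gamma> ! 1 > 0" for \<gamma>
    using roots_is_root[OF that(1)]
  proof (cases rule: is_root_cases)
    case (2 \<alpha> L)
    have "length \<alpha> = 6" by (rule pos_length[OF 2(1)])
    moreover have "list_all (\<lambda>b. 0 \<le> b) \<alpha>" using table_keys(2) 2(1) by (auto simp: list_all_iff)
    ultimately have "\<gamma> ! 1 \<le> 0" unfolding 2(2) by (simp add: list_all_length)
    with that(2) show ?thesis by simp
  qed blast
  show "\<exists>n'\<in>genm NS. re \<gamma> u * re \<beta> t = re \<beta> t * n'" if "\<gamma> \<in> roots" "\<gamma> ! 1 > 0" for \<gamma> u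
    using root_commutator[OF assms(1) _ that(2) l assms(4)] tab[OF that] by blast
  show "\<exists>n'\<in>genm LS. re \<gamma> u * re \<beta> t = re \<beta> t * n'" if \<gamma>: "\<gamma> \<in> roots" "\<gamma> ! 1 < 0" for \<gamma> u
  proof -
    have g: "map uminus \<gamma> \<in> roots" "map uminus \<gamma> ! 1 > 0"
      using roots_neg[OF \<gamma>(1)] \<gamma>(2) is_root_length[OF roots_is_root[OF \<gamma>(1)]] by simp_all
    obtain A where A: "(map uminus \<gamma>, A) \<in> set pos_table" using tab[OF g] by blast
    have "length (map uminus \<beta>) = 6" "map uminus \<beta> ! 1 = 0" using l assms(4) by simp_all
    from root_commutator[OF assms(2) A g(2) this, of u "- t"] obtain n' where
      n': "re (map uminus \<gamma>) u * re (map uminus \<beta>) (- t) = re (map uminus \<beta>) (- t) * n'" "trn n' \<in> genm LS" by blast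
    have tr: "trn (re (map uminus \<delta>) v) = re \<delta> (v :: 'k)" if "is_root \<delta>" for \<delta> v
      unfolding re_def rm_neg[OF that] by simp
    have "re \<beta> (- t) * re \<gamma> u = trn n' * re \<beta> (- t)"
      using arg_cong[OF n'(1), of trn] by (simp add: tr assms(3) roots_is_root[OF \<gamma>(1)])
    then have "re \<beta> t * (re \<beta> (- t) * re \<gamma> u) * re \<beta> t = re \<beta> t * (trn n' * re \<beta> (- t)) * re \<beta> t" by simp
    then have "(re \<beta> t * re \<beta> (- t)) * re \<gamma> u * re \<beta> t = re \<beta> t * trn n' * (re \<beta> (- t) * re \<beta> t)" by (simp only: mult.assoc)
    then show ?thesis using n'(2) re_inverse[OF assms(3), of t] by auto
  qed
qed

lemma levi_normalizes:
  assumes "\<beta> \<in> {e23, e24, e34, e25, e35, e45}" shows "normalizes (re \<beta> (t :: 'k::field))"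
proof (rule re_normalizes)
  show "normal_ok \<beta> (rootL \<beta>) pos_table pos_table" "normal_ok (map uminus \<beta>) (rootL (map uminus \<beta>)) pos_table pos_table"
    using assms normal_ok by auto
  show "is_root \<beta>" "\<beta> ! 1 = 0" using assms named_roots by auto
qed

section \<open>The Levi component of the product over the \<open>\<gamma>\<^sub>i\<close>\<close>

lemma coroot_mat_tor: "i \<in> {1..6} \<Longrightarrow> coroot_mat i t = mat_of (tor (simple_vec (int i)) t)"
proof -
  assume i: "i \<in> {1..6}"
  have "weights ! r ! (i - 1) = prw (simple_vec (int i)) (weights ! r)" if r: "r < 27" for r
  proof -
    obtain a b c d e f where w: "weights ! r = [a, b, c, d, e, f]" using length_6[OF weights_length(2)[OF r]] .
    have "i = 1 \<or> i = 2 \<or> i = 3 \<or> i = 4 \<or> i = 5 \<or> i = 6" using i by auto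
    then show ?thesis by (elim disjE) (simp_all add: w simple_vec_def)
  qed
  then show ?thesis by (intro eq_matI) (simp_all add: coroot_mat_def tor_def mat_of_dg)
qed

text \<open>The lowest degree is -1; there the unipotent factors of \<open>m n' nb\<close> have no effect.\<close>
lemma bottom_block:
  assumes "blk_diag m" "blk_upper n" "blk_lower b" "r < 27" "s < 27" "gr r = - 1" "gr s = - 1"
  shows "ent (m * n * b) r s = ent m r s"
proof -
  have nb: "ent (n * b) k s = (if k = s then 1 else 0)" if k: "k < 27" "gr k = - 1" for k
  proof -
    have "ent (n * b) k s = ent b k s"
    proof (rule ent_upper_mult[OF assms(2) k(1) assms(5)])
      show "gr k \<le> gr s" using k assms(7) by simp
      show "ent b l s = 0" if "l < 27" "gr k > gr l" for l
        using gr_range[OF that(1)] that(2) k(2) by auto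
    qed
    then show ?thesis using assms(3,5,7) k by (simp add: blk_lower_def)
  qed
  have "ent (m * (n * b)) r s = (\<Sum>l<27. if l = s then ent m r s else 0)"
    unfolding ent_mult[OF assms(4,5)]
  proof (rule sum.cong[OF HOL.refl])
    fix l :: nat assume l: "l \<in> {..<27}"
    show "ent m r l * ent (n * b) l s = (if l = s then ent m r s else 0)"
    proof (cases "ent m r l = 0")
      case False
      then have "gr l = - 1" using assms(1,4,6) l by (auto simp: blk_diag_def)
      then show ?thesis using nb[of l] l by simp
    qed auto
  qed
  then show ?thesis using assms(5) by (simp add: mult.assoc)
qed

text \<open>
  The relations of a root vector \<open>F\<close> of a root that has pairing -1 with the coroot of \<open>\<beta>\<close>, where \<open>A\<close> is the
  root vector of \<open>\<beta>\<close>. The representative of the reflection at \<open>\<beta>\<close> then sends \<open>F\<close> to a commutator.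
\<close>
definition step_ok :: "sparse \<Rightarrow> sparse \<Rightarrow> bool" where
  "step_ok A F \<longleftrightarrow> valid A \<and> valid F \<and> valid (sptrn A) \<and> spmul (sptrn A) F = [] \<and> spmul F (sptrn A) = [] \<and>
     spmul A (spmul F A) = [] \<and> spadd (spmul (sptrn A) (spmul A F)) (spmul F (spmul A (sptrn A))) = F"

definition bracket :: "sparse \<Rightarrow> sparse \<Rightarrow> sparse" where
  "bracket A F = spadd (spmul A F) (spneg (spmul F A))"

lemma weyl_step:
  assumes "is_root \<beta>" "step_ok (rootL \<beta>) F" "a * a = (1 :: 'k::field)"
  shows "re \<beta> a * re (map uminus \<beta>) (- a) * re \<beta> a * sp F = scl a (sp (bracket (rootL \<beta>) F)) * (re \<beta> a * re (map uminus \<beta>) (- a) * re \<beta> a)"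
proof -
  let ?A = "rm \<beta> :: 'k m27" let ?B = "trn ?A" let ?F = "sp F :: 'k m27"
  from assms(2) have v: "valid (rootL \<beta>)" "valid F" "valid (sptrn (rootL \<beta>))"
    and s: "spmul (sptrn (rootL \<beta>)) F = []" "spmul F (sptrn (rootL \<beta>)) = []" "spmul (rootL \<beta>) (spmul F (rootL \<beta>)) = []"
      "spadd (spmul (sptrn (rootL \<beta>)) (spmul (rootL \<beta>) F)) (spmul F (spmul (rootL \<beta>) (sptrn (rootL \<beta>)))) = F"
    by (simp_all add: step_ok_def)
  have BF: "?B * ?F = 0" "?F * ?B = 0" and AFA: "?A * (?F * ?A) = 0" and F: "?B * (?A * ?F) + ?F * (?A * ?B) = ?F"
    using arg_cong[OF s(1), of "sp :: _ \<Rightarrow> 'k m27"] arg_cong[OF s(2), of "sp :: _ \<Rightarrow> 'k m27"]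
      arg_cong[OF s(3), of "sp :: _ \<Rightarrow> 'k m27"] arg_cong[OF s(4), of "sp :: _ \<Rightarrow> 'k m27"]
    by (simp_all add: rm_def sp_mult v sp_Nil sp_trn sp_add)
  have Z: "sp (bracket (rootL \<beta>) F) = ?A * ?F - ?F * ?A"
    by (simp add: bracket_def rm_def sp_mult v sp_add sp_neg)
  have BFZ: "?B * (?F * Z) = 0" "?F * (?B * Z) = 0" "?A * (?F * (?A * Z)) = 0" for Z
  proof -
    show "?B * (?F * Z) = 0" "?F * (?B * Z) = 0" by (simp_all add: mult.assoc[symmetric] BF)
    have "?A * (?F * (?A * Z)) = ?A * (?F * ?A) * Z" by (simp only: mult.assoc)
    then show "?A * (?F * (?A * Z)) = 0" by (simp add: AFA)
  qed
  have a: "a * (a * z) = z" for z using assms(3) by (simp add: mult.assoc[symmetric])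
  have w: "re \<beta> a * re (map uminus \<beta>) (- a) * re \<beta> a = 1 + scl a ?A - scl a ?B - ?A * ?B - ?B * ?A"
    unfolding re_def rm_neg[OF assms(1)]
    by (simp only: ring_normal rm_sl2[OF assms(1)], rule m27_eqI, simp add: algebra_simps a assms(3))
  have BAF: "?B * (?A * ?F) = ?F - ?F * (?A * ?B)" using F by (simp add: algebra_simps)
  have AFAl: "?A * (?F * ?A) = 0" by (rule AFA)
  show ?thesis
    unfolding w Z
    by (simp only: ring_normal rm_sl2[OF assms(1)] BF BFZ AFAl BAF, rule m27_eqI, simp add: algebra_simps assms(3))
qed

text \<open>
  The chain of commutators in the second condition of \<open>adapted_signs\<close>, from \<open>- \<gamma>\<^sub>0\<close> through
  \<open>\<gamma>\<^sub>5 - \<gamma>\<^sub>0\<close> and so on to \<open>\<gamma>\<^sub>0\<close>, and the single reflection in the first one.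
\<close>
lemma adapted_checks:
  "relabel (rootL (simple_vec 2)) (rootL g1) = rootL g0"
  "(let L0 = rootL n0; L1 = bracket (rootL g5) L0; L2 = bracket (rootL g4) L1; L3 = bracket (rootL g3) L2 in
     step_ok (rootL g5) L0 \<and> step_ok (rootL g4) L1 \<and> step_ok (rootL g3) L2 \<and> step_ok (rootL g2) L3 \<and>
     bracket (rootL g2) L3 = rootL g0)"
  by code_simp+

lemma valid_root: "is_root \<beta> \<Longrightarrow> valid (rootL \<beta>)"
  using table_ok by (auto simp: list_all_iff rootL_pos rootL_neg elim!: is_root_cases)

lemma gamma_simps: "gamma 0 = g0" "gamma (Suc 0) = g1" "gamma 2 = g2" "gamma 3 = g3" "gamma 4 = g4" "gamma 5 = g5"
  by (simp_all add: gamma_def)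

lemma named_in_roots: "\<beta> \<in> {g0, g1, g2, g3, g4, g5, n0, n1, n5, d2, d3, d4, e23, e24, e34, e25, e35, e45} \<Longrightarrow> \<beta> \<in> roots"
  using named_roots by (auto simp: roots_eq)

context chevalley
begin

lemma subgroups: "levi x = generate E6 (mat_of ` MS)" "unip_rad x = generate E6 (mat_of ` NS)"
    "opp_unip_rad x = generate E6 (mat_of ` LS)"
proof -
  have g: "{x \<beta> t |\<beta> t. \<beta> \<in> roots \<and> P \<beta>} = mat_of ` {re \<beta> t |\<beta> t. \<beta> \<in> roots \<and> P \<beta>}" for P
  proof (intro equalityI subsetI)
    fix y assume "y \<in> {x \<beta> t |\<beta> t. \<beta> \<in> roots \<and> P \<beta>}"
    then obtain \<beta> t where y: "y = x \<beta> t" "\<beta> \<in> roots" "P \<beta>" by blast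
    then show "y \<in> mat_of ` {re \<beta> t |\<beta> t. \<beta> \<in> roots \<and> P \<beta>}" using sg(2)[OF y(2), of t] by blast
  next
    fix y :: "'k mat" assume "y \<in> mat_of ` {re \<beta> t |\<beta> t. \<beta> \<in> roots \<and> P \<beta>}"
    then obtain \<beta> t where y: "y = mat_of (re \<beta> t)" "\<beta> \<in> roots" "P \<beta>" by blast
    then show "y \<in> {x \<beta> t |\<beta> t. \<beta> \<in> roots \<and> P \<beta>}" using re_x[OF y(2), of t] by blast
  qed
  have t: "{coroot_mat i t |i t. i \<in> {1..6} \<and> t \<noteq> (0::'k)} = mat_of ` {tor (simple_vec (int i)) t |i t. i \<in> {1..6} \<and> t \<noteq> 0}"
  proof (intro equalityI subsetI)
    fix y :: "'k mat" assume "y \<in> {coroot_mat i t |i t. i \<in> {1..6} \<and> t \<noteq> 0}"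
    then obtain i t where y: "y = coroot_mat i t" "i \<in> {1..6}" "t \<noteq> 0" by blast
    show "y \<in> mat_of ` {tor (simple_vec (int i)) t |i t. i \<in> {1..6} \<and> t \<noteq> 0}"
      unfolding y(1) coroot_mat_tor[OF y(2)] using y(2,3) by blast
  next
    fix y :: "'k mat" assume "y \<in> mat_of ` {tor (simple_vec (int i)) t |i t. i \<in> {1..6} \<and> t \<noteq> 0}"
    then obtain i t where y: "y = mat_of (tor (simple_vec (int i)) t)" "i \<in> {1..6}" "t \<noteq> 0" by blast
    show "y \<in> {coroot_mat i t |i t. i \<in> {1..6} \<and> t \<noteq> 0}"
      unfolding y(1) coroot_mat_tor[OF y(2), symmetric] using y(2,3) by blast
  qed
  show "levi x = generate E6 (mat_of ` MS)" "unip_rad x = generate E6 (mat_of ` NS)"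
    "opp_unip_rad x = generate E6 (mat_of ` LS)"
    unfolding levi_def unip_rad_def opp_unip_rad_def MS_def NS_def LS_def g t image_Un by simp_all
qed

lemma levi_genm: "mat_of m \<in> levi x \<longleftrightarrow> m \<in> genm MS"
  by (simp add: subgroups genm_def)

lemma is_M_component_iff:
  assumes "W \<in> EE"
  shows "is_M_component x (mat_of W) (mat_of n) (mat_of m) \<longleftrightarrow>
    m \<in> genm MS \<and> (\<exists>n'\<in>genm NS. \<exists>b\<in>genm LS. minv W * n = m * n' * b)"
proof -
  have 1: "(\<exists>n'\<in>unip_rad x. Q n') \<longleftrightarrow> (\<exists>n'\<in>genm NS. Q (mat_of n'))" for Q
    using genm_mat_of[OF gens_EE(2)] unfolding subgroups by (auto simp: genm_def)
  have 2: "(\<exists>n'\<in>opp_unip_rad x. Q n') \<longleftrightarrow> (\<exists>n'\<in>genm LS. Q (mat_of n'))" for Q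
    using genm_mat_of[OF gens_EE(3)] unfolding subgroups by (auto simp: genm_def)
  show ?thesis
    unfolding is_M_component_def 1 2 levi_genm minv(1)[OF assms, symmetric] times_m27.rep_eq[symmetric] mat_of_inject ..
qed

lemma M_component_unique:
  assumes "W \<in> EE" "is_M_component x (mat_of W) (mat_of n) m" "is_M_component x (mat_of W) (mat_of n) m'"
  shows "m = m'"
proof -
  have "m \<in> levi x" "m' \<in> levi x" using assms by (auto simp: is_M_component_def)
  then obtain A A' where A: "m = mat_of A" "m' = mat_of A'"
    using genm_mat_of[OF gens_EE(1)] unfolding subgroups by metis
  then show ?thesis
    using assms(2,3) unfolding A is_M_component_iff[OF assms(1)] by (metis decomposition_unique)
qed

abbreviation "s0 \<equiv> sg g0"
abbreviation "s1 \<equiv> sg g1"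
abbreviation "s2 \<equiv> sg g2"
abbreviation "s3 \<equiv> sg g3"
abbreviation "s4 \<equiv> sg g4"

lemma weyl_rep_re: "\<beta> \<in> roots \<Longrightarrow> weyl_rep x \<beta> = mat_of (re \<beta> (sg \<beta>) * re (map uminus \<beta>) (- sg \<beta>) * re \<beta> (sg \<beta>))"
  by (simp add: weyl_rep_def neg_root_def sg(2) roots_neg sg_neg times_m27.rep_eq)

text \<open>
  In the table the signs of the two conjugations are positive (\<open>adapted_checks\<close>), so that the conditions
  compare the signs of the given Chevalley system with each other.
\<close>
lemma adapted:
  assumes "adapted_signs x"
  shows "s1 = s0" "s2 * s3 * s4 = 1" "sg g5 = 1"
proof -
  have g5: "g5 = simple_vec (int 2)" by (simp add: simple_vec_def)
  show s5: "sg g5 = 1" unfolding g5 by (rule sg_simple) simp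
  note R = named_in_roots
  have r: "is_root g0" "is_root g1" "is_root g2" "is_root g3" "is_root g4" "is_root g5" "is_root n0"
    using named_roots by simp_all
  have "conj_E6 (weyl_rep x (gamma 5)) (x (gamma 1) 1) = x (gamma 0) 1"
    using assms by (simp add: adapted_signs_def)
  moreover have "weyl_rep x (gamma 5) = mat_of (nmat 2)"
    using weyl_rep_simple[of 2] simple_root_vec[of 2] by (simp add: gamma_simps simple_vec_def)
  moreover have "minv (nmat 2) = (trn (nmat 2) :: 'k m27)" by (rule minv_nmat) simp
  ultimately have 1: "nmat 2 * re g1 s1 * trn (nmat 2) = re g0 s0"
    using sg(2)[OF R[of g1], of 1] sg(2)[OF R[of g0], of 1]
    by (simp add: gamma_simps conj_E6_m27 nmat_EE mat_of_inject)
  have "nmat 2 * rm g1 * trn (nmat 2) = (rm g0 :: 'k m27)"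
    using conj_sparse[OF valid_root[OF r(2)], of 2] adapted_checks(1) by (simp add: rm_def)
  then have "nmat 2 * re g1 s1 * trn (nmat 2) = re g0 s1"
    by (simp add: re_def distrib_left distrib_right nmat_eq(2))
  with 1 have "re g0 s0 = re g0 s1" by (rule trans[OF sym])
  then have "s0 = s1" by (simp only: re_inject[OF r(1)])
  then show "s1 = s0" by (rule sym)
  define w where "w \<beta> = re \<beta> (sg \<beta>) * re (map uminus \<beta>) (- sg \<beta>) * re \<beta> (sg \<beta>)" for \<beta>
  have wE: "w \<beta> \<in> EE" if "\<beta> \<in> roots" for \<beta>
    unfolding w_def by (intro EE_mult roots_EE that roots_neg)
  let ?w = "w g2 * (w g3 * (w g4 * w g5))"
  have wE': "?w \<in> EE" by (intro EE_mult wE R) simp_all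
  have "conj_E6 (weyl_rep x (gamma 2) * weyl_rep x (gamma 3) * weyl_rep x (gamma 4) * weyl_rep x (gamma 5))
      (x (neg_root (gamma 0)) 1) = x (gamma 0) 1"
    using assms by (simp add: adapted_signs_def)
  moreover have "weyl_rep x (gamma 2) * weyl_rep x (gamma 3) * weyl_rep x (gamma 4) * weyl_rep x (gamma 5) = mat_of ?w"
    unfolding gamma_simps using R by (simp add: weyl_rep_re w_def times_m27.rep_eq[symmetric] mult.assoc)
  moreover have "x (neg_root (gamma 0)) 1 = mat_of (re n0 s0)"
    using sg(2)[OF R[of n0], of 1] sg_neg[OF R[of g0]] by (simp add: gamma_simps neg_root_def)
  ultimately have "?w * re n0 s0 * minv ?w = re g0 s0"
    using sg(2)[OF R[of g0], of 1] by (simp add: gamma_simps conj_E6_m27[OF wE'] mat_of_inject)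
  from arg_cong[OF this, of "\<lambda>Z. Z * ?w"] have 2: "?w * re n0 s0 = re g0 s0 * ?w"
    using minv(4)[OF wE'] by (simp add: mult.assoc)
  let ?L0 = "rootL n0" let ?L1 = "bracket (rootL g5) ?L0" let ?L2 = "bracket (rootL g4) ?L1" let ?L3 = "bracket (rootL g3) ?L2"
  have ok: "step_ok (rootL g5) ?L0" "step_ok (rootL g4) ?L1" "step_ok (rootL g3) ?L2" "step_ok (rootL g2) ?L3"
    and last: "bracket (rootL g2) ?L3 = rootL g0"
    using adapted_checks(2) unfolding Let_def by blast+
  have st: "w \<beta> * (sp F * Z) = scl (sg \<beta>) (sp (bracket (rootL \<beta>) F) * (w \<beta> * Z))"
    if "is_root \<beta>" "step_ok (rootL \<beta>) F" "sg \<beta> * sg \<beta> = 1" for \<beta> F Z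
  proof -
    have "w \<beta> * (sp F * Z) = w \<beta> * sp F * Z" by (simp only: mult.assoc)
    also have "w \<beta> * sp F = scl (sg \<beta>) (sp (bracket (rootL \<beta>) F)) * w \<beta>"
      unfolding w_def by (rule weyl_step[OF that])
    finally show ?thesis by (simp only: mult.assoc scl_simps)
  qed
  have sq: "sg \<beta> * sg \<beta> = 1" if "\<beta> \<in> {g2, g3, g4, g5}" for \<beta> by (rule sg(3)[OF R]) (use that in auto)
  have "?w * rm n0 = w g2 * (w g3 * (w g4 * (w g5 * (sp ?L0 * 1))))" by (simp only: rm_def mult.assoc mult_1_right)
  also have "w g5 * (sp ?L0 * 1) = sp ?L1 * w g5"
    using st[OF r(6) ok(1), of 1] s5 by simp
  also have "w g4 * (sp ?L1 * w g5) = scl s4 (sp ?L2 * (w g4 * w g5))" by (rule st[OF r(5) ok(2) sq]) simp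
  also have "w g3 * \<dots> = scl s4 (scl s3 (sp ?L3 * (w g3 * (w g4 * w g5))))"
    unfolding scl_simps(6) by (subst st[OF r(4) ok(3) sq]) simp_all
  also have "w g2 * \<dots> = scl s4 (scl s3 (scl s2 (rm g0 * ?w)))"
    unfolding scl_simps(6) by (subst st[OF r(3) ok(4) sq]) (simp_all only: last rm_def insert_iff simp_thms)
  also have "\<dots> = scl (s2 * s3 * s4) (rm g0) * ?w" by (simp add: mult_ac)
  finally have "?w * rm n0 = scl (s2 * s3 * s4) (rm g0) * ?w" .
  then have "?w * re n0 s0 = re g0 (s0 * (s2 * s3 * s4)) * ?w"
    by (simp add: re_def distrib_left distrib_right)
  with 2 have "re g0 s0 * (?w * minv ?w) = re g0 (s0 * (s2 * s3 * s4)) * (?w * minv ?w)"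
    by (simp only: mult.assoc[symmetric])
  then have "re g0 s0 = re g0 (s0 * (s2 * s3 * s4))" by (simp only: minv(3)[OF wE'] mult_1_right)
  then have "s0 = s0 * (s2 * s3 * s4)" by (simp only: re_inject[OF r(1)])
  then have "s0 * s0 = s0 * s0 * (s2 * s3 * s4)" by (simp add: mult.assoc)
  then show "s2 * s3 * s4 = 1" using sg(3)[OF R[of g0]] by simp
qed


text \<open>
  The factors of degree 0 in \<open>big_cell\<close>, after the torus element of \<open>\<gamma>\<^sub>0\<close>, with \<open>u = s\<^sub>0 / c\<^sub>0\<close>.
\<close>
definition levi_part :: "'k vec \<Rightarrow> 'k m27" where
  "levi_part c = tor g0 (inverse (c $ 0)) *
     (re e23 (s0 * s2 * s3 * (c $ 2 * c $ 3 / c $ 0)) * (re e24 (s0 * s2 * s4 * (c $ 2 * c $ 4 / c $ 0)) *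
     (re e34 (- (s0 * s3 * s4 * (c $ 3 * c $ 4 / c $ 0))) * (tor g5 (c $ 0 * c $ 0 / quartic c) *
     (re e25 (- (s0 * s2 * (c $ 2 * c $ 5 / c $ 0))) * (re e35 (s0 * s3 * (c $ 3 * c $ 5 / c $ 0)) *
      re e45 (s0 * s4 * (c $ 4 * c $ 5 / c $ 0))))))))"

text \<open>The representative of the reflection at \<open>\<gamma>\<^sub>0\<close>.\<close>
definition w0' :: "'k m27" where
  "w0' = re g0 s0 * re n0 (- s0) * re g0 s0"

lemma w0'_EE: "w0' \<in> EE"
  unfolding w0'_def by (intro EE_mult roots_EE named_in_roots) simp_all

lemma minv_w0': "minv w0' = re g0 (- s0) * re n0 s0 * re g0 (- s0)"
proof (rule minv_eqI[OF w0'_EE])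
  have r: "is_root g0" "is_root n0" using named_roots by simp_all
  have i: "re g0 s0 * (re g0 (- s0) * Z) = Z" "re n0 (- s0) * (re n0 s0 * Z) = Z" for Z
    using re_inverse[OF r(1), of s0] re_inverse[OF r(2), of s0] by (simp_all add: mult.assoc[symmetric])
  show "w0' * (re g0 (- s0) * re n0 s0 * re g0 (- s0)) = 1"
    unfolding w0'_def by (simp add: mult.assoc i re_inverse[OF r(1)])
qed

definition gprod :: "'k vec \<Rightarrow> 'k m27" where
  "gprod c = re g0 (s0 * c $ 0) * (re g1 (s1 * c $ 1) * (re g2 (s2 * c $ 2) * (re g3 (s3 * c $ 3) *
     (re g4 (s4 * c $ 4) * re g5 (sg g5 * c $ 5)))))"

lemma gamma_prod_gprod: "gamma_prod x c = mat_of (gprod c)"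
proof -
  have "[0..<6] = [0, 1, 2, 3, 4, 5]" by (simp add: upt_conv_Cons)
  moreover have "x \<beta> t = mat_of (re \<beta> (sg \<beta> * t))" if "\<beta> \<in> {g0, g1, g2, g3, g4, g5}" for \<beta> t
    by (rule sg(2)[OF named_in_roots]) (use that in auto)
  ultimately show ?thesis
    by (simp add: gamma_prod_def gamma_simps gprod_def times_m27.rep_eq[symmetric] one_m27.rep_eq[symmetric])
qed

lemma levi_part_MM:
  assumes "c $ 0 \<noteq> 0" "quartic c \<noteq> 0" shows "levi_part c \<in> genm MS"
proof -
  have R: "re \<beta> t \<in> genm MS" if "\<beta> \<in> {e23, e24, e34, e25, e35, e45}" for \<beta> and t :: 'k
  proof (rule genm_incl)
    have "\<beta> \<in> roots" by (rule named_in_roots) (use that in auto)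
    moreover have "\<beta> ! 1 = 0" using that by auto
    ultimately show "re \<beta> t \<in> MS" unfolding MS_def by blast
  qed
  then show ?thesis
    unfolding levi_part_def by (intro genm_mult tor_g0 tor_g5 R) (use assms in simp_all)
qed

lemma normalizes_NS: "normalizes A \<Longrightarrow> n \<in> genm NS \<Longrightarrow> \<exists>n'\<in>genm NS. \<forall>Z. n * (A * Z) = A * (n' * Z)"
  unfolding normalizes_def by (metis mult.assoc)

lemma normalizes_LS: "normalizes A \<Longrightarrow> n \<in> genm LS \<Longrightarrow> \<exists>n'\<in>genm LS. \<forall>Z. n * (A * Z) = A * (n' * Z)"
  unfolding normalizes_def by (metis mult.assoc)

text \<open>
  The torus and the root elements of degree 0 in \<open>big_cell\<close> normalize both unipotent radicals. So they are
  moved to the left of all factors of positive degree, and those of negative degree to the right.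
\<close>
lemma M_component_exists:
  assumes "adapted_signs x" and c: "c $ 0 \<noteq> 0" "quartic c \<noteq> 0"
  shows "\<exists>n'\<in>genm NS. \<exists>b\<in>genm LS. minv w0' * gprod c = levi_part c * n' * b"
proof -
  note ad = adapted[OF assms(1)]
  have NN: "re \<beta> t \<in> genm NS" if "\<beta> \<in> {g0, g1, g2, g3, g4, g5}" for \<beta> and t :: 'k
  proof (rule genm_incl)
    have "\<beta> \<in> roots" by (rule named_in_roots) (use that in auto)
    moreover have "\<beta> ! 1 > 0" using that by auto
    ultimately show "re \<beta> t \<in> NS" unfolding NS_def by blast
  qed
  have LL: "re \<beta> t \<in> genm LS" if "\<beta> \<in> {n0, n1, n5, d2, d3, d4}" for \<beta> and t :: 'k
  proof (rule genm_incl)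
    have "\<beta> \<in> roots" by (rule named_in_roots) (use that in auto)
    moreover have "\<beta> ! 1 < 0" using that by auto
    ultimately show "re \<beta> t \<in> LS" unfolding LS_def by blast
  qed
  have sq: "s0 * s0 = 1" "s2 * s2 = 1" "s3 * s3 = 1" "s4 * s4 = 1" using sg(3)[OF named_in_roots] by simp_all
  define u where "u = s0 / c $ 0"
  define t1 t2 t3 t4 t5 where "t1 = s1 * c $ 1" and "t2 = s2 * c $ 2" and "t3 = s3 * c $ 3" and "t4 = s4 * c $ 4" and "t5 = c $ 5"
  define b where "b = - (u * t1) - u * u * t2 * t3 * t4"
  define d where "d = 1 + b * t5"
  have "u * u = 1 / (c $ 0 * c $ 0)" using sq by (simp add: u_def)
  moreover have "t2 * t3 * t4 = (s2 * s3 * s4) * (c $ 2 * c $ 3 * c $ 4)" by (simp add: t2_def t3_def t4_def mult_ac)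
  then have "t2 * t3 * t4 = c $ 2 * c $ 3 * c $ 4" unfolding ad(2) by simp
  moreover have "u * t1 = c $ 1 / c $ 0" using sq ad(1) by (simp add: u_def t1_def mult.assoc[symmetric])
  ultimately have bq: "b = - (c $ 1 / c $ 0) - (c $ 2 * c $ 3 * c $ 4) / (c $ 0 * c $ 0)"
    unfolding b_def by (simp add: mult.assoc)
  have d: "d = quartic c / (c $ 0 * c $ 0)"
    unfolding d_def t5_def quartic_def bq using c(1) by (simp add: field_simps)
  have d0: "d \<noteq> 0" "inverse d = c $ 0 * c $ 0 / quartic c" using c by (simp_all add: d)
  have r0: "is_root g0" using named_roots by simp
  have h0: "sl2_tor g0 (inverse (c $ 0)) = tor g0 (inverse (c $ 0))"
  proof (rule sl2_tor_eq)
    show "(g0, rootL g0) \<in> set pos_table" by code_simp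
    show "diag_ok g0" using diag_ok by simp
  qed (use c in simp)
  let ?R = "re g1 t1 * (re g2 t2 * (re g3 t3 * (re g4 t4 * re g5 t5)))"
  have "minv w0' * gprod c = minv w0' * re g0 (s0 * c $ 0) * ?R"
    by (simp add: gprod_def t1_def t2_def t3_def t4_def t5_def ad(3) mult.assoc)
  also have "minv w0' * re g0 (s0 * c $ 0) = re g0 (- u) * tor g0 (inverse (c $ 0)) * re n0 u"
    using sl2_weyl[OF r0 sq(1) c(1)] by (simp add: minv_w0' h0 u_def)
  finally have 1: "minv w0' * gprod c = re g0 (- u) * (tor g0 (inverse (c $ 0)) * (re n0 u * ?R))"
    by (simp only: mult.assoc)
  have p: "u * t2 * t3 = s0 * s2 * s3 * (c $ 2 * c $ 3 / c $ 0)" "u * t2 * t4 = s0 * s2 * s4 * (c $ 2 * c $ 4 / c $ 0)"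
    "u * t3 * t4 = s0 * s3 * s4 * (c $ 3 * c $ 4 / c $ 0)" "u * t2 * t5 = s0 * s2 * (c $ 2 * c $ 5 / c $ 0)"
    "u * t3 * t5 = s0 * s3 * (c $ 3 * c $ 5 / c $ 0)" "u * t4 * t5 = s0 * s4 * (c $ 4 * c $ 5 / c $ 0)"
    by (simp_all add: u_def t2_def t3_def t4_def t5_def)
  let ?H = "tor g0 (inverse (c $ 0))" let ?h = "tor g5 (inverse d)"
  let ?e1 = "re e23 (u * t2 * t3)" let ?e2 = "re e24 (u * t2 * t4)" let ?e3 = "re e34 (- (u * t3 * t4))"
  let ?f1 = "re e25 (- (u * t2 * t5))" let ?f2 = "re e35 (u * t3 * t5)" let ?f3 = "re e45 (u * t4 * t5)"
  have nrm: "normalizes ?H" "normalizes ?h" "normalizes ?e1" "normalizes ?e2" "normalizes ?e3"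
    "normalizes ?f1" "normalizes ?f2" "normalizes ?f3"
    by (rule tor_normalizes levi_normalizes; use c d0 in simp)+
  obtain m1 where m1: "m1 \<in> genm NS" "\<And>Z. re g0 (- u) * (?H * Z) = ?H * (m1 * Z)"
    using normalizes_NS[OF nrm(1) NN[of g0 "- u"]] by auto
  define m1' where "m1' = m1 * (re g1 t1 * (re g2 t2 * (re g3 t3 * (re g4 t4 * re g1 (- (u * t2 * t3 * t4))))))"
  have m1': "m1' \<in> genm NS" unfolding m1'_def by (intro genm_mult m1 NN) simp_all
  obtain m2 where m2: "m2 \<in> genm NS" "\<And>Z. m1' * (?e1 * Z) = ?e1 * (m2 * Z)" using normalizes_NS[OF nrm(3) m1'] by auto
  obtain m3 where m3: "m3 \<in> genm NS" "\<And>Z. m2 * (?e2 * Z) = ?e2 * (m3 * Z)" using normalizes_NS[OF nrm(4) m2(1)] by auto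
  obtain m4 where m4: "m4 \<in> genm NS" "\<And>Z. m3 * (?e3 * Z) = ?e3 * (m4 * Z)" using normalizes_NS[OF nrm(5) m3(1)] by auto
  obtain m5 where m5: "m5 \<in> genm NS" "\<And>Z. m4 * (?h * Z) = ?h * (m5 * Z)" using normalizes_NS[OF nrm(2) m4(1)] by auto
  have m5': "m5 * re g5 (t5 * d) \<in> genm NS" by (intro genm_mult m5 NN) simp
  obtain m6 where m6: "m6 \<in> genm NS" "\<And>Z. m5 * re g5 (t5 * d) * (?f1 * Z) = ?f1 * (m6 * Z)" using normalizes_NS[OF nrm(6) m5'] by auto
  obtain m7 where m7: "m7 \<in> genm NS" "\<And>Z. m6 * (?f2 * Z) = ?f2 * (m7 * Z)" using normalizes_NS[OF nrm(7) m6(1)] by auto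
  obtain m8 where m8: "m8 \<in> genm NS" "\<And>Z. m7 * (?f3 * Z) = ?f3 * (m8 * Z)" using normalizes_NS[OF nrm(8) m7(1)] by auto
  have dL: "re d2 (u * t2 / d) \<in> genm LS" by (rule LL) simp
  obtain b1 where b1: "b1 \<in> genm LS" "\<And>Z. re d2 (u * t2 / d) * (?f2 * Z) = ?f2 * (b1 * Z)" using normalizes_LS[OF nrm(7) dL] by auto
  have b1': "b1 * re d3 (u * t3 / d) \<in> genm LS" by (intro genm_mult b1 LL) simp
  obtain b2 where b2: "b2 \<in> genm LS" "\<And>Z. b1 * re d3 (u * t3 / d) * (?f3 * Z) = ?f3 * (b2 * Z)" using normalizes_LS[OF nrm(8) b1'] by auto
  define b3 where "b3 = b2 * (re d4 (u * t4 / d) * (re n1 (u * t5) * (re n0 (u / d) * re n5 (b / d))))"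
  have b3: "b3 \<in> genm LS" unfolding b3_def by (intro genm_mult b2 LL) simp_all
  note as = mult.assoc[where 'a = "'k m27"]
  note bc = big_cell[of u t1 t2 t3 t4 t5, folded b_def, folded d_def, OF d0(1)]
  have "minv w0' * gprod c = ?H * (m1' * (?e1 * (?e2 * (?e3 * (?h * (re g5 (t5 * d) *
    (?f1 * (re d2 (u * t2 / d) * (?f2 * (re d3 (u * t3 / d) *
    (?f3 * (re d4 (u * t4 / d) * (re n1 (u * t5) * (re n0 (u / d) * re n5 (b / d)))))))))))))))"
    unfolding 1 bc m1(2) m1'_def by (simp only: mult.assoc)
  also have "\<dots> = ?H * (?e1 * (?e2 * (?e3 * (?h * (?f1 * (?f2 * (?f3 * (m8 * b3))))))))"
    unfolding b3_def
    by (simp only: m2(2) m3(2) m4(2) m5(2) m7(2) m8(2) b1(2) m6(2)[unfolded as] b2(2)[unfolded as] as)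
  also have "\<dots> = levi_part c * m8 * b3"
    unfolding levi_part_def p d0(2) by (simp only: as)
  finally show ?thesis using m8(1) b3 by blast
qed

end

section \<open>The Weyl group on the weights\<close>

text \<open>The \<open>i\<close>-th simple reflection in coordinates with respect to the fundamental weights.\<close>
fun wrefl :: "int \<Rightarrow> int list \<Rightarrow> int list" where
  "wrefl i [a, b, c, d, e, f] =
    (if i = 1 then [- a, b, c + a, d, e, f]
     else if i = 2 then [a, - b, c, d + b, e, f]
     else if i = 3 then [a + c, b, - c, d + c, e, f]
     else if i = 4 then [a, b + d, c + d, - d, e + d, f]
     else if i = 5 then [a, b, c, d + e, - e, f + e]
     else [a, b, c, d, e + f, - f])"
| "wrefl i _ = []"

lemma length_wrefl: "length v = 6 \<Longrightarrow> length (wrefl i v) = 6"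
  by (erule length_6) simp

lemma length_srefl: "length v = 6 \<Longrightarrow> length (srefl i v) = 6"
  by (erule length_6) simp

lemma prw_refl: "length \<beta> = 6 \<Longrightarrow> length v = 6 \<Longrightarrow> prw (srefl i \<beta>) (wrefl i v) = prw \<beta> v"
  by (erule length_6, erule length_6) (simp add: algebra_simps)

definition wact :: "nat list \<Rightarrow> int list \<Rightarrow> int list" where
  "wact ws = foldr (\<lambda>i. wrefl (int i)) ws"

definition sact :: "nat list \<Rightarrow> int list \<Rightarrow> int list" where
  "sact ws = foldr (\<lambda>i. srefl (int i)) ws"

lemma length_act: "length v = 6 \<Longrightarrow> length (wact ws v) = 6" "length v = 6 \<Longrightarrow> length (sact ws v) = 6"
  by (induction ws) (simp_all add: wact_def sact_def length_wrefl length_srefl)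

lemma prw_act: "length \<beta> = 6 \<Longrightarrow> length v = 6 \<Longrightarrow> prw (sact ws \<beta>) (wact ws v) = prw \<beta> v"
  by (induction ws) (simp_all add: wact_def sact_def prw_refl length_act[unfolded wact_def sact_def])

lemma prw_act_adjoint:
  assumes "length v = 6" "length \<beta> = 6" shows "prw \<beta> (wact ws v) = prw (sact (rev ws) \<beta>) v"
  using assms
proof (induction ws arbitrary: \<beta>)
  case (Cons i ws)
  have "prw \<beta> (wact (i # ws) v) = prw (srefl (int i) (srefl (int i) \<beta>)) (wrefl (int i) (wact ws v))"
    by (simp add: wact_def srefl_invol Cons.prems)
  also have "\<dots> = prw (srefl (int i) \<beta>) (wact ws v)"
    by (rule prw_refl) (simp_all add: length_srefl length_act Cons.prems)
  also have "\<dots> = prw (sact (rev ws) (srefl (int i) \<beta>)) v"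
    by (rule Cons.IH) (simp_all add: length_srefl Cons.prems)
  finally show ?case by (simp add: sact_def)
qed (simp add: wact_def sact_def)

lemma weyl_word_sact:
  assumes "set ws \<subseteq> {1..6}" "\<beta> \<in> roots" shows "weyl_word ws \<beta> = sact ws \<beta> \<and> sact ws \<beta> \<in> roots"
  using assms(1)
proof (induction ws)
  case (Cons i ws)
  then have i: "i \<in> {1..6}" and IH: "weyl_word ws \<beta> = sact ws \<beta>" "sact ws \<beta> \<in> roots" by auto
  have "root_refl (simple_root i) (sact ws \<beta>) = srefl (int i) (sact ws \<beta>)"
    by (rule root_refl_simple[OF i is_root_length[OF roots_is_root[OF IH(2)]]])
  then show ?case using IH roots.refl[OF IH(2) i] by (simp add: weyl_word_def sact_def)
qed (simp add: weyl_word_def sact_def assms)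

lemma sact_inj: "length \<beta> = 6 \<Longrightarrow> length \<beta>' = 6 \<Longrightarrow> sact ws \<beta> = sact ws \<beta>' \<Longrightarrow> \<beta> = \<beta>'"
proof (induction ws)
  case (Cons i ws)
  from Cons.prems(3) have "srefl (int i) (srefl (int i) (sact ws \<beta>)) = srefl (int i) (srefl (int i) (sact ws \<beta>'))"
    by (simp add: sact_def)
  then show ?case using Cons by (simp add: srefl_invol length_act)
qed (simp add: sact_def)

lemma prw_neg: "length \<beta> = 6 \<Longrightarrow> length v = 6 \<Longrightarrow> prw (map uminus \<beta>) v = - prw \<beta> v"
  by (erule length_6, erule length_6) simp

text \<open>The longest element permutes the positive roots up to sign, so it negates the sum of their coroots.\<close>
lemma longest_negates:
  assumes "longest_reduced_word J ws" "length v = 6"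
  shows "(\<Sum>\<beta>\<in>pos_roots J. prw \<beta> (wact ws v)) = - (\<Sum>\<beta>\<in>pos_roots J. prw \<beta> v)"
proof -
  let ?P = "pos_roots J"
  have ws: "set ws \<subseteq> {1..6}" and neg: "\<And>\<beta>. \<beta> \<in> ?P \<Longrightarrow> neg_root (weyl_word ws \<beta>) \<in> ?P"
    using assms(1) by (auto simp: longest_reduced_word_def reduced_word_def)
  have "\<beta> \<in> fst ` set pos_table \<union> map uminus ` fst ` set pos_table" if "is_root \<beta>" for \<beta>
    using that uminus_uminus[of \<beta>] unfolding is_root_def by (metis UnI1 UnI2 imageI)
  then have "?P \<subseteq> fst ` set pos_table \<union> map uminus ` fst ` set pos_table"
    unfolding pos_roots_def roots_eq by blast
  then have fin: "finite ?P" by (rule finite_subset) simp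
  define f where "f \<beta> = map uminus (sact ws \<beta>)" for \<beta>
  have l: "length \<beta> = 6" if "\<beta> \<in> ?P" for \<beta> using that is_root_length roots_is_root by (auto simp: pos_roots_def)
  have f: "f \<beta> \<in> ?P" if "\<beta> \<in> ?P" for \<beta>
    using neg[OF that] weyl_word_sact[OF ws] that by (auto simp: f_def neg_root_def pos_roots_def)
  have inj: "inj_on f ?P"
  proof (rule inj_onI)
    fix \<beta> \<beta>' assume b: "\<beta> \<in> ?P" "\<beta>' \<in> ?P" and "f \<beta> = f \<beta>'"
    then have "map uminus (f \<beta>) = map uminus (f \<beta>')" by simp
    then show "\<beta> = \<beta>'" unfolding f_def uminus_uminus using sact_inj l b by blast
  qed
  then have "f ` ?P = ?P" using f fin by (intro endo_inj_surj) auto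
  then have "(\<Sum>\<beta>\<in>?P. prw \<beta> (wact ws v)) = (\<Sum>\<beta>\<in>?P. prw (f \<beta>) (wact ws v))"
    using sum.reindex[OF inj, of "\<lambda>\<beta>. prw \<beta> (wact ws v)"] by simp
  also have "\<dots> = (\<Sum>\<beta>\<in>?P. - prw \<beta> v)"
    unfolding f_def using l assms(2) by (intro sum.cong) (simp_all add: prw_neg prw_act length_act)
  finally show ?thesis by (simp add: sum_negf)
qed

text \<open>The sums of the positive coroots of \<open>G\<close> and of \<open>M\<close>.\<close>
abbreviation "rho2 \<equiv> [16, 22, 30, 42, 30, 16] :: int list"
abbreviation "rhoM2 \<equiv> [5, 0, 8, 9, 8, 5] :: int list"

lemma pos_roots_table: "pos_roots {1..6} = set (map fst pos_table)"
  "pos_roots {1, 3, 4, 5, 6} = set (filter (\<lambda>\<beta>. \<beta> ! 1 = 0) (map fst pos_table))"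
proof -
  have "(\<beta> \<in> roots \<and> (\<forall>b\<in>set \<beta>. 0 \<le> b)) \<longleftrightarrow> \<beta> \<in> fst ` set pos_table" for \<beta>
  proof
    assume b: "\<beta> \<in> roots \<and> (\<forall>b\<in>set \<beta>. 0 \<le> b)"
    then have "is_root \<beta>" using roots_is_root by blast
    then show "\<beta> \<in> fst ` set pos_table"
    proof (cases rule: is_root_cases)
      case (2 \<alpha> L)
      have "list_ex (\<lambda>b. 0 < b) \<alpha>" using table_keys(2) 2(1) by (auto simp: list_all_iff)
      then show ?thesis using b 2(2) by (auto simp: list_ex_iff)
    qed force
  next
    assume "\<beta> \<in> fst ` set pos_table"
    then obtain L where L: "(\<beta>, L) \<in> set pos_table" by auto
    then show "\<beta> \<in> roots \<and> (\<forall>b\<in>set \<beta>. 0 \<le> b)"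
      using table_keys(2) pos_table_roots[OF L] by (auto simp: list_all_iff)
  qed
  then have P: "{\<beta>. \<beta> \<in> roots \<and> (\<forall>b\<in>set \<beta>. 0 \<le> b)} = fst ` set pos_table" by blast
  show "pos_roots {1..6} = set (map fst pos_table)" using P by (simp add: pos_roots_def)
  have "{1..6} - {1, 3, 4, 5, 6} = {2::nat}" by auto
  then show "pos_roots {1, 3, 4, 5, 6} = set (filter (\<lambda>\<beta>. \<beta> ! 1 = 0) (map fst pos_table))"
    using P unfolding pos_roots_def by auto
qed

lemma sum_pos_roots:
  assumes "length v = 6"
  shows "(\<Sum>\<beta>\<in>pos_roots {1..6}. prw \<beta> v) = prw rho2 v"
    "(\<Sum>\<beta>\<in>pos_roots {1, 3, 4, 5, 6}. prw \<beta> v) = prw rhoM2 v"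
proof -
  obtain a b c d e f where v: "v = [a, b, c, d, e, f]" using length_6[OF assms] .
  show "(\<Sum>\<beta>\<in>pos_roots {1..6}. prw \<beta> v) = prw rho2 v"
    unfolding pos_roots_table(1) sum_list_distinct_conv_sum_set[OF table_keys(1), symmetric]
    by (simp add: pos_table_def v)
  show "(\<Sum>\<beta>\<in>pos_roots {1, 3, 4, 5, 6}. prw \<beta> v) = prw rhoM2 v"
    unfolding pos_roots_table(2) sum_list_distinct_conv_sum_set[OF distinct_filter[OF table_keys(1)], symmetric]
    by (simp add: pos_table_def v)
qed

text \<open>
  The 21 positive coroots outside \<open>M\<close> are that of \<open>\<gamma>\<^sub>0\<close> and 10 pairs of which it is the sum.
\<close>
lemma rho_decomp: "length v = 6 \<Longrightarrow> prw rho2 v = prw rhoM2 v + 11 * prw g0 v"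
  by (erule length_6) simp

lemma wact_g0:
  assumes "set ws \<subseteq> {1, 3, 4, 5, 6}" "length v = 6" shows "prw g0 (wact ws v) = prw g0 v"
  using assms(1)
proof (induction ws)
  case (Cons i ws)
  obtain a b c d e f where w: "wact ws v = [a, b, c, d, e, f]" using length_6[OF length_act(1)[OF assms(2)]] .
  have "prw g0 (wrefl (int i) (wact ws v)) = prw g0 (wact ws v)"
    using Cons.prems unfolding w by auto
  then show ?case using Cons by (simp add: wact_def)
qed (simp add: wact_def)

text \<open>The reflection at \<open>\<gamma>\<^sub>0\<close>, which is the second fundamental weight.\<close>
definition refl0 :: "int list \<Rightarrow> int list" where
  "refl0 v = map2 (\<lambda>a c. a - prw g0 v * c) v [0, 1, 0, 0, 0, 0]"

lemma prw_refl0: "length v = 6 \<Longrightarrow> prw rho2 (refl0 v) = prw rhoM2 v - 11 * prw g0 v"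
  by (erule length_6) (simp add: refl0_def)

lemma prw_refl0_adjoint:
  assumes "length \<beta> = 6" shows "\<exists>\<beta>'. length \<beta>' = 6 \<and> (\<forall>v. length v = 6 \<longrightarrow> prw \<beta> (refl0 v) = prw \<beta>' v)"
proof -
  obtain a b c d e f where \<beta>: "\<beta> = [a, b, c, d, e, f]" using length_6[OF assms] .
  show ?thesis
    by (intro exI[of _ "[a - b, - b, c - 2 * b, d - 3 * b, e - 2 * b, f - b]"])
      (auto simp: \<beta> refl0_def algebra_simps elim!: length_6)
qed

section \<open>Monomial matrices\<close>

text \<open>Holds for the matrices that permute the weight spaces by \<open>\<pi>\<close>.\<close>
definition monomial :: "(int list \<Rightarrow> int list) \<Rightarrow> 'k::field m27 \<Rightarrow> bool" where
  "monomial \<pi> A \<longleftrightarrow> (\<forall>r<27. \<forall>s<27. ent A r s \<noteq> 0 \<longrightarrow> weights ! r = \<pi> (weights ! s))"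

definition perm_ok :: "int \<Rightarrow> bool" where
  "perm_ok i = (let L = rootL (simple_vec i); Z = index_weights in
     list_all (\<lambda>(s, v). map_of Z (fst (mv L s)) = Some (wrefl i v)) Z)"

lemma perm_ok: "list_all perm_ok [1, 2, 3, 4, 5, 6]"
  by code_simp

lemma monomial_nmat:
  assumes "i \<in> {1..6}" shows "monomial (wrefl (int i)) (nmat i)"
  unfolding monomial_def
proof (intro allI impI)
  fix r s :: nat assume rs: "r < 27" "s < 27" "ent (nmat i) r s \<noteq> 0"
  have "int i \<in> {1,2,3,4,5,6}" using assms by auto
  then have "perm_ok (int i)" using perm_ok by auto
  then have "map_of index_weights (fst (mv (rootL (simple_vec (int i))) (int s))) = Some (wrefl (int i) (weights ! s))"
    using index_weights_nth[OF rs(2)] unfolding perm_ok_def Let_def list_all_iff by fastforce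
  moreover have "fst (mv (rootL (simple_vec (int i))) (int s)) = int r"
    using rs by (simp add: ent_nmat split: if_splits)
  ultimately show "weights ! r = wrefl (int i) (weights ! s)"
    using index_weights_map_of[OF rs(1)] by simp
qed

lemma ent_mult_nonzero:
  assumes "r < 27" "s < 27" "ent (A * B) r s \<noteq> 0" obtains l where "l < 27" "ent A r l \<noteq> 0" "ent B l s \<noteq> 0"
proof -
  have "\<exists>l<27. ent A r l \<noteq> 0 \<and> ent B l s \<noteq> 0"
  proof (rule ccontr)
    assume "\<not> ?thesis"
    then have "ent (A * B) r s = 0" unfolding ent_mult[OF assms(1,2)] by (intro sum.neutral) auto
    with assms(3) show False by simp
  qed
  then show ?thesis using that by blast
qed

lemma monomial_mult:
  assumes "monomial \<pi> A" "monomial \<rho> B" shows "monomial (\<pi> \<circ> \<rho>) (A * B)"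
  unfolding monomial_def
proof (intro allI impI)
  fix r s :: nat assume rs: "r < 27" "s < 27" "ent (A * B) r s \<noteq> 0"
  then obtain l where "l < 27" "ent A r l \<noteq> 0" "ent B l s \<noteq> 0" by (rule ent_mult_nonzero)
  then show "weights ! r = (\<pi> \<circ> \<rho>) (weights ! s)" using assms rs unfolding monomial_def by simp
qed

definition lift :: "nat list \<Rightarrow> 'k::field m27" where
  "lift ws = foldr (\<lambda>i A. nmat i * A) ws 1"

lemma lift_simps [simp]: "lift [] = 1" "lift (i # ws) = nmat i * lift ws"
  by (simp_all add: lift_def)

lemma lift_EE: "set ws \<subseteq> {1..6} \<Longrightarrow> lift ws \<in> EE"
  by (induction ws) (simp_all add: EE_one EE_mult nmat_EE)

lemma lift_trn: "set ws \<subseteq> {1..6} \<Longrightarrow> lift ws * trn (lift ws) = (1 :: 'k::field m27) \<and> trn (lift ws) * lift ws = (1 :: 'k m27)"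
proof (induction ws)
  case (Cons i ws)
  then have i: "i \<in> {1..6}" and IH: "lift ws * trn (lift ws) = (1 :: 'k m27)" "trn (lift ws) * lift ws = (1 :: 'k m27)" by auto
  have "nmat i * (lift ws * trn (lift ws)) * trn (nmat i) = (1 :: 'k m27)"
    "trn (lift ws) * (trn (nmat i) * nmat i) * lift ws = (1 :: 'k m27)"
    by (simp_all add: IH nmat_eq(2,3)[OF i])
  then show ?case by (simp add: mult.assoc)
qed simp

lemma minv_lift: "set ws \<subseteq> {1..6} \<Longrightarrow> minv (lift ws) = trn (lift ws)"
  using lift_trn by (intro minv_eqI lift_EE) blast+

lemma monomial_lift: "set ws \<subseteq> {1..6} \<Longrightarrow> monomial (wact ws) (lift ws :: 'k::field m27)"
proof (induction ws)
  case Nil then show ?case by (auto simp: monomial_def wact_def split: if_splits)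
next
  case (Cons i ws)
  then have "monomial (wrefl (int i) \<circ> wact ws) (nmat i * lift ws :: 'k m27)"
    by (intro monomial_mult monomial_nmat) simp_all
  then show ?case by (simp add: wact_def o_def)
qed

text \<open>
  Integers lie in \<open>F\<close>, so that multiplication by such a matrix preserves polynomials with
  coefficients in \<open>F\<close>.
\<close>
definition integral :: "'k::field m27 \<Rightarrow> bool" where
  "integral A \<longleftrightarrow> (\<forall>r<27. \<forall>s<27. ent A r s \<in> \<int>)"

lemma integral_simps: "integral A \<Longrightarrow> integral B \<Longrightarrow> integral (A * B)" "integral (sp L)" "integral 1"
    "integral A \<Longrightarrow> integral (trn A)" "integral A \<Longrightarrow> integral B \<Longrightarrow> integral (A + B)"
  by (auto simp: integral_def ent_mult intro!: Ints_sum Ints_mult)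

lemma integral_nmat: "integral (nmat i)"
  unfolding nmat_def by (rule integral_simps)

lemma integral_lift: "integral (lift ws)"
  by (induction ws) (simp_all add: integral_simps integral_nmat)

lemma integral_re: "t \<in> \<int> \<Longrightarrow> integral (re \<beta> t)"
  unfolding re_def rm_def by (auto simp: integral_def intro!: Ints_add Ints_mult)

section \<open>Elements of the group have determinant 1\<close>

lemma upper_ok: "list_all (\<lambda>i. list_all (\<lambda>(r, s, k). r < s) (rootL (simple_vec i))) [1, 2, 3, 4, 5, 6]"
  by code_simp

lemma spent_upper: "list_all (\<lambda>(r, s, k). r < s) L \<Longrightarrow> j \<le> i \<Longrightarrow> spent L i j = 0"
  by (induction L) (auto simp: spent_simps)

text \<open>
  Simple root vectors raise weights, and higher weights are listed first; so the generators are
  unitriangular.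
\<close>
lemma det_simple:
  assumes "i \<in> {1..6}" shows "det (x_simple i t) = 1" "det (x_neg_simple i t) = (1 :: 'k::field)"
proof -
  let ?A = "re (simple_vec (int i)) t"
  have "int i \<in> {1,2,3,4,5,6}" using assms by auto
  then have "list_all (\<lambda>(r, s, k). r < s) (rootL (simple_vec (int i)))" using upper_ok by auto
  then have e: "ent ?A r s = (if r = s then 1 else 0)" if "r < 27" "s \<le> r" for r s
    using spent_upper[of _ s r] that by (simp add: re_def rm_def)
  have "upper_triangular (mat_of ?A)"
    using e carrier_matD(1)[OF mat_of_carrier[of ?A]] unfolding ent.rep_eq by (intro upper_triangularI) simp
  then have "det (mat_of ?A) = prod_list (diag_mat (mat_of ?A))"
    by (rule det_upper_triangular[OF _ mat_of_carrier])
  also have "diag_mat (mat_of ?A) = map (\<lambda>_. 1) [0..<27]"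
    using carrier_matD(1)[OF mat_of_carrier[of ?A]] e unfolding ent.rep_eq by (auto simp: diag_mat_def)
  finally have d: "det (mat_of ?A) = 1" by (simp add: prod_list_replicate map_replicate_const)
  then show "det (x_simple i t) = 1" by (simp only: x_simple_re[OF assms])
  have "x_neg_simple i t = transpose_mat (mat_of ?A)"
    unfolding x_neg_simple_re[OF assms] trn.rep_eq[symmetric] re_def rm_neg[OF is_root_simple[OF assms]] by simp
  then show "det (x_neg_simple i t) = 1"
    using d det_transpose[OF mat_of_carrier[of ?A]] by simp
qed

lemma det_E6: "g \<in> carrier E6 \<Longrightarrow> det g = (1 :: 'k::field)"
proof -
  let ?S = "\<Union>i\<in>{1..6}. range (x_simple i) \<union> range (x_neg_simple i) :: 'k mat set"
  have S: "h \<in> carrier GL27" "det h = 1" if h: "h \<in> ?S" for h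
  proof -
    show "h \<in> carrier GL27" using h E6_generators by blast
    obtain i t where i: "i \<in> {1..6}" and "h = x_simple i t \<or> h = x_neg_simple i t" using h by blast
    then show "det h = 1" using det_simple[OF i, of t] by auto
  qed
  have cm: "h \<in> carrier_mat 27 27" if "h \<in> carrier GL27" for h :: "'k mat"
    using that by (auto simp: GL27_def units_of_def Units_def ring_mat_def)
  interpret GL: group "GL27 :: 'k mat monoid" by (rule GL27_group)
  assume "g \<in> carrier E6"
  then have "g \<in> generate GL27 ?S" by (simp add: E6_def)
  then have "g \<in> carrier GL27 \<and> det g = 1"
  proof (induction rule: generate.induct)
    case one then show ?case using GL.one_closed by (simp add: GL27_simps)
  next
    case (incl h) then show ?case using S by blast
  next
    case (inv h)
    have "inv\<^bsub>GL27\<^esub> h * h = 1\<^sub>m 27" using GL.l_inv[OF S(1)[OF inv]] by (simp add: GL27_simps)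
    then have "det (inv\<^bsub>GL27\<^esub> h) * det h = 1"
      using det_mult[OF cm[OF GL.inv_closed[OF S(1)[OF inv]]] cm[OF S(1)[OF inv]]] by simp
    then show ?case using S[OF inv] by simp
  next
    case (eng h1 h2)
    then show ?case using GL.m_closed[of h1 h2] det_mult[OF cm cm, of h1 h2] by (simp add: GL27_simps)
  qed
  then show ?thesis by simp
qed

section \<open>The representative of the longest coset\<close>

text \<open>
  Conjugation by \<open>A\<close> permutes the root vectors up to sign, written in a form without the inverse.
\<close>
definition permutes_roots :: "'k::field m27 \<Rightarrow> bool" where
  "permutes_roots A \<longleftrightarrow> (\<forall>\<beta>\<in>roots. \<exists>\<beta>'\<in>roots. \<exists>\<epsilon>\<in>{1, - 1}. A * rm \<beta> = scl \<epsilon> (rm \<beta>') * A)"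

lemma permutes_roots_mult:
  assumes "permutes_roots A" "permutes_roots B" shows "permutes_roots (A * B)"
  unfolding permutes_roots_def
proof
  fix \<beta> assume "\<beta> \<in> roots"
  then obtain \<beta>1 \<epsilon>1 where 1: "\<beta>1 \<in> roots" "\<epsilon>1 \<in> {1, - 1}" "B * rm \<beta> = scl \<epsilon>1 (rm \<beta>1) * B"
    using assms(2) unfolding permutes_roots_def by blast
  then obtain \<beta>2 \<epsilon>2 where 2: "\<beta>2 \<in> roots" "\<epsilon>2 \<in> {1, - 1}" "A * rm \<beta>1 = scl \<epsilon>2 (rm \<beta>2) * A"
    using assms(1) unfolding permutes_roots_def by blast
  have "A * B * rm \<beta> = scl \<epsilon>1 (A * rm \<beta>1) * B" by (simp add: mult.assoc 1(3))
  also have "\<dots> = scl (\<epsilon>1 * \<epsilon>2) (rm \<beta>2) * (A * B)" by (simp add: 2(3) mult.assoc)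
  finally have "A * B * rm \<beta> = scl (\<epsilon>1 * \<epsilon>2) (rm \<beta>2) * (A * B)" .
  moreover have "\<epsilon>1 * \<epsilon>2 \<in> {1, - 1}" using 1(2) 2(2) by auto
  ultimately show "\<exists>\<beta>'\<in>roots. \<exists>\<epsilon>\<in>{1, - 1}. A * B * rm \<beta> = scl \<epsilon> (rm \<beta>') * (A * B)" using 2(1) by blast
qed

lemma permutes_roots_nmat:
  assumes "i \<in> {1..6}" shows "permutes_roots (nmat i :: 'k::field m27)" "permutes_roots (trn (nmat i) :: 'k m27)"
proof -
  let ?N = "nmat i :: 'k m27"
  have *: "srefl (int i) \<beta> \<in> roots \<and> (\<exists>\<epsilon>\<in>{1, - 1}. ?N * rm \<beta> = scl \<epsilon> (rm (srefl (int i) \<beta>)) * ?N)" if b: "\<beta> \<in> roots" for \<beta>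
  proof -
    have r: "is_root \<beta>" using roots_is_root[OF b] .
    have "\<exists>\<epsilon>\<in>{1, - 1}. ?N * rm \<beta> * trn ?N = scl \<epsilon> (rm (srefl (int i) \<beta>))"
      using conj_root(2)[OF r assms, where 'k = 'k] by (auto simp del: mult_minus_left mult_minus_right)
    then obtain \<epsilon> where e: "\<epsilon> \<in> {1, - 1}" "?N * rm \<beta> * trn ?N = scl \<epsilon> (rm (srefl (int i) \<beta>))" by blast
    have "?N * rm \<beta> = ?N * rm \<beta> * trn ?N * ?N" by (simp add: mult.assoc nmat_eq(3)[OF assms])
    with e have "?N * rm \<beta> = scl \<epsilon> (rm (srefl (int i) \<beta>)) * ?N" by simp
    then show ?thesis using e(1) conj_root(1)[OF r assms] by (auto simp: roots_eq)
  qed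
  then show "permutes_roots ?N" unfolding permutes_roots_def by blast
  show "permutes_roots (trn ?N)"
    unfolding permutes_roots_def
  proof
    fix \<beta> assume b: "\<beta> \<in> roots"
    let ?b = "srefl (int i) \<beta>"
    have b': "?b \<in> roots" using *[OF b] by blast
    from *[OF b'] obtain \<epsilon> where e: "\<epsilon> \<in> {1, - 1}" "?N * rm ?b = scl \<epsilon> (rm \<beta>) * ?N"
      unfolding srefl_invol[OF is_root_length[OF roots_is_root[OF b]]] by blast
    from arg_cong[OF e(2), of "\<lambda>Z. trn ?N * Z * trn ?N"] have "rm ?b * trn ?N = scl \<epsilon> (trn ?N * rm \<beta>)"
      by (simp add: mult.assoc nmat_eq(2)[OF assms]) (simp add: mult.assoc[symmetric] nmat_eq(3)[OF assms])
    then have "trn ?N * rm \<beta> = scl \<epsilon> (rm ?b) * trn ?N" using e(1) by auto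
    then show "\<exists>\<beta>'\<in>roots. \<exists>\<epsilon>\<in>{1, - 1}. trn ?N * rm \<beta> = scl \<epsilon> (rm \<beta>') * trn ?N" using e(1) b' by blast
  qed
qed

lemma permutes_roots_one: "permutes_roots 1"
  unfolding permutes_roots_def by (intro ballI bexI[of _ 1]) auto

lemma permutes_roots_lift: "set ws \<subseteq> {1..6} \<Longrightarrow> permutes_roots (lift ws)" "set ws \<subseteq> {1..6} \<Longrightarrow> permutes_roots (trn (lift ws))"
  by (induction ws) (simp_all add: permutes_roots_one permutes_roots_mult permutes_roots_nmat)

lemma lift_levi: "set ws \<subseteq> {1, 3, 4, 5, 6} \<Longrightarrow> (lift ws :: 'k::field m27) \<in> genm MS"
proof (induction ws)
  case (Cons i ws)
  then have i: "i \<in> {1, 3, 4, 5, 6}" "i \<in> {1..6}" by auto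
  let ?a = "simple_vec (int i)"
  have a: "?a ! 1 = 0" using i(1) by (auto simp: simple_vec_def)
  have r: "?a \<in> roots" "map uminus ?a \<in> roots" using is_root_simple[OF i(2)] by (simp_all add: roots_eq is_root_neg)
  have "re ?a t \<in> MS" "re (map uminus ?a) t \<in> MS" for t :: 'k
    unfolding MS_def using r a length_simple[of "int i"] by auto
  then have "(nmat i :: 'k m27) \<in> genm MS" unfolding nmat_re[OF i(2)] by (intro genm_mult genm_incl)
  then show ?case using Cons by (simp add: genm_mult)
qed (simp add: genm_one)

definition heights_ok :: bool where
  "heights_ok = (let Z = index_weights in
     list_all (\<lambda>s. case map_of Z s of None \<Rightarrow> False | Some w \<Rightarrow>
       list_all (\<lambda>(r, v). prw rho2 v = prw rho2 w \<longrightarrow> r = s) Z) [0, 1, 2, 3, 23, 24, 25, 26])"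

lemma heights_ok: heights_ok
  by code_simp

lemma distinct_weights: "distinct weights"
  by (simp add: weights_def)

lemma weights_inj: "r < 27 \<Longrightarrow> s < 27 \<Longrightarrow> weights ! r = weights ! s \<Longrightarrow> r = s"
  using distinct_weights weights_length(1) by (simp add: nth_eq_iff_index_eq)

lemma unique_height:
  assumes "r < 27" "s \<in> {0, 1, 2, 3, 23, 24, 25, 26}" "prw rho2 (weights ! r) = prw rho2 (weights ! s)"
  shows "r = s"
proof -
  have s: "s < 27" "int s \<in> set [0, 1, 2, 3, 23, 24, 25, 26]" using assms(2) by auto
  have "list_all (\<lambda>(r, v). prw rho2 v = prw rho2 (weights ! s) \<longrightarrow> r = int s) index_weights"
    using heights_ok s(2) index_weights_map_of[OF s(1)] unfolding heights_ok_def Let_def list_all_iff by fastforce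
  then show ?thesis using index_weights_nth[OF assms(1)] assms(3) by (auto simp: list_all_iff)
qed

lemma prw_unit: "length v = 6 \<Longrightarrow> j < 6 \<Longrightarrow> prw (simple_vec (int (Suc j))) v = v ! j"
proof (erule length_6)
  fix a b c d e f assume v: "v = [a, b, c, d, e, f]" and j: "j < 6"
  have "j = 0 \<or> j = 1 \<or> j = 2 \<or> j = 3 \<or> j = 4 \<or> j = 5" using j by auto
  then show "prw (simple_vec (int (Suc j))) v = v ! j" by (elim disjE) (simp_all add: v simple_vec_def)
qed

lemma weights_explicit: "weights ! 0 = [1, 0, 0, 0, 0, 0]" "weights ! 1 = [-1, 0, 1, 0, 0, 0]" "weights ! 2 = [0, 0, -1, 1, 0, 0]"
    "weights ! 3 = [0, 1, 0, -1, 1, 0]" "weights ! 23 = [0, -1, -1, 1, 0, 0]" "weights ! 24 = [0, 0, 0, -1, 1, 0]"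
    "weights ! 25 = [0, 0, 0, 0, -1, 1]" "weights ! 26 = [0, 0, 0, 0, 0, -1]"
  by (simp_all add: weights_def)

lemma prw_spanning:
  assumes "length \<beta> = 6" "length \<alpha> = 6" "\<And>s. s \<in> {0, 1, 2, 3, 23, 24, 25, 26} \<Longrightarrow> prw \<alpha> (weights ! s) = prw \<beta> (weights ! s)"
  shows "\<alpha> = \<beta>"
proof -
  obtain a b c d e f where b: "\<beta> = [a, b, c, d, e, f]" using length_6[OF assms(1)] .
  obtain a' b' c' d' e' f' where a: "\<alpha> = [a', b', c', d', e', f']" using length_6[OF assms(2)] .
  from assms(3)[of 0] assms(3)[of 1] assms(3)[of 2] assms(3)[of 3] assms(3)[of 23] assms(3)[of 24] assms(3)[of 25] assms(3)[of 26]
  show ?thesis unfolding weights_explicit a b by simp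
qed

text \<open>
  Among the weights there are enough with a height that no other weight has to span the weight lattice.
  A linear map that permutes the weights and preserves heights fixes these, hence all weights.
\<close>
lemma linear_height_identity:
  assumes lin: "\<And>j. j < 6 \<Longrightarrow> \<exists>\<beta>. length \<beta> = 6 \<and> (\<forall>r<27. \<forall>s<27. P r s \<longrightarrow> weights ! r ! j = prw \<beta> (weights ! s))"
    and ht: "\<And>r s. r < 27 \<Longrightarrow> s < 27 \<Longrightarrow> P r s \<Longrightarrow> prw rho2 (weights ! r) = prw rho2 (weights ! s)"
    and ex: "\<And>s. s < 27 \<Longrightarrow> \<exists>r<27. P r s"
    and "r < 27" "s < 27" "P r s"
  shows "r = s"
proof (rule weights_inj[OF assms(4,5)], rule nth_equalityI)
  show "length (weights ! r) = length (weights ! s)" using weights_length assms by simp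
  fix j assume "j < length (weights ! r)"
  then have j: "j < 6" using weights_length assms by simp
  obtain \<beta> where b: "length \<beta> = 6" "\<And>r s. r < 27 \<Longrightarrow> s < 27 \<Longrightarrow> P r s \<Longrightarrow> weights ! r ! j = prw \<beta> (weights ! s)"
    using lin[OF j] by blast
  have "simple_vec (int (Suc j)) = \<beta>"
  proof (rule prw_spanning[OF b(1) length_simple])
    fix s :: nat assume s: "s \<in> {0, 1, 2, 3, 23, 24, 25, 26}"
    then have s27: "s < 27" by auto
    obtain r where r: "r < 27" "P r s" using ex[OF s27] by blast
    have "r = s" by (rule unique_height[OF r(1) s ht[OF r(1) s27 r(2)]])
    then show "prw (simple_vec (int (Suc j))) (weights ! s) = prw \<beta> (weights ! s)"
      using b(2)[OF r(1) s27 r(2)] prw_unit[OF weights_length(2)[OF s27] j] by simp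
  qed
  then show "weights ! r ! j = weights ! s ! j"
    using b(2)[OF assms(4-6)] prw_unit[OF weights_length(2)[OF assms(5)] j] by simp
qed

lemma monomial_trn: "monomial \<pi> A \<Longrightarrow> r < 27 \<Longrightarrow> s < 27 \<Longrightarrow> ent (trn A) r s \<noteq> 0 \<Longrightarrow> weights ! s = \<pi> (weights ! r)"
  unfolding monomial_def by simp

lemma cvec_inj: assumes "length \<beta> = 6" "length \<beta>' = 6" "cvec \<beta> = cvec \<beta>'" shows "\<beta> = \<beta>'"
proof -
  obtain a b c d e f where b: "\<beta> = [a, b, c, d, e, f]" using length_6[OF assms(1)] .
  obtain a' b' c' d' e' f' where b': "\<beta>' = [a', b', c', d', e', f']" using length_6[OF assms(2)] .
  have e: "2 * a - c = 2 * a' - c'" "2 * b - d = 2 * b' - d'" "2 * c - a - d = 2 * c' - a' - d'"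
    "2 * d - b - c - e = 2 * d' - b' - c' - e'" "2 * e - d - f = 2 * e' - d' - f'" "2 * f - e = 2 * f' - e'"
    using assms(3) unfolding b b' cvec.simps list.inject by blast+
  then have "a = a'" "b = b'" "c = c'" "d = d'" "e = e'" "f = f'" by linarith+
  then show ?thesis by (simp add: b b')
qed

lemma map2_cancel: "length v = 6 \<Longrightarrow> length w = 6 \<Longrightarrow> length w' = 6 \<Longrightarrow> map2 (+) v w = map2 (+) v (w' :: int list) \<Longrightarrow> w = w'"
  by (erule length_6, erule length_6, erule length_6) simp

text \<open>
  Every weight but the highest one is obtained by subtraction of a simple root from a weight listed earlier.
\<close>
lemma edges_ok: "list_all (\<lambda>s. list_ex (\<lambda>i. list_ex (\<lambda>(r, s', k). 0 \<le> r \<and> s' = s \<and> spentI (rootL (simple_vec i)) r s = 1) (rootL (simple_vec i))) [1, 2, 3, 4, 5, 6])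
    [1, 2, 3, 4, 5, 6, 7, 8, 9, 10, 11, 12, 13, 14, 15, 16, 17, 18, 19, 20, 21, 22, 23, 24, 25, 26]"
  by code_simp

lemma edge_exists:
  assumes "0 < s" "s < 27"
  obtains i r where "i \<in> {1..6}" "r < s" "ent (rm (simple_vec (int i)) :: 'k::field m27) r s = 1"
proof -
  have "int s \<in> set [1, 2, 3, 4, 5, 6, 7, 8, 9, 10, 11, 12, 13, 14, 15, 16, 17, 18, 19, 20, 21, 22, 23, 24, 25, 26]"
    using assms by simp presburger
  from bspec[OF edges_ok[unfolded list_all_iff] this]
  obtain z r k where z: "z \<in> set [1, 2, 3, 4, 5, 6]" "(r, int s, k) \<in> set (rootL (simple_vec z))" "0 \<le> r"
    "spentI (rootL (simple_vec z)) r (int s) = 1"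
    unfolding list_ex_iff by auto
  have "r < int s" using bspec[OF upper_ok[unfolded list_all_iff] z(1)] z(2) by auto
  then obtain n where n: "r = int n" "n < s" using z(3) by (metis nonneg_int_cases of_nat_less_iff)
  show ?thesis
  proof (rule that[of "nat z" n])
    show "nat z \<in> {1..6}" using z(1) by auto
    have "int (nat z) = z" using z(1) by auto
    then show "ent (rm (simple_vec (int (nat z))) :: 'k m27) n s = 1"
      using z(4) n assms by (simp add: rm_def spent_spentI)
  qed (use n in simp)
qed

text \<open>The entry at the weight \<open>v\<close> of a torus element with the given coordinates.\<close>
definition ptor :: "int list \<Rightarrow> 'k::field \<Rightarrow> 'k \<Rightarrow> 'k \<Rightarrow> 'k \<Rightarrow> 'k \<Rightarrow> 'k \<Rightarrow> 'k" where
  "ptor v a b c d e f = a powi (v ! 0) * b powi (v ! 1) * c powi (v ! 2) * d powi (v ! 3) * e powi (v ! 4) * f powi (v ! 5)"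

lemma powi_shift: "x * x = 1 \<Longrightarrow> x powi (k + 2) = x powi k \<and> x powi (k - 1) = x * x powi (k :: int)" for x :: "'k::field"
proof -
  assume x: "x * x = 1"
  then have "x \<noteq> 0" "inverse x = x" by (auto intro: inverse_unique)
  then show ?thesis using x by (simp add: power_int_add power_int_diff power2_eq_square divide_inverse mult.commute)
qed

lemma ptor_shift:
  assumes "length v = 6" "a * a = 1" "b * b = 1" "c * c = 1" "d * d = 1" "e * e = 1" "f * f = (1 :: 'k::field)"
  shows "ptor (map2 (+) v (cvec (simple_vec 1))) a b c d e f = c * ptor v a b c d e f"
    "ptor (map2 (+) v (cvec (simple_vec 2))) a b c d e f = d * ptor v a b c d e f"
    "ptor (map2 (+) v (cvec (simple_vec 3))) a b c d e f = a * d * ptor v a b c d e f"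
    "ptor (map2 (+) v (cvec (simple_vec 4))) a b c d e f = b * c * e * ptor v a b c d e f"
    "ptor (map2 (+) v (cvec (simple_vec 5))) a b c d e f = d * f * ptor v a b c d e f"
    "ptor (map2 (+) v (cvec (simple_vec 6))) a b c d e f = e * ptor v a b c d e f"
proof -
  obtain v1 v2 v3 v4 v5 v6 where v: "v = [v1, v2, v3, v4, v5, v6]" using length_6[OF assms(1)] .
  note p = powi_shift[OF assms(2)] powi_shift[OF assms(3)] powi_shift[OF assms(4)]
    powi_shift[OF assms(5)] powi_shift[OF assms(6)] powi_shift[OF assms(7)]
  show "ptor (map2 (+) v (cvec (simple_vec 1))) a b c d e f = c * ptor v a b c d e f"
    "ptor (map2 (+) v (cvec (simple_vec 2))) a b c d e f = d * ptor v a b c d e f"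
    "ptor (map2 (+) v (cvec (simple_vec 3))) a b c d e f = a * d * ptor v a b c d e f"
    "ptor (map2 (+) v (cvec (simple_vec 4))) a b c d e f = b * c * e * ptor v a b c d e f"
    "ptor (map2 (+) v (cvec (simple_vec 5))) a b c d e f = d * f * ptor v a b c d e f"
    "ptor (map2 (+) v (cvec (simple_vec 6))) a b c d e f = e * ptor v a b c d e f"
    by (simp_all add: v simple_vec_def ptor_def p)
qed

text \<open>
  Along each edge \<open>\<mu> \<rightarrow> \<mu> + \<alpha>\<^sub>i\<close> of the weight diagram the diagonal entries differ by a sign that depends only
  on \<open>i\<close>. A torus element with the same signs makes the matrix scalar; the scalar is an integer with
  27th power 1, so it is 1.
\<close>
lemma diagonal_in_levi:
  assumes g: "(g :: 'k::field_char_0 m27) \<in> EE" and diag: "\<And>r s. r < 27 \<Longrightarrow> s < 27 \<Longrightarrow> r \<noteq> s \<Longrightarrow> ent g r s = 0"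
    and int: "integral g" and perm: "permutes_roots g"
  shows "g \<in> genm MS"
proof -
  define f where "f r = ent g r r" for r
  have gf: "g = dg f" by (rule m27_eqI) (simp add: diag f_def)
  have f0: "f r \<noteq> 0" if "r < 27" for r
  proof
    assume "f r = 0"
    then have "ent (g * minv g) r r = 0" using that by (simp add: gf)
    then show False using minv(3)[OF g] that by simp
  qed
  have ed: "\<exists>\<eta>\<in>{1, - 1}. \<forall>r<27. \<forall>s<27. ent (rm (simple_vec (int i)) :: 'k m27) r s = 1 \<longrightarrow> f r = \<eta> * f s"
    if i: "i \<in> {1..6}" for i
  proof -
    let ?a = "simple_vec (int i)"
    have a: "?a \<in> roots" "is_root ?a" using is_root_simple[OF i] by (simp_all add: roots_eq)
    obtain \<beta> \<epsilon> where b: "\<beta> \<in> roots" "\<epsilon> \<in> {1, - 1}" "g * rm ?a = scl \<epsilon> (rm \<beta>) * g"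
      using perm a(1) unfolding permutes_roots_def by blast
    have "f r = \<epsilon> * f s" if rs: "r < 27" "s < 27" "ent (rm ?a :: 'k m27) r s = 1" for r s
    proof -
      have e: "ent (g * rm ?a) r s = ent (scl \<epsilon> (rm \<beta>) * g) r s" using b(3) by simp
      have e: "f r = \<epsilon> * ent (rm \<beta>) r s * f s" using e rs by (simp add: gf)
      then have nz: "ent (rm \<beta> :: 'k m27) r s \<noteq> 0" using f0[OF rs(1)] by auto
      have b6: "length \<beta> = 6" by (rule is_root_length[OF roots_is_root[OF b(1)]])
      have nz': "ent (rm ?a :: 'k m27) r s \<noteq> 0" using rs(3) by simp
      have "map2 (+) (weights ! s) (cvec \<beta>) = map2 (+) (weights ! s) (cvec ?a)"
        using rm_shift[OF roots_is_root[OF b(1)] nz rs(1,2)] rm_shift[OF a(2) nz' rs(1,2)] by (rule trans[OF sym])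
      then have "cvec \<beta> = cvec ?a"
        by (rule map2_cancel[OF weights_length(2)[OF rs(2)] length_cvec[OF b6] length_cvec[OF length_simple]])
      then have "\<beta> = ?a" by (rule cvec_inj[OF b6 length_simple])
      then show ?thesis using e rs(3) by simp
    qed
    then show ?thesis using b(2) by blast
  qed
  define \<eta> where "\<eta> i = (SOME e. e \<in> {1, - 1} \<and> (\<forall>r<27. \<forall>s<27. ent (rm (simple_vec (int i)) :: 'k m27) r s = 1 \<longrightarrow> f r = e * f s))" for i
  have \<eta>: "\<eta> i \<in> {1, - 1} \<and> (\<forall>r<27. \<forall>s<27. ent (rm (simple_vec (int i)) :: 'k m27) r s = 1 \<longrightarrow> f r = \<eta> i * f s)"
    if "i \<in> {1..6}" for i
    unfolding \<eta>_def by (rule someI_ex) (use ed[OF that] in blast)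
  have e1: "\<eta> i \<in> {1, - 1}" "\<eta> i \<noteq> 0" if "i \<in> {1..6}" for i using \<eta>[OF that] by auto
  \<comment> \<open>The inverse of the Cartan matrix modulo 2, applied to the signs \<open>\<eta>\<close>.\<close>
  define \<epsilon> :: "nat \<Rightarrow> 'k" where "\<epsilon> = (\<lambda>j. if j = 1 then \<eta> 2 * \<eta> 3 else if j = 2 then \<eta> 1 * \<eta> 4 * \<eta> 6 else if j = 3 then \<eta> 1
    else if j = 4 then \<eta> 2 else if j = 5 then \<eta> 6 else \<eta> 2 * \<eta> 5)"
  have eta: "\<eta> 1 \<in> {1, - 1}" "\<eta> 2 \<in> {1, - 1}" "\<eta> 3 \<in> {1, - 1}" "\<eta> 4 \<in> {1, - 1}" "\<eta> 5 \<in> {1, - 1}" "\<eta> 6 \<in> {1, - 1}"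
    by (rule e1; simp)+
  have sq: "\<eta> 1 * \<eta> 1 = 1" "\<eta> 2 * \<eta> 2 = 1" "\<eta> 3 * \<eta> 3 = 1" "\<eta> 4 * \<eta> 4 = 1" "\<eta> 5 * \<eta> 5 = 1" "\<eta> 6 * \<eta> 6 = 1"
    using eta by auto
  have sq': "\<eta> 1 * (\<eta> 1 * z) = z" "\<eta> 2 * (\<eta> 2 * z) = z" "\<eta> 3 * (\<eta> 3 * z) = z" "\<eta> 4 * (\<eta> 4 * z) = z"
    "\<eta> 5 * (\<eta> 5 * z) = z" "\<eta> 6 * (\<eta> 6 * z) = z" for z
    by (simp_all only: mult.assoc[symmetric] sq mult_1_left)
  have eps_sq: "\<epsilon> j * \<epsilon> j = 1" for j by (simp add: \<epsilon>_def sq sq' mult_ac del: One_nat_def)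
  then have eps0: "\<epsilon> j \<noteq> 0" for j by (metis mult_zero_left zero_neq_one)
  let ?T = "tor (simple_vec 1) (\<epsilon> 1) * (tor (simple_vec 2) (\<epsilon> 2) * (tor (simple_vec 3) (\<epsilon> 3) *
    (tor (simple_vec 4) (\<epsilon> 4) * (tor (simple_vec 5) (\<epsilon> 5) * tor (simple_vec 6) (\<epsilon> 6)))))"
  define T where "T = ?T"
  have TM: "T \<in> genm MS"
  proof -
    have "tor (simple_vec (int i)) (\<epsilon> i) \<in> genm MS" if "i \<in> {1..6}" for i
      by (rule genm_incl) (use that eps0 in \<open>auto simp: MS_def\<close>)
    from this[of 1] this[of 2] this[of 3] this[of 4] this[of 5] this[of 6] show ?thesis
      unfolding T_def by (intro genm_mult) simp_all
  qed
  define t where "t v = ptor v (\<epsilon> 1) (\<epsilon> 2) (\<epsilon> 3) (\<epsilon> 4) (\<epsilon> 5) (\<epsilon> 6)" for v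
  have Tt: "T = dg (\<lambda>r. t (weights ! r))"
  proof (rule m27_eqI)
    fix r s :: nat assume rs: "r < 27" "s < 27"
    note u = prw_unit[OF weights_length(2)[OF rs(1)], of 0] prw_unit[OF weights_length(2)[OF rs(1)], of 1]
      prw_unit[OF weights_length(2)[OF rs(1)], of 2] prw_unit[OF weights_length(2)[OF rs(1)], of 3]
      prw_unit[OF weights_length(2)[OF rs(1)], of 4] prw_unit[OF weights_length(2)[OF rs(1)], of 5]
    show "ent T r s = ent (dg (\<lambda>r. t (weights ! r))) r s"
      using rs u by (cases "r = s") (simp_all add: T_def tor_def dg_mult t_def ptor_def mult.assoc)
  qed
  have step: "t (weights ! r) * f r = t (weights ! s) * f s"
    if rs: "r < 27" "s < 27" and i: "i \<in> {1..6}" and e: "ent (rm (simple_vec (int i)) :: 'k m27) r s = 1" for r s i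
  proof -
    have fr: "f r = \<eta> i * f s" using \<eta>[OF i] rs e by blast
    have sh: "weights ! r = map2 (+) (weights ! s) (cvec (simple_vec (int i)))"
      by (rule rm_shift[OF is_root_simple[OF i], where 'k = 'k]) (use e rs in simp_all)
    have "t (weights ! r) = \<eta> i * t (weights ! s)"
    proof -
      have eps: "\<eta> 1 = \<epsilon> 3" "\<eta> 2 = \<epsilon> 4" "\<eta> 3 = \<epsilon> 1 * \<epsilon> 4" "\<eta> 4 = \<epsilon> 2 * \<epsilon> 3 * \<epsilon> 5" "\<eta> 5 = \<epsilon> 4 * \<epsilon> 6" "\<eta> 6 = \<epsilon> 5"
        by (simp_all add: \<epsilon>_def sq sq' mult_ac del: One_nat_def)
      note ps = ptor_shift[OF weights_length(2)[OF rs(2)] eps_sq[of 1] eps_sq[of 2] eps_sq[of 3] eps_sq[of 4] eps_sq[of 5] eps_sq[of 6]]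
      have "i = 1 \<or> i = 2 \<or> i = 3 \<or> i = 4 \<or> i = 5 \<or> i = 6" using i by auto
      then show ?thesis
        unfolding sh t_def by (elim disjE) (simp_all only: ps eps of_nat_1 of_nat_numeral)
    qed
    moreover have "\<eta> i * \<eta> i = 1" using e1(1)[OF i] by auto
    ultimately show ?thesis using fr by (simp add: mult_ac)
  qed
  define e where "e = t (weights ! 0) * f 0"
  have const: "t (weights ! s) * f s = e" if "s < 27" for s
    using that
  proof (induction s rule: less_induct)
    case (less s)
    show ?case
    proof (cases "s = 0")
      case False
      obtain i r where ir: "i \<in> {1..6}" "r < s" "ent (rm (simple_vec (int i)) :: 'k m27) r s = 1"
        using edge_exists[of s] False less.prems by blast
      then show ?thesis using step[OF _ less.prems ir(1) ir(3)] less.IH[OF ir(2)] less.prems by simp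
    qed (simp add: e_def)
  qed
  have Tg: "T * g = dg (\<lambda>_. e)"
    by (rule m27_eqI) (simp add: Tt gf const)
  have TE: "T \<in> EE" using TM genm_EE[OF gens_EE(1)] by blast
  have "det (mat_of (T * g)) = 1" using det_E6 EE_mult[OF TE g] by (simp add: EE_def)
  moreover have "mat_of (T * g) = e \<cdot>\<^sub>m 1\<^sub>m 27" unfolding Tg mat_of_dg by (intro eq_matI) auto
  ultimately have e27: "e ^ 27 = 1" by simp
  have "e \<in> \<int>"
  proof -
    have "t (weights ! 0) = \<epsilon> 1" by (simp add: t_def ptor_def weights_explicit)
    then have "t (weights ! 0) = \<eta> 2 * \<eta> 3" by (simp add: \<epsilon>_def)
    then have "t (weights ! 0) \<in> \<int>" using eta(2,3) by auto
    moreover have "f 0 \<in> \<int>" using int by (simp add: integral_def f_def)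
    ultimately show ?thesis unfolding e_def by (rule Ints_mult)
  qed
  then obtain z where z: "e = of_int z" by (elim Ints_cases)
  then have z27: "z ^ 27 = 1" using e27 by (metis of_int_eq_1_iff of_int_power)
  have "z dvd z ^ 27" by (rule dvd_power) simp
  then have "\<bar>z\<bar> = 1" unfolding z27 by simp
  then have "z = 1 \<or> z = - 1" by linarith
  then have "z = 1" using z27 by auto
  then have "T * g = 1" unfolding Tg z by (intro m27_eqI) simp
  then have "minv T = g" by (rule minv_eqI[OF TE])
  then show ?thesis using genm_minv[OF gens_EE(1) TM] by simp
qed

lemma refl0_roots: "list_all (\<lambda>(\<beta>, L). let \<beta>' = map2 (\<lambda>b a. b - \<beta> ! 1 * a) \<beta> g0 in
    map_of pos_table \<beta>' \<noteq> None \<or> map_of pos_table (map uminus \<beta>') \<noteq> None) pos_table"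
  by code_simp

lemma root_refl_g0: "\<beta> \<in> roots \<Longrightarrow> root_refl g0 \<beta> \<in> roots"
proof -
  have e: "root_refl g0 \<gamma> = map2 (\<lambda>b a. b - \<gamma> ! 1 * a) \<gamma> g0" if "length \<gamma> = 6" for \<gamma>
    using that by (elim length_6) (simp add: root_refl_def root_pairing_explicit)
  have n: "root_refl g0 (map uminus \<gamma>) = map uminus (root_refl g0 \<gamma>)" if "length \<gamma> = 6" for \<gamma>
    using that by (elim length_6) (simp add: root_refl_def root_pairing_explicit)
  have P: "is_root (root_refl g0 \<gamma>)" if t: "(\<gamma>, L) \<in> set pos_table" for \<gamma> L
  proof -
    have "map_of pos_table (root_refl g0 \<gamma>) \<noteq> None \<or> map_of pos_table (map uminus (root_refl g0 \<gamma>)) \<noteq> None"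
      using bspec[OF refl0_roots[unfolded list_all_iff] t] unfolding e[OF pos_length[OF t]] by (simp add: Let_def)
    then show ?thesis unfolding is_root_def by (simp add: map_of_eq_None_iff)
  qed
  assume "\<beta> \<in> roots"
  then have "is_root \<beta>" by (rule roots_is_root)
  then have "is_root (root_refl g0 \<beta>)"
  proof (cases rule: is_root_cases)
    case (2 \<alpha> L)
    then show ?thesis using P[OF 2(1)] n[OF pos_length[OF 2(1)]] by (simp add: is_root_neg)
  qed (rule P)
  then show ?thesis by (simp add: roots_eq)
qed

context chevalley
begin

lemma w0'_explicit: "w0' = 1 + scl s0 (rm g0) - scl s0 (trn (rm g0)) - rm g0 * trn (rm g0) - trn (rm g0) * rm g0"
proof -
  have r: "is_root g0" using named_roots by simp
  have a: "s0 * s0 = 1" "s0 * (s0 * z) = z" for z using sg(3)[OF named_in_roots[of g0]] by (simp_all add: mult.assoc[symmetric])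
  have n: "n0 = map uminus g0" by simp
  show ?thesis
    unfolding w0'_def n re_def rm_neg[OF r]
    by (simp only: ring_normal rm_sl2[OF r], rule m27_eqI, simp add: algebra_simps a)
qed

lemma w0'_monomial: "monomial refl0 w0'"
  unfolding monomial_def
proof (intro allI impI)
  fix r s :: nat assume rs: "r < 27" "s < 27" and nz: "ent w0' r s \<noteq> 0"
  let ?A = "rm g0 :: 'k m27" let ?p = "\<lambda>r. prw g0 (weights ! r)"
  have r0: "is_root g0" using named_roots by simp
  obtain a b c d e f where w: "weights ! s = [a, b, c, d, e, f]" using length_6[OF weights_length(2)[OF rs(2)]] .
  have p: "?p r \<in> {- 1, 0, 1}" if "r < 27" for r using gr_range[OF that] by (simp add: gr_def)
  have "sl2_tor g0 (- 1) = (tor g0 (- 1) :: 'k m27)"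
  proof (rule sl2_tor_eq)
    show "(g0, rootL g0) \<in> set pos_table" by code_simp
    show "diag_ok g0" using diag_ok by simp
  qed simp
  from arg_cong[OF this, of "\<lambda>Z. ent Z r s"]
  have h: "2 * ((if r = s then 1 else 0) - ent (?A * trn ?A) r s - ent (trn ?A * ?A) r s) = (if r = s then 1 + (- 1) powi ?p r else 0)"
    using rs by (auto simp: sl2_tor_def tor_def algebra_simps)
  have "ent ?A r s \<noteq> 0 \<or> ent ?A s r \<noteq> 0 \<or> (if r = s then 1 else 0) - ent (?A * trn ?A) r s - ent (trn ?A * ?A) r s \<noteq> 0"
    using nz rs unfolding w0'_explicit by auto
  then show "weights ! r = refl0 (weights ! s)"
  proof (elim disjE)
    assume "ent ?A r s \<noteq> 0"
    from rm_shift[OF r0 this rs] have e: "weights ! r = map2 (+) (weights ! s) [0, 1, 0, 0, 0, 0]" by simp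
    then have "?p r = ?p s + 2" by (simp add: w)
    then have "?p s = - 1" using p[OF rs(1)] p[OF rs(2)] by auto
    then show ?thesis unfolding e by (simp add: refl0_def w)
  next
    assume "ent ?A s r \<noteq> 0"
    from rm_shift[OF r0 this rs(2,1)] have "weights ! s = map2 (+) (weights ! r) [0, 1, 0, 0, 0, 0]" by simp
    then have e: "weights ! r = map2 (+) (weights ! s) (map uminus [0, 1, 0, 0, 0, 0])"
      by (intro map2_neg weights_length rs) simp_all
    then have "?p r = ?p s - 2" by (simp add: w)
    then have "?p s = 1" using p[OF rs(1)] p[OF rs(2)] by auto
    then show ?thesis unfolding e by (simp add: refl0_def w)
  next
    assume "(if r = s then 1 else 0) - ent (?A * trn ?A) r s - ent (trn ?A * ?A) r s \<noteq> 0"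
    then have "(if r = s then 1 + (- 1 :: 'k) powi ?p r else 0) \<noteq> 0" unfolding h[symmetric] mult_eq_0_iff by simp
    then have "r = s" "?p r = 0" using p[OF rs(1)] by (auto split: if_splits)
    then show ?thesis by (simp add: refl0_def w)
  qed
qed

lemma w0'_permutes_roots: "permutes_roots w0'"
  unfolding permutes_roots_def
proof
  fix \<beta> assume b: "\<beta> \<in> roots"
  let ?b = "root_refl g0 \<beta>"
  have g0: "g0 \<in> roots" by (rule named_in_roots) simp
  have b': "?b \<in> roots" by (rule root_refl_g0[OF b])
  have w: "weyl_rep x g0 = mat_of w0'" using weyl_rep_re[OF g0] by (simp add: w0'_def)
  obtain \<epsilon> where e: "\<epsilon> \<in> {1, - 1}" "\<And>t. conj_E6 (weyl_rep x g0) (x \<beta> t) = x ?b (\<epsilon> * t)" using x_conj[OF g0 b] by blast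
  have "w0' * re \<beta> 1 * minv w0' = re ?b (sg ?b * \<epsilon> * sg \<beta>)"
    using e(2)[of "sg \<beta>"] sg(2)[OF b, of "sg \<beta>"] sg(2)[OF b', of "\<epsilon> * sg \<beta>"] sg(3)[OF b]
    by (simp add: w conj_E6_m27[OF w0'_EE] mat_of_inject mult.assoc)
  from arg_cong[OF this, of "\<lambda>Z. Z * w0'"] have "w0' * re \<beta> 1 = re ?b (sg ?b * \<epsilon> * sg \<beta>) * w0'"
    by (simp add: mult.assoc minv(4)[OF w0'_EE])
  then have "w0' * rm \<beta> = scl (sg ?b * \<epsilon> * sg \<beta>) (rm ?b) * w0'"
    by (simp add: re_def distrib_left distrib_right)
  moreover have "sg ?b * \<epsilon> * sg \<beta> \<in> {1, - 1}" using e(1) sg(1)[OF b] sg(1)[OF b'] by auto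
  ultimately show "\<exists>\<beta>'\<in>roots. \<exists>\<epsilon>\<in>{1, - 1}. w0' * rm \<beta> = scl \<epsilon> (rm \<beta>') * w0'" using b' by blast
qed

lemma s0_Ints: "s0 \<in> \<int>" "- s0 \<in> \<int>"
  using sg(1)[OF named_in_roots[of g0]] by auto

lemma integral_w0': "integral w0'" "integral (minv w0')"
  unfolding minv_w0' unfolding w0'_def by (intro integral_simps integral_re s0_Ints)+

text \<open>
  The product \<open>g\<close> conjugate to the given one represents an element of the Weyl group that preserves the heights
  of the weights: the longest element of \<open>G\<close> negates the sum of the positive coroots, that of \<open>M\<close> its part in
  \<open>M\<close>, and the reflection at \<open>\<gamma>\<^sub>0\<close> the rest. So \<open>g\<close> is diagonal, and lies in the torus by \<open>diagonal_in_levi\<close>.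
\<close>
lemma longest_quotient:
  assumes wG: "longest_reduced_word {1..6} wG" and wM: "longest_reduced_word {1, 3, 4, 5, 6} wM"
  shows "lift wM * trn (lift wG) * w0' \<in> genm MS"
proof -
  have sG: "set wG \<subseteq> {1..6}" and sM: "set wM \<subseteq> {1, 3, 4, 5, 6}" using assms by (auto simp: longest_reduced_word_def)
  then have sM': "set wM \<subseteq> {1..6}" by auto
  define g where "g = trn (lift wG) * w0' * (lift wM :: 'k m27)"
  have LG: "(lift wG :: 'k m27) \<in> EE" "trn (lift wG :: 'k m27) \<in> EE" "(lift wM :: 'k m27) \<in> EE"
    using lift_EE[OF sG] lift_EE[OF sM'] minv(2)[OF lift_EE[OF sG], where 'a = 'k] by (simp_all add: minv_lift[OF sG])
  have gE: "g \<in> EE" unfolding g_def by (intro EE_mult LG w0'_EE)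
  have nz: "\<exists>l<27. \<exists>m<27. weights ! l = wact wG (weights ! r) \<and> weights ! l = refl0 (weights ! m) \<and> weights ! m = wact wM (weights ! s)"
    if rs: "r < 27" "s < 27" "ent g r s \<noteq> 0" for r s
  proof -
    obtain m where m: "m < 27" "ent (trn (lift wG) * w0') r m \<noteq> 0" "ent (lift wM :: 'k m27) m s \<noteq> 0"
      using ent_mult_nonzero[OF rs(1,2)] rs(3) unfolding g_def by metis
    obtain l where l: "l < 27" "ent (trn (lift wG) :: 'k m27) r l \<noteq> 0" "ent w0' l m \<noteq> 0"
      using ent_mult_nonzero[OF rs(1) m(1,2)] by metis
    have "weights ! l = wact wG (weights ! r)" by (rule monomial_trn[OF monomial_lift[OF sG] rs(1) l(1,2)])
    moreover have "weights ! l = refl0 (weights ! m)" using w0'_monomial l m(1) unfolding monomial_def by blast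
    moreover have "weights ! m = wact wM (weights ! s)" using monomial_lift[OF sM', where 'k = 'k] m rs(2) unfolding monomial_def by blast
    ultimately show ?thesis using l(1) m(1) by blast
  qed
  have diag: "r = s" if rs: "r < 27" "s < 27" "ent g r s \<noteq> 0" for r s
  proof (rule linear_height_identity[where P = "\<lambda>r s. ent g r s \<noteq> 0", OF _ _ _ rs])
    fix j :: nat assume j: "j < 6"
    have l1: "length (sact wG (simple_vec (int (Suc j)))) = 6" by (rule length_act(2)[OF length_simple])
    obtain \<beta>1 where b1: "length \<beta>1 = 6" "\<And>v. length v = 6 \<Longrightarrow> prw (sact wG (simple_vec (int (Suc j)))) (refl0 v) = prw \<beta>1 v"
      using prw_refl0_adjoint[OF l1] by blast
    show "\<exists>\<beta>. length \<beta> = 6 \<and> (\<forall>r<27. \<forall>s<27. ent g r s \<noteq> 0 \<longrightarrow> weights ! r ! j = prw \<beta> (weights ! s))"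
    proof (intro exI[of _ "sact (rev wM) \<beta>1"] conjI allI impI)
      show "length (sact (rev wM) \<beta>1) = 6" by (rule length_act(2)[OF b1(1)])
      fix r s :: nat assume rs: "r < 27" "s < 27" "ent g r s \<noteq> 0"
      obtain l m where lm: "l < 27" "m < 27" "weights ! l = wact wG (weights ! r)" "weights ! l = refl0 (weights ! m)"
        "weights ! m = wact wM (weights ! s)" using nz[OF rs] by blast
      have "weights ! r ! j = prw (simple_vec (int (Suc j))) (weights ! r)"
        by (rule prw_unit[OF weights_length(2)[OF rs(1)] j, symmetric])
      also have "\<dots> = prw (sact wG (simple_vec (int (Suc j)))) (wact wG (weights ! r))"
        by (rule prw_act[OF length_simple weights_length(2)[OF rs(1)], symmetric])
      also have "\<dots> = prw \<beta>1 (weights ! m)"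
        unfolding lm(3)[symmetric] lm(4) by (rule b1(2)[OF weights_length(2)[OF lm(2)]])
      also have "\<dots> = prw (sact (rev wM) \<beta>1) (weights ! s)"
        unfolding lm(5) by (rule prw_act_adjoint[OF weights_length(2)[OF rs(2)] b1(1)])
      finally show "weights ! r ! j = prw (sact (rev wM) \<beta>1) (weights ! s)" .
    qed
  next
    fix r s :: nat assume rs: "r < 27" "s < 27" "ent g r s \<noteq> 0"
    obtain l m where lm: "l < 27" "m < 27" "weights ! l = wact wG (weights ! r)" "weights ! l = refl0 (weights ! m)"
      "weights ! m = wact wM (weights ! s)" using nz[OF rs] by blast
    note L = weights_length(2)[OF rs(1)] weights_length(2)[OF rs(2)] weights_length(2)[OF lm(2)]
    have "- prw rho2 (weights ! r) = prw rho2 (weights ! l)"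
      using longest_negates[OF wG L(1)] unfolding lm(3) by (simp only: sum_pos_roots(1) L(1) length_act(1))
    also have "\<dots> = prw rhoM2 (weights ! m) - 11 * prw g0 (weights ! m)"
      unfolding lm(4) by (rule prw_refl0[OF L(3)])
    also have "prw rhoM2 (weights ! m) = - prw rhoM2 (weights ! s)"
      using longest_negates[OF wM L(2)] unfolding lm(5) by (simp only: sum_pos_roots(2) L(2) length_act(1))
    also have "prw g0 (weights ! m) = prw g0 (weights ! s)" unfolding lm(5) by (rule wact_g0[OF sM L(2)])
    finally show "prw rho2 (weights ! r) = prw rho2 (weights ! s)" using rho_decomp[OF L(2)] by linarith
  next
    fix s :: nat assume s: "s < 27"
    show "\<exists>r<27. ent g r s \<noteq> 0"
    proof (rule ccontr)
      assume "\<not> ?thesis"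
      then have "ent (minv g * g) s s = 0" unfolding ent_mult[OF s s] by (intro sum.neutral) auto
      then show False using minv(4)[OF gE] s by simp
    qed
  qed
  have gM: "g \<in> genm MS"
  proof (rule diagonal_in_levi[OF gE])
    show "ent g r s = 0" if "r < 27" "s < 27" "r \<noteq> s" for r s using diag that by blast
    show "integral g" unfolding g_def by (intro integral_simps integral_lift integral_w0')
    show "permutes_roots g" unfolding g_def
      by (intro permutes_roots_mult permutes_roots_lift sG sM' w0'_permutes_roots)
  qed
  have lM: "lift wM \<in> genm MS" by (rule lift_levi[OF sM])
  have "lift wM * (g * minv (lift wM)) \<in> genm MS"
    by (intro genm_mult lM gM genm_minv[OF gens_EE(1)])
  moreover have "lift wM * (g * minv (lift wM)) = lift wM * trn (lift wG) * w0'"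
    using minv(3)[OF LG(3)] by (simp add: g_def mult.assoc)
  ultimately show ?thesis by simp
qed

lemma w0_lift_eq:
  assumes "set wG \<subseteq> {1..6}" "set wM \<subseteq> {1..6}" shows "w0_lift x wG wM = mat_of (lift wG * trn (lift wM))"
proof -
  have w: "weyl_lift x ws = mat_of (lift ws)" if "set ws \<subseteq> {1..6}" for ws
    using that
  proof (induction ws)
    case (Cons i ws)
    then show ?case by (simp add: weyl_lift_def weyl_rep_simple times_m27.rep_eq)
  qed (simp add: weyl_lift_def one_m27.rep_eq)
  show ?thesis
    unfolding w0_lift_def w[OF assms(1)] w[OF assms(2)]
    by (simp add: minv(1)[OF lift_EE[OF assms(2)], symmetric] minv_lift[OF assms(2)] times_m27.rep_eq)
qed

end

section \<open>Regular functions of the parameters\<close>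

text \<open>Functions whose only denominators are the two that occur in \<open>levi_part\<close>.\<close>
definition nearly_poly :: "('f::field_char_0 alg_closure vec \<Rightarrow> 'f alg_closure) \<Rightarrow> bool" where
  "nearly_poly \<phi> \<longleftrightarrow> (\<exists>e\<in>polyfuns A6. \<exists>k. \<forall>c\<in>R_set. \<phi> c * (c $ 0 * quartic c) ^ k = e c)"

lemma nearly_polyI:
  "e \<in> polyfuns A6 \<Longrightarrow> (\<And>c. c \<in> R_set \<Longrightarrow> \<phi> c * (c $ 0 * quartic c) ^ k = e c) \<Longrightarrow> nearly_poly \<phi>"
  unfolding nearly_poly_def by (intro bexI[of _ e] exI[of _ k]) simp_all

lemma nearly_polyE:
  assumes "nearly_poly \<phi>"
  obtains e k where "e \<in> polyfuns A6" "\<And>c. c \<in> R_set \<Longrightarrow> \<phi> c * (c $ 0 * quartic c) ^ k = e c"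
proof -
  obtain e k where "e \<in> polyfuns A6" and e: "\<forall>c\<in>R_set. \<phi> c * (c $ 0 * quartic c) ^ k = e c"
    using assms unfolding nearly_poly_def by (elim bexE exE) (rule that)
  then show thesis using that[OF _ bspec[OF e]] by simp
qed

lemma denominator_poly: "(\<lambda>c :: 'f::field alg_closure vec. (c $ 0 * quartic c) ^ k) \<in> polyfuns A6"
  by (intro polyfuns_intros polyfuns_A6_coord quartic_poly) simp

lemma nearly_poly_poly: "\<phi> \<in> polyfuns A6 \<Longrightarrow> nearly_poly \<phi>"
  by (rule nearly_polyI[of \<phi> _ 0]) simp_all

lemma nearly_poly_add:
  assumes "nearly_poly \<phi>" "nearly_poly \<psi>" shows "nearly_poly (\<lambda>c. \<phi> c + \<psi> c)"
proof -
  obtain e k where 1: "e \<in> polyfuns A6" "\<And>c. c \<in> R_set \<Longrightarrow> \<phi> c * (c $ 0 * quartic c) ^ k = e c"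
    by (rule nearly_polyE[OF assms(1)], rule that)
  obtain e' k' where 2: "e' \<in> polyfuns A6" "\<And>c. c \<in> R_set \<Longrightarrow> \<psi> c * (c $ 0 * quartic c) ^ k' = e' c"
    by (rule nearly_polyE[OF assms(2)], rule that)
  let ?d = "\<lambda>c. c $ 0 * quartic c"
  have "(\<lambda>c. e c * ?d c ^ k' + e' c * ?d c ^ k) \<in> polyfuns A6"
    by (intro polyfuns.add polyfuns.mult 1(1) 2(1) denominator_poly)
  moreover have "(\<phi> c + \<psi> c) * ?d c ^ (k + k') = e c * ?d c ^ k' + e' c * ?d c ^ k" if "c \<in> R_set" for c
    unfolding 1(2)[OF that, symmetric] 2(2)[OF that, symmetric] by (simp only: power_add distrib_right mult_ac)
  ultimately show ?thesis by (rule nearly_polyI)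
qed

lemma nearly_poly_mult:
  assumes "nearly_poly \<phi>" "nearly_poly \<psi>" shows "nearly_poly (\<lambda>c. \<phi> c * \<psi> c)"
proof -
  obtain e k where 1: "e \<in> polyfuns A6" "\<And>c. c \<in> R_set \<Longrightarrow> \<phi> c * (c $ 0 * quartic c) ^ k = e c"
    by (rule nearly_polyE[OF assms(1)], rule that)
  obtain e' k' where 2: "e' \<in> polyfuns A6" "\<And>c. c \<in> R_set \<Longrightarrow> \<psi> c * (c $ 0 * quartic c) ^ k' = e' c"
    by (rule nearly_polyE[OF assms(2)], rule that)
  let ?d = "\<lambda>c. c $ 0 * quartic c"
  have "(\<lambda>c. e c * e' c) \<in> polyfuns A6" by (intro polyfuns.mult 1(1) 2(1))
  moreover have "\<phi> c * \<psi> c * ?d c ^ (k + k') = e c * e' c" if "c \<in> R_set" for c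
    unfolding 1(2)[OF that, symmetric] 2(2)[OF that, symmetric] by (simp only: power_add mult_ac)
  ultimately show ?thesis by (rule nearly_polyI)
qed

lemma polyfuns_int: "z \<in> \<int> \<Longrightarrow> (\<lambda>_. z :: 'f::field_char_0 alg_closure) \<in> polyfuns S"
proof (erule Ints_cases)
  fix n assume "z = of_int n"
  then show "(\<lambda>_. z) \<in> polyfuns S" using polyfuns.const[of "of_int n" S] by simp
qed

lemma nearly_poly_inverses:
  "nearly_poly (\<lambda>c :: 'f::field_char_0 alg_closure vec. inverse (c $ 0))"
  "nearly_poly (\<lambda>c :: 'f alg_closure vec. inverse (quartic c))"
proof -
  show "nearly_poly (\<lambda>c :: 'f alg_closure vec. inverse (c $ 0))"
    by (rule nearly_polyI[of quartic _ 1]) (simp_all add: quartic_poly R_nonzero)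
  have "(\<lambda>c :: 'f alg_closure vec. c $ 0) \<in> polyfuns A6" by (rule polyfuns_A6_coord) simp
  then show "nearly_poly (\<lambda>c :: 'f alg_closure vec. inverse (quartic c))"
    by (rule nearly_polyI[of _ _ 1]) (simp_all add: R_nonzero)
qed

lemma nearly_poly_cong: "nearly_poly \<psi> \<Longrightarrow> (\<And>c. \<phi> c = \<psi> c) \<Longrightarrow> nearly_poly \<phi>"
  by presburger

definition nearly_poly_mat :: "('f::field_char_0 alg_closure vec \<Rightarrow> 'f alg_closure m27) \<Rightarrow> bool" where
  "nearly_poly_mat A \<longleftrightarrow> (\<forall>r<27. \<forall>s<27. nearly_poly (\<lambda>c. ent (A c) r s))"

lemma nearly_poly_sum: "finite I \<Longrightarrow> (\<And>i. i \<in> I \<Longrightarrow> nearly_poly (\<phi> i)) \<Longrightarrow> nearly_poly (\<lambda>c. \<Sum>i\<in>I. \<phi> i c)"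
proof (induction I rule: finite_induct)
  case empty then show ?case by (simp add: nearly_poly_poly polyfuns_numeral)
next
  case (insert i I) then show ?case by (simp add: nearly_poly_add)
qed

lemma nearly_poly_mat_mult: "nearly_poly_mat A \<Longrightarrow> nearly_poly_mat B \<Longrightarrow> nearly_poly_mat (\<lambda>c. A c * B c)"
  unfolding nearly_poly_mat_def by (auto simp: ent_mult intro!: nearly_poly_sum nearly_poly_mult)

lemma nearly_poly_mat_int: "integral A \<Longrightarrow> nearly_poly_mat (\<lambda>_. A)"
  unfolding nearly_poly_mat_def integral_def by (simp add: nearly_poly_poly polyfuns_int)

lemma nearly_poly_mat_re:
  assumes "nearly_poly t" shows "nearly_poly_mat (\<lambda>c. re \<beta> (t c))"
  unfolding nearly_poly_mat_def
proof (intro allI impI)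
  fix r s :: nat assume rs: "r < 27" "s < 27"
  show "nearly_poly (\<lambda>c. ent (re \<beta> (t c)) r s)"
  proof (rule nearly_poly_cong)
    show "ent (re \<beta> (t c)) r s = (if r = s then 1 else 0) + t c * of_int (spent (rootL \<beta>) r s)" for c
      using rs by (simp add: re_def rm_def)
    show "nearly_poly (\<lambda>c. (if r = s then 1 else 0) + t c * of_int (spent (rootL \<beta>) r s))"
      by (intro nearly_poly_add nearly_poly_mult assms nearly_poly_poly polyfuns_int) auto
  qed
qed

lemma diag_ok_range: "diag_ok \<beta> \<Longrightarrow> r < 27 \<Longrightarrow> prw \<beta> (weights ! r) \<in> {- 1, 0, 1}"
  using index_weights_nth[of r] unfolding diag_ok_def Let_def list_all_iff by fastforce

lemma nearly_poly_mat_tor: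
  assumes "diag_ok \<beta>" "nearly_poly t" "nearly_poly (\<lambda>c. inverse (t c))"
  shows "nearly_poly_mat (\<lambda>c. tor \<beta> (t c))"
  unfolding nearly_poly_mat_def
proof (intro allI impI)
  fix r s :: nat assume rs: "r < 27" "s < 27"
  have c: "nearly_poly (\<lambda>_. 0)" "nearly_poly (\<lambda>_. 1)" by (simp_all add: nearly_poly_poly polyfuns_numeral)
  show "nearly_poly (\<lambda>c. ent (tor \<beta> (t c)) r s)"
    using diag_ok_range[OF assms(1) rs(1)] rs assms(2,3) c
    by (cases "r = s") (auto simp: tor_def power_int_minus)
qed

section \<open>The invariants read off from the Levi component\<close>

text \<open>
  The root vectors of the \<open>\<gamma>\<^sub>i\<close>, and their products in pairs in the order of the factors; \<open>\<gamma>\<^sub>0\<close> occurs in none.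
\<close>
definition short_products :: "sparse list" where
  "short_products = (let L = map rootL [g1, g2, g3, g4, g5] in
     [rootL g0, L!0, L!1, L!2, L!3, L!4, spmul (L!0) (L!1), spmul (L!0) (L!2), spmul (L!0) (L!3), spmul (L!0) (L!4),
      spmul (L!1) (L!2), spmul (L!1) (L!3), spmul (L!1) (L!4), spmul (L!2) (L!3), spmul (L!2) (L!4), spmul (L!3) (L!4)])"

lemma corner_checks:
  "map (\<lambda>L. spentI L 3 24) short_products = [1, 0,0,0,0,0, 0,0,0,0, 0,0,0, 0,0, 0]"
  "map (\<lambda>L. spentI L 0 20) short_products = [1, 0,0,0,0,0, 0,0,0,-1, 0,0,0, 0,0, 0]"
  "map (\<lambda>L. spentI L 0 26) short_products = [0, 0,0,0,0,0, 0,0,0,0, 1,0,0, 0,0, 0]"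
  "map (\<lambda>L. spentI L 3 23) short_products = [0, 0,0,0,0,0, 0,0,0,0, 0,0,-1, 0,0, 0]"
  "map (\<lambda>L. spentI L 5 21) short_products = [0, 0,0,0,0,0, 0,0,0,0, 0,0,0, 0,1, 0]"
  "map (\<lambda>L. spentI L 7 20) short_products = [0, 0,0,0,0,0, 0,0,0,0, 0,0,0, 0,0, 1]"
  by code_simp+

lemma cube_checks:
  "map (\<lambda>\<beta>. spmul (rootL g0) (rootL \<beta>)) [g1, g2, g3, g4, g5] = [[], [], [], [], []]"
  "(let L = map rootL [g1, g2, g3, g4, g5] in
    map (\<lambda>(a, b, c). spmul a (spmul b c)) [(L!0, L!1, L!2), (L!0, L!1, L!3), (L!0, L!1, L!4), (L!0, L!2, L!3), (L!0, L!2, L!4),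
      (L!0, L!3, L!4), (L!1, L!2, L!3), (L!1, L!2, L!4), (L!1, L!3, L!4), (L!2, L!3, L!4)])
    = [[], [], [], [], [], [], [], [], [], []]"
  by code_simp+

text \<open>The rows of the inverse of \<open>w0'\<close> with the listed indices have a single nonzero entry.\<close>
lemma row_checks:
  "(let A = rootL g0; D = spadd (spmul A (sptrn A)) (spmul (sptrn A) A) in
    list_all (\<lambda>(r, l0). list_all (\<lambda>l. spentI A r l = 0 \<and> spentI A l r = (if l = l0 then 1 else 0) \<and>
      spentI D r l = (if l = r then 1 else 0)) (map (fst \<circ> snd) spone)) [(20, 0), (24, 3), (25, 5), (26, 7)])"
  by code_simp

text \<open>
  The product of two root vectors is 0 if the first is that of \<open>\<gamma>\<^sub>0\<close>, and that of three is always 0; so the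
  entries of the product are polynomials of degree at most 2.
\<close>
lemma product_expansion:
  fixes t0 t1 t2 t3 t4 t5 :: "'k::field"
  assumes ij: "i < 27" "j < 27"
    and v: "map (\<lambda>L. spentI L (int i) (int j)) short_products = [k0, a1, a2, a3, a4, a5, k12, k13, k14, k15, k23, k24, k25, k34, k35, k45]"
  shows "ent (re g0 t0 * (re g1 t1 * (re g2 t2 * (re g3 t3 * (re g4 t4 * re g5 t5))))) i j =
    (if i = j then 1 else 0) + t0 * of_int k0 + t1 * of_int a1 + t2 * of_int a2 + t3 * of_int a3 + t4 * of_int a4 + t5 * of_int a5
    + t1 * t2 * of_int k12 + t1 * t3 * of_int k13 + t1 * t4 * of_int k14 + t1 * t5 * of_int k15 + t2 * t3 * of_int k23
    + t2 * t4 * of_int k24 + t2 * t5 * of_int k25 + t3 * t4 * of_int k34 + t3 * t5 * of_int k35 + t4 * t5 * of_int k45"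
proof -
  have r: "is_root g0" "is_root g1" "is_root g2" "is_root g3" "is_root g4" "is_root g5" using named_roots by simp_all
  note vr = valid_root[OF r(1)] valid_root[OF r(2)] valid_root[OF r(3)] valid_root[OF r(4)] valid_root[OF r(5)]
  define rv :: "nat \<Rightarrow> 'k m27" where "rv n = rm ([g0, g1, g2, g3, g4, g5] ! n)" for n
  have Xs: "rv 0 = sp (rootL g0)" "rv 1 = sp (rootL g1)" "rv 2 = sp (rootL g2)" "rv 3 = sp (rootL g3)" "rv 4 = sp (rootL g4)" "rv 5 = sp (rootL g5)"
    by (simp_all add: rv_def rm_def)
  note spm = sp_mult[OF vr(1), symmetric] sp_mult[OF vr(2), symmetric] sp_mult[OF vr(3), symmetric]
    sp_mult[OF vr(4), symmetric] sp_mult[OF vr(5), symmetric]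
  have z0: "rv 0 * rv 1 = 0" "rv 0 * rv 2 = 0" "rv 0 * rv 3 = 0" "rv 0 * rv 4 = 0" "rv 0 * rv 5 = 0"
    unfolding Xs using cube_checks(1) by (simp_all add: sp_Nil spm)
  have z1: "rv 1 * (rv 2 * rv 3) = 0" "rv 1 * (rv 2 * rv 4) = 0" "rv 1 * (rv 2 * rv 5) = 0" "rv 1 * (rv 3 * rv 4) = 0" "rv 1 * (rv 3 * rv 5) = 0"
    "rv 1 * (rv 4 * rv 5) = 0" "rv 2 * (rv 3 * rv 4) = 0" "rv 2 * (rv 3 * rv 5) = 0" "rv 2 * (rv 4 * rv 5) = 0" "rv 3 * (rv 4 * rv 5) = 0"
    unfolding Xs using cube_checks(2) by (simp_all add: Let_def sp_Nil spm)
  have z0': "rv 0 * (rv 1 * Z) = 0" "rv 0 * (rv 2 * Z) = 0" "rv 0 * (rv 3 * Z) = 0" "rv 0 * (rv 4 * Z) = 0" for Z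
    by (simp_all only: mult.assoc[symmetric] z0 mult_zero_left)
  have z1': "rv 1 * (rv 2 * (rv 3 * Z)) = 0" "rv 1 * (rv 2 * (rv 4 * Z)) = 0" "rv 1 * (rv 3 * (rv 4 * Z)) = 0" "rv 2 * (rv 3 * (rv 4 * Z)) = 0" for Z
  proof -
    have "A * (B * (C * Z)) = A * (B * C) * Z" for A B C :: "'k m27" by (simp only: mult.assoc)
    then show "rv 1 * (rv 2 * (rv 3 * Z)) = 0" "rv 1 * (rv 2 * (rv 4 * Z)) = 0" "rv 1 * (rv 3 * (rv 4 * Z)) = 0" "rv 2 * (rv 3 * (rv 4 * Z)) = 0"
      by (simp_all only: z1 mult_zero_left mult_zero_right)
  qed
  have re: "re g0 t0 = 1 + scl t0 (rv 0)" "re g1 t1 = 1 + scl t1 (rv 1)" "re g2 t2 = 1 + scl t2 (rv 2)"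
    "re g3 t3 = 1 + scl t3 (rv 3)" "re g4 t4 = 1 + scl t4 (rv 4)" "re g5 t5 = 1 + scl t5 (rv 5)"
    by (simp_all add: re_def rv_def)
  have V: "spentI (rootL g0) (int i) (int j) = k0" "spentI (rootL g1) (int i) (int j) = a1" "spentI (rootL g2) (int i) (int j) = a2"
    "spentI (rootL g3) (int i) (int j) = a3" "spentI (rootL g4) (int i) (int j) = a4" "spentI (rootL g5) (int i) (int j) = a5"
    "spentI (spmul (rootL g1) (rootL g2)) (int i) (int j) = k12" "spentI (spmul (rootL g1) (rootL g3)) (int i) (int j) = k13"
    "spentI (spmul (rootL g1) (rootL g4)) (int i) (int j) = k14" "spentI (spmul (rootL g1) (rootL g5)) (int i) (int j) = k15"
    "spentI (spmul (rootL g2) (rootL g3)) (int i) (int j) = k23" "spentI (spmul (rootL g2) (rootL g4)) (int i) (int j) = k24"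
    "spentI (spmul (rootL g2) (rootL g5)) (int i) (int j) = k25" "spentI (spmul (rootL g3) (rootL g4)) (int i) (int j) = k34"
    "spentI (spmul (rootL g3) (rootL g5)) (int i) (int j) = k35" "spentI (spmul (rootL g4) (rootL g5)) (int i) (int j) = k45"
    using v by (simp_all add: short_products_def Let_def)
  have E: "ent (rv 0) i j = of_int k0" "ent (rv 1) i j = of_int a1" "ent (rv 2) i j = of_int a2" "ent (rv 3) i j = of_int a3"
    "ent (rv 4) i j = of_int a4" "ent (rv 5) i j = of_int a5" "ent (rv 1 * rv 2) i j = of_int k12" "ent (rv 1 * rv 3) i j = of_int k13"
    "ent (rv 1 * rv 4) i j = of_int k14" "ent (rv 1 * rv 5) i j = of_int k15" "ent (rv 2 * rv 3) i j = of_int k23" "ent (rv 2 * rv 4) i j = of_int k24"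
    "ent (rv 2 * rv 5) i j = of_int k25" "ent (rv 3 * rv 4) i j = of_int k34" "ent (rv 3 * rv 5) i j = of_int k35" "ent (rv 4 * rv 5) i j = of_int k45"
    unfolding Xs by (simp_all only: spm ent_sp[OF ij] spent_spentI V)
  show ?thesis
    unfolding re
    by (simp only: ring_normal z0 z0' z1 z1' add_0_right add_0_left)
      (simp only: ent_simps[OF ij] E distrib_left distrib_right add_ac mult_ac)
qed

context chevalley
begin

lemma bottom_rows:
  assumes "(r, l) \<in> {(20, 0), (24, 3), (25, 5), (26, 7)}" "s < 27"
  shows "ent (minv w0' * G) r s = s0 * ent G l s"
proof -
  let ?A = "rm g0 :: 'k m27"
  have r0: "is_root g0" using named_roots by simp
  have rl: "r < 27" "l < 27" "(int r, int l) \<in> set [(20, 0), (24, 3), (25, 5), (26, 7)]" using assms(1) by auto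
  have a: "s0 * s0 = 1" "s0 * (s0 * z) = z" for z using sg(3)[OF named_in_roots[of g0]] by (simp_all add: mult.assoc[symmetric])
  have n: "n0 = map uminus g0" by simp
  have w: "minv w0' = 1 + scl s0 (trn ?A) - scl s0 ?A - (?A * trn ?A + trn ?A * ?A)"
    unfolding minv_w0' n re_def rm_neg[OF r0]
    by (simp only: ring_normal rm_sl2[OF r0], rule m27_eqI, simp add: algebra_simps a)
  have v: "valid (rootL g0)" "valid (sptrn (rootL g0))"
  proof -
    have "(g0, rootL g0) \<in> set pos_table" by code_simp
    then show "valid (rootL g0)" "valid (sptrn (rootL g0))" using table_ok by (auto simp: list_all_iff)
  qed
  have m: "map (fst \<circ> snd) spone = map int [0..<27]" by (simp add: spone_def upt_conv_Cons)
  have row: "ent (minv w0') r k = (if k = l then s0 else 0)" if k: "k < 27" for k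
  proof -
    have "int k \<in> set (map (fst \<circ> snd) spone)" unfolding m using k by simp
    then have c: "spentI (rootL g0) (int r) (int k) = 0" "spentI (rootL g0) (int k) (int r) = (if int k = int l then 1 else 0)"
      "spentI (spadd (spmul (rootL g0) (sptrn (rootL g0))) (spmul (sptrn (rootL g0)) (rootL g0))) (int r) (int k) = (if int k = int r then 1 else 0)"
      using bspec[OF row_checks[unfolded Let_def list_all_iff] rl(3)] by blast+
    have "?A * trn ?A + trn ?A * ?A = sp (spadd (spmul (rootL g0) (sptrn (rootL g0))) (spmul (sptrn (rootL g0)) (rootL g0)))"
      by (simp add: rm_def sp_mult v sp_trn[symmetric] sp_add)
    then show ?thesis unfolding w using k rl(1) c by (auto simp: rm_def spent_spentI)
  qed
  have "ent (minv w0' * G) r s = (\<Sum>k<27. if k = l then s0 * ent G l s else 0)"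
    unfolding ent_mult[OF rl(1) assms(2)] by (rule sum.cong) (auto simp: row)
  then show ?thesis using rl(2) by simp
qed

text \<open>
  In the lowest degree, entries of the Levi component are entries of the whole product, and \<open>bottom_rows\<close>
  reduces the latter to \<open>product_expansion\<close>.
\<close>
lemma levi_part_entries:
  assumes "adapted_signs x" "c $ 0 \<noteq> 0" "quartic c \<noteq> 0"
  shows "ent (levi_part c) 24 24 = c $ 0" "ent (levi_part c) 20 20 = c $ 0 - c $ 1 * c $ 5"
    "ent (levi_part c) 24 23 = - (s0 * s2) * (c $ 2 * c $ 5)" "ent (levi_part c) 25 21 = s0 * s3 * (c $ 3 * c $ 5)"
    "ent (levi_part c) 26 20 = s0 * s4 * (c $ 4 * c $ 5)" "ent (levi_part c) 20 26 = s0 * s2 * s3 * (c $ 2 * c $ 3)"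
proof -
  note ad = adapted[OF assms(1)]
  have a: "s0 * s0 = 1" "s0 * (s0 * z) = z" for z using sg(3)[OF named_in_roots[of g0]] by (simp_all add: mult.assoc[symmetric])
  obtain n b where nb: "n \<in> genm NS" "b \<in> genm LS" "minv w0' * gprod c = levi_part c * n * b"
    using M_component_exists[OF assms] by blast
  have e: "ent (levi_part c) r s = s0 * ent (gprod c) l s"
    if "(r, l) \<in> {(20, 0), (24, 3), (25, 5), (26, 7)}" "s < 27" "gr r = - 1" "gr s = - 1" for r l s
  proof -
    have r: "r < 27" using that(1) by auto
    have "ent (levi_part c * n * b) r s = ent (levi_part c) r s"
      by (rule bottom_block[OF blk_gens(1)[OF levi_part_MM[OF assms(2,3)]] blk_gens(2)[OF nb(1)] blk_gens(3)[OF nb(2)] r that(2-4)])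
    then show ?thesis using bottom_rows[OF that(1,2)] unfolding nb(3)[symmetric] by simp
  qed
  have gr: "gr 20 = - 1" "gr 21 = - 1" "gr 23 = - 1" "gr 24 = - 1" "gr 25 = - 1" "gr 26 = - 1"
    by (simp_all add: gr_def weights_def)
  show "ent (levi_part c) 24 24 = c $ 0"
    by (subst e[of 24 3]) (simp_all add: gr gprod_def product_expansion[of 3 24, simplified, OF corner_checks(1)] a)
  show "ent (levi_part c) 20 20 = c $ 0 - c $ 1 * c $ 5"
    by (subst e[of 20 0]) (simp_all add: gr gprod_def product_expansion[of 0 20, simplified, OF corner_checks(2)] a ad algebra_simps)
  show "ent (levi_part c) 20 26 = s0 * s2 * s3 * (c $ 2 * c $ 3)"
    by (subst e[of 20 0]) (simp_all add: gr gprod_def product_expansion[of 0 26, simplified, OF corner_checks(3)] mult_ac)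
  show "ent (levi_part c) 24 23 = - (s0 * s2) * (c $ 2 * c $ 5)"
    by (subst e[of 24 3]) (simp_all add: gr gprod_def product_expansion[of 3 23, simplified, OF corner_checks(4)] ad mult_ac)
  show "ent (levi_part c) 25 21 = s0 * s3 * (c $ 3 * c $ 5)"
    by (subst e[of 25 5]) (simp_all add: gr gprod_def product_expansion[of 5 21, simplified, OF corner_checks(5)] ad mult_ac)
  show "ent (levi_part c) 26 20 = s0 * s4 * (c $ 4 * c $ 5)"
    by (subst e[of 26 7]) (simp_all add: gr gprod_def product_expansion[of 7 20, simplified, OF corner_checks(6)] ad mult_ac)
qed

lemma levi_part_flip: "levi_part (flip c) = levi_part c"
  by (simp add: levi_part_def flip_nth quartic_def)

end

lemma nearly_poly_levi_part:
  assumes "chevalley (x :: int list \<Rightarrow> 'f::field_char_0 alg_closure \<Rightarrow> 'f alg_closure mat)"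
  shows "nearly_poly_mat (chevalley.levi_part x)"
proof -
  interpret chevalley x by (rule assms)
  have s: "s0 \<in> \<int>" "s2 \<in> \<int>" "s3 \<in> \<int>" "s4 \<in> \<int>"
    using sg(1)[OF named_in_roots[of g0]] sg(1)[OF named_in_roots[of g2]] sg(1)[OF named_in_roots[of g3]] sg(1)[OF named_in_roots[of g4]]
    by auto
  note i = polyfuns_int[OF s(1)] polyfuns_int[OF s(2)] polyfuns_int[OF s(3)] polyfuns_int[OF s(4)]
  have co: "(\<lambda>c :: 'f alg_closure vec. c $ 0) \<in> polyfuns A6" "(\<lambda>c :: 'f alg_closure vec. c $ 2) \<in> polyfuns A6"
    "(\<lambda>c :: 'f alg_closure vec. c $ 3) \<in> polyfuns A6" "(\<lambda>c :: 'f alg_closure vec. c $ 4) \<in> polyfuns A6"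
    "(\<lambda>c :: 'f alg_closure vec. c $ 5) \<in> polyfuns A6"
    by (rule polyfuns_A6_coord, simp)+
  have quot: "nearly_poly (\<lambda>c :: 'f alg_closure vec. a c / c $ 0)" if "a \<in> polyfuns A6" for a
    unfolding divide_inverse by (intro nearly_poly_mult nearly_poly_inverses nearly_poly_poly that)
  have d: "diag_ok g0" "diag_ok g5" using diag_ok by (simp_all add: simple_vec_def)
  have q: "nearly_poly (\<lambda>c :: 'f alg_closure vec. c $ 0 * c $ 0 / quartic c)"
    unfolding divide_inverse by (intro nearly_poly_mult nearly_poly_inverses nearly_poly_poly co)
  have q': "nearly_poly (\<lambda>c :: 'f alg_closure vec. inverse (c $ 0 * c $ 0 / quartic c))"
    by (rule nearly_poly_cong[of "\<lambda>c. quartic c * (inverse (c $ 0) * inverse (c $ 0))"])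
      (intro nearly_poly_mult nearly_poly_inverses nearly_poly_poly quartic_poly, simp add: field_simps)
  have R: "nearly_poly_mat (\<lambda>c. re \<beta> (s * (a c / c $ 0)))" "nearly_poly_mat (\<lambda>c. re \<beta> (- (s * (a c / c $ 0))))"
    if "(\<lambda>_. s) \<in> polyfuns A6" "a \<in> polyfuns A6" for \<beta> and s :: "'f alg_closure" and a
  proof -
    have p: "nearly_poly (\<lambda>c. s * (a c / c $ 0))" by (rule nearly_poly_mult[OF nearly_poly_poly[OF that(1)] quot[OF that(2)]])
    have "nearly_poly (\<lambda>c. (- 1) * (s * (a c / c $ 0)))" by (intro nearly_poly_mult[OF _ p] nearly_poly_poly polyfuns_int) simp
    then show "nearly_poly_mat (\<lambda>c. re \<beta> (s * (a c / c $ 0)))" "nearly_poly_mat (\<lambda>c. re \<beta> (- (s * (a c / c $ 0))))"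
      using p by (simp_all add: nearly_poly_mat_re)
  qed
  show ?thesis
    unfolding levi_part_def[abs_def]
    by (intro nearly_poly_mat_mult R polyfuns.mult i co nearly_poly_mat_tor d q q' nearly_poly_inverses)
      (simp add: nearly_poly_poly co)
qed

section \<open>The map \<open>\<N>\<close>\<close>

theorem corollary3p11:
  fixes absv :: "'f::field_char_0 \<Rightarrow> real"
    and x :: "int list \<Rightarrow> 'f alg_closure \<Rightarrow> 'f alg_closure mat"
    and wG wM :: "nat list"
  defines "\<Psi> \<equiv> \<lambda>c. N_map x (w0_lift x wG wM) (gamma_prod x c)"
  assumes "p_adic_field absv"
    and "chevalley_system x" and "adapted_signs x"
    and "longest_reduced_word {1..6} wG" and "longest_reduced_word {1, 3, 4, 5, 6} wM"
  shows "(\<forall>c\<in>R_set. (\<exists>!m. is_M_component x (w0_lift x wG wM) (gamma_prod x c) m) \<and> \<Psi> c \<in> levi x) \<and>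
         etale_onto_image A6 R_set Mat27 \<Psi> \<and>
         has_degree_onto_image R_set \<Psi> 2"
proof -
  have cv: "chevalley x" by (rule chevalley.intro[OF assms(3)])
  interpret chevalley x by (rule cv)
  have sG: "set wG \<subseteq> {1..6}" and sM: "set wM \<subseteq> {1..6}"
    using assms(5,6) by (auto simp: longest_reduced_word_def)
  define W where "W = lift wG * trn (lift wM :: 'f alg_closure m27)"
  define \<mu> where "\<mu> = lift wM * trn (lift wG) * w0'"
  \<comment> \<open>The inverse of \<open>\<mu>\<close>.\<close>
  define \<nu> where "\<nu> = minv w0' * W"
  have w0: "w0_lift x wG wM = mat_of W" unfolding W_def by (rule w0_lift_eq[OF sG sM])
  have LE: "lift wG \<in> EE" "trn (lift wM) \<in> EE"
    using lift_EE[OF sG] minv(2)[OF lift_EE[OF sM]] by (simp_all add: minv_lift[OF sM])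
  have WE: "W \<in> EE" unfolding W_def by (intro EE_mult LE)
  have trnG: "trn (lift wG) * (lift wG * Z) = Z" "lift wG * (trn (lift wG) * Z) = Z" for Z :: "'f alg_closure m27"
    using lift_trn[OF sG, where 'k = "'f alg_closure"] by (simp_all add: mult.assoc[symmetric])
  have trnM: "trn (lift wM) * (lift wM * Z) = Z" "lift wM * trn (lift wM) = (1 :: 'f alg_closure m27)" for Z :: "'f alg_closure m27"
    using lift_trn[OF sM, where 'k = "'f alg_closure"] by (simp_all add: mult.assoc[symmetric])
  have minvW: "minv W = lift wM * trn (lift wG)"
  proof (rule minv_eqI[OF WE])
    show "W * (lift wM * trn (lift wG)) = 1"
      using lift_trn[OF sG, where 'k = "'f alg_closure"] by (simp add: W_def mult.assoc trnM)
  qed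
  have w0'w: "minv w0' * (w0' * Z) = Z" "w0' * (minv w0' * Z) = Z" for Z
    using minv(3,4)[OF w0'_EE] by (simp_all add: mult.assoc[symmetric])
  have \<nu>\<mu>: "\<nu> * (\<mu> * Z) = Z" for Z
    by (simp add: \<nu>_def \<mu>_def W_def mult.assoc trnM trnG w0'w)
  have \<mu>M: "\<mu> \<in> genm MS" unfolding \<mu>_def by (rule longest_quotient[OF assms(5,6)])
  have int: "integral \<mu>" "integral \<nu>"
    unfolding \<mu>_def \<nu>_def W_def by (intro integral_simps integral_lift integral_w0')+
  have comp: "is_M_component x (w0_lift x wG wM) (gamma_prod x c) (mat_of (\<mu> * levi_part c))" if c: "c \<in> R_set" for c
  proof -
    have q: "c $ 0 \<noteq> 0" "quartic c \<noteq> 0" using c by (simp_all add: R_nonzero)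
    obtain n b where nb: "n \<in> genm NS" "b \<in> genm LS" "minv w0' * gprod c = levi_part c * n * b"
      using M_component_exists[OF assms(4) q] by blast
    have "minv W * gprod c = \<mu> * (minv w0' * gprod c)"
      by (simp add: minvW \<mu>_def mult.assoc w0'w)
    also have "\<dots> = \<mu> * levi_part c * n * b" by (simp only: nb(3) mult.assoc)
    finally show ?thesis
      unfolding w0 gamma_prod_gprod is_M_component_iff[OF WE]
      using nb(1,2) genm_mult[OF \<mu>M levi_part_MM[OF q]] by blast
  qed
  have uniq: "m = m'" if "is_M_component x (w0_lift x wG wM) (gamma_prod x c) m" "is_M_component x (w0_lift x wG wM) (gamma_prod x c) m'" for c m m'
    using that unfolding w0 gamma_prod_gprod by (rule M_component_unique[OF WE])
  have \<Psi>: "\<Psi> c = mat_of (\<mu> * levi_part c)" if "c \<in> R_set" for c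
    unfolding \<Psi>_def N_map_def by (rule the_equality) (rule comp[OF that], rule uniq[OF _ comp[OF that]])
  have first: "(\<exists>!m. is_M_component x (w0_lift x wG wM) (gamma_prod x c) m) \<and> \<Psi> c \<in> levi x" if "c \<in> R_set" for c
  proof
    show "\<exists>!m. is_M_component x (w0_lift x wG wM) (gamma_prod x c) m"
      by (rule ex1I) (rule comp[OF that], rule uniq[OF _ comp[OF that]])
    show "\<Psi> c \<in> levi x" unfolding \<Psi>[OF that] using comp[OF that] by (simp add: is_M_component_def)
  qed
  define coef where "coef r s m = (\<Sum>l<27. ent \<nu> r l * m $$ (l, s))" for r s :: nat and m :: "'f alg_closure mat"
  have coef: "coef r s (\<Psi> c) = ent (levi_part c) r s" if "c \<in> R_set" "r < 27" "s < 27" for c r s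
  proof -
    have "coef r s (\<Psi> c) = ent (\<nu> * (\<mu> * levi_part c)) r s"
      unfolding coef_def \<Psi>[OF that(1)] ent_mult[OF that(2,3)] unfolding ent.rep_eq ..
    then show ?thesis by (simp only: \<nu>\<mu>)
  qed
  have coef_poly: "coef r s \<in> polyfuns Mat27" if "r < 27" "s < 27" for r s
    unfolding coef_def[abs_def]
  proof (rule polyfuns_sum)
    fix l :: nat assume "l \<in> {..<27}"
    then have l: "l < 27" by simp
    have z: "ent \<nu> r l \<in> \<int>" using int(2) that(1) l by (simp add: integral_def)
    then show "(\<lambda>m. ent \<nu> r l * m $$ (l, s)) \<in> polyfuns Mat27"
      by (intro polyfuns.mult polyfuns_int[OF z] polyfuns_Mat27_coord l that(2))
  qed
  have sq: "s0 * s0 = 1" "s2 * s2 = 1" "s3 * s3 = 1" "s4 * s4 = 1" using sg(3)[OF named_in_roots] by simp_all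
  then have sq': "s0 * (s0 * z) = z" "s2 * (s2 * z) = z" "s3 * (s3 * z) = z" "s4 * (s4 * z) = z" for z
    by (simp_all add: mult.assoc[symmetric])
  have si: "s0 \<in> \<int>" "s2 \<in> \<int>" "s3 \<in> \<int>" "s4 \<in> \<int>"
    using sg(1)[OF named_in_roots[of g0]] sg(1)[OF named_in_roots[of g2]] sg(1)[OF named_in_roots[of g3]] sg(1)[OF named_in_roots[of g4]]
    by auto
  \<comment> \<open>The signs are those by which the entries differ from the invariants.\<close>
  define p where "p i = (if i = 0 then coef 24 24 else if i = 1 then (\<lambda>m. coef 24 24 m - coef 20 20 m)
    else if i = 2 then (\<lambda>m. - (s0 * s2) * coef 24 23 m) else if i = 3 then (\<lambda>m. s0 * s3 * coef 25 21 m)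
    else (\<lambda>m. s0 * s4 * coef 26 20 m))" for i :: nat
  define r where "r = (\<lambda>m. s0 * s2 * s3 * coef 20 26 m)"
  note pint = polyfuns_int[OF si(1)] polyfuns_int[OF si(2)] polyfuns_int[OF si(3)] polyfuns_int[OF si(4)]
  have p_polys: "coef 24 24 \<in> polyfuns Mat27" "(\<lambda>m. coef 24 24 m - coef 20 20 m) \<in> polyfuns Mat27"
    "(\<lambda>m. - (s0 * s2) * coef 24 23 m) \<in> polyfuns Mat27" "(\<lambda>m. s0 * s3 * coef 25 21 m) \<in> polyfuns Mat27"
    "(\<lambda>m. s0 * s4 * coef 26 20 m) \<in> polyfuns Mat27"
    by (intro polyfuns_diff polyfuns_minus polyfuns.mult pint coef_poly; simp)+
  interpret inv: invariant_coordinates \<Psi> p r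
  proof
    fix c :: "'f alg_closure vec" assume c: "c \<in> R_set"
    have q: "c $ 0 \<noteq> 0" "quartic c \<noteq> 0" using c by (simp_all add: R_nonzero)
    note le = levi_part_entries[OF assms(4) q]
    show "\<Psi> c \<in> carrier_mat 27 27" by (simp add: \<Psi>[OF c])
    show "\<Psi> (flip c) = \<Psi> c" by (simp add: \<Psi>[OF c] \<Psi>[OF flip_R[OF c]] levi_part_flip)
    show "p 0 (\<Psi> c) = c $ 0" by (simp add: p_def coef[OF c] le)
    show "r (\<Psi> c) = c $ 2 * c $ 3" by (simp add: r_def coef[OF c] le mult_ac sq sq')
    fix i :: nat assume "0 < i" "i < 5"
    then have "i = 1 \<or> i = 2 \<or> i = 3 \<or> i = 4" by auto
    then show "p i (\<Psi> c) = c $ i * c $ 5"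
      by (elim disjE) (simp_all add: p_def coef[OF c] le mult_ac sq sq')
  next
    fix i j :: nat assume ij: "i < 27" "j < 27"
    have "nearly_poly_mat (\<lambda>c. \<mu> * levi_part c)"
      by (intro nearly_poly_mat_mult nearly_poly_mat_int int nearly_poly_levi_part cv)
    then have np: "nearly_poly (\<lambda>c. ent (\<mu> * levi_part c) i j)"
      unfolding nearly_poly_mat_def using ij by blast
    obtain e k where e: "e \<in> polyfuns A6" "\<And>c. c \<in> R_set \<Longrightarrow> ent (\<mu> * levi_part c) i j * (c $ 0 * quartic c) ^ k = e c"
      by (rule nearly_polyE[OF np], rule that)
    show "\<exists>e\<in>polyfuns A6. \<exists>k. \<forall>c\<in>R_set. \<Psi> c $$ (i, j) * (c $ 0 * quartic c) ^ k = e c"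
      by (intro bexI[OF _ e(1)] exI[of _ k] ballI) (simp only: \<Psi> e(2)[unfolded ent.rep_eq])
  next
    fix i :: nat assume "i < 5"
    show "p i \<in> polyfuns Mat27"
      unfolding p_def by (simp only: p_polys simp_thms split: if_split)
  next
    show "r \<in> polyfuns Mat27" unfolding r_def by (intro polyfuns.mult coef_poly pint) simp_all
  qed
  show ?thesis using first inv.etale_double_cover inv.degree_two by blast
qed

end
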